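(* Let $d\ge 4$ be an integer. There exist two non-isometric flat tori $\mathbb{T}$ and $\mathbb{T}'$ of dimension $d$ whose local Weyl counting functions are identical everywhere, that is, $$N_{\mathbb{T}}(x,\lambda)=N_{\mathbb{T}'}(y,\lambda)\qquad\text{for all }x\in\mathbb{T},\ y\in\mathbb{T}',\ \lambda\in\mathbb{R}.$$
   Context: A flat torus of dimension $d$ is a quotient $\mathbb{R}^d/\Gamma$ by a full-rank lattice $\Gamma\subset\mathbb{R}^d$, with the Riemannian metric induced by the Euclidean metric. For a compact connected Riemannian manifold $(M,g)$ without boundary, let $\{e_{\lambda_j}\}_{j\ge1}$ be an orthonormal basis of $L^2(M,dV_g)$ consisting of eigenfunctions of the Laplace--Beltrami operator, $-\Delta_g e_{\lambda_j}=\lambda_j^2e_{\lambda_j}$, where $0=\lambda_1<\lambda_2\le\lambda_3\le\cdots$ are listed with multiplicity. The local Weyl counting function of $M$ is $$N_M(x,\lambda)=\sum_{\lambda_j\le\lambda}|e_{\lambda_j}(x)|^2,\qquad x\in M,\ \lambda\in\mathbb{R}.$$ It does not depend on the choice of the orthonormal basis. *)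

theory Defs
  imports "HOL-Analysis.Analysis"
begin

text \<open>\<open>C_k_on k U F\<close> is only meant for open sets \<open>U\<close>: the derivatives are full
  (two-sided) derivatives at the points of \<open>U\<close>, and all directional derivatives are again
  required to be of class \<open>C\<^sup>k\<close>.\<close>

primrec C_k_on :: "nat \<Rightarrow> 'a::real_normed_vector set \<Rightarrow> ('a \<Rightarrow> 'b::real_normed_vector) \<Rightarrow> bool"
  where
    "C_k_on 0 U F \<longleftrightarrow> continuous_on U F"
  | "C_k_on (Suc k) U F \<longleftrightarrow>
       (\<forall>x\<in>U. F differentiable (at x)) \<and>
       (\<forall>v. C_k_on k U (\<lambda>x. frechet_derivative F (at x) v))"

definition smooth_on :: "'a::real_normed_vector set \<Rightarrow> ('a \<Rightarrow> 'b::real_normed_vector) \<Rightarrow> bool"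
  where "smooth_on U F \<longleftrightarrow> (\<forall>k. C_k_on k U F)"

definition euclidean_laplacian :: "('a::euclidean_space \<Rightarrow> 'b::real_normed_vector) \<Rightarrow> 'a \<Rightarrow> 'b"
  where "euclidean_laplacian F x =
    (\<Sum>b\<in>Basis. frechet_derivative (\<lambda>y. frechet_derivative F (at y) b) (at x) b)"

definition lattice_generated_by :: "real^'n^'n \<Rightarrow> (real^'n) set"
  where "lattice_generated_by B = {B *v z | z. \<forall>i. z $ i \<in> \<int>}"

definition full_rank_lattice :: "(real^'n) set \<Rightarrow> bool"
  where "full_rank_lattice \<Gamma> \<longleftrightarrow> (\<exists>B. invertible B \<and> \<Gamma> = lattice_generated_by B)"

definition torus_proj :: "(real^'n) set \<Rightarrow> real^'n \<Rightarrow> (real^'n) set"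
  where "torus_proj \<Gamma> x = (\<lambda>\<gamma>. x + \<gamma>) ` \<Gamma>"

text \<open>The underlying set of \<open>\<real>\<^sup>d/\<Gamma>\<close>: points are cosets of \<open>\<Gamma>\<close>.\<close>

definition torus :: "(real^'n) set \<Rightarrow> (real^'n) set set"
  where "torus \<Gamma> = range (torus_proj \<Gamma>)"

text \<open>The smooth structure and the metric of \<open>torus \<Gamma>\<close> are those for which
  \<open>torus_proj \<Gamma>\<close> is a smooth covering and a local isometry. So a map between tori is smooth
  iff near every point it lifts to a smooth map between Euclidean spaces, and its differential
  is, in the standard trivialisations of the tangent bundles, the derivative of such a lift.\<close>

definition local_lift ::
  "(real^'n) set \<Rightarrow> (real^'n) set \<Rightarrow> ((real^'n) set \<Rightarrow> (real^'n) set)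
     \<Rightarrow> (real^'n) set \<Rightarrow> (real^'n \<Rightarrow> real^'n) \<Rightarrow> bool"
  where "local_lift \<Gamma> \<Gamma>' \<phi> U F \<longleftrightarrow>
    open U \<and> smooth_on U F \<and> (\<forall>x\<in>U. \<phi> (torus_proj \<Gamma> x) = torus_proj \<Gamma>' (F x))"

definition smooth_torus_map ::
  "(real^'n) set \<Rightarrow> (real^'n) set \<Rightarrow> ((real^'n) set \<Rightarrow> (real^'n) set) \<Rightarrow> bool"
  where "smooth_torus_map \<Gamma> \<Gamma>' \<phi> \<longleftrightarrow> (\<forall>x. \<exists>U F. x \<in> U \<and> local_lift \<Gamma> \<Gamma>' \<phi> U F)"

definition torus_diffeomorphism ::
  "(real^'n) set \<Rightarrow> (real^'n) set \<Rightarrow> ((real^'n) set \<Rightarrow> (real^'n) set) \<Rightarrow> bool"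
  where "torus_diffeomorphism \<Gamma> \<Gamma>' \<phi> \<longleftrightarrow>
    bij_betw \<phi> (torus \<Gamma>) (torus \<Gamma>') \<and>
    smooth_torus_map \<Gamma> \<Gamma>' \<phi> \<and> smooth_torus_map \<Gamma>' \<Gamma> (inv_into (torus \<Gamma>) \<phi>)"

definition torus_isometry ::
  "(real^'n) set \<Rightarrow> (real^'n) set \<Rightarrow> ((real^'n) set \<Rightarrow> (real^'n) set) \<Rightarrow> bool"
  where "torus_isometry \<Gamma> \<Gamma>' \<phi> \<longleftrightarrow>
    torus_diffeomorphism \<Gamma> \<Gamma>' \<phi> \<and>
    (\<forall>U F. local_lift \<Gamma> \<Gamma>' \<phi> U F \<longrightarrow>
      (\<forall>x\<in>U. \<forall>v w. frechet_derivative F (at x) v \<bullet> frechet_derivative F (at x) w = v \<bullet> w))"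

definition isometric_tori :: "(real^'n) set \<Rightarrow> (real^'n) set \<Rightarrow> bool"
  where "isometric_tori \<Gamma> \<Gamma>' \<longleftrightarrow> (\<exists>\<phi>. torus_isometry \<Gamma> \<Gamma>' \<phi>)"

text \<open>The volume is the image of Lebesgue measure on a fundamental parallelepiped. The choice of
  the lattice basis is immaterial, since any two parallelepipeds are fundamental domains.\<close>

definition lattice_basis :: "(real^'n) set \<Rightarrow> real^'n^'n"
  where "lattice_basis \<Gamma> = (SOME B. invertible B \<and> \<Gamma> = lattice_generated_by B)"

definition fundamental_domain :: "(real^'n) set \<Rightarrow> (real^'n) set"
  where "fundamental_domain \<Gamma> = {lattice_basis \<Gamma> *v t | t. \<forall>i. 0 \<le> t $ i \<and> t $ i < 1}"

definition torus_borel :: "(real^'n) set \<Rightarrow> (real^'n) set measure"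
  where "torus_borel \<Gamma> = sigma (torus \<Gamma>) {A. A \<subseteq> torus \<Gamma> \<and> torus_proj \<Gamma> -` A \<in> sets borel}"

definition torus_volume :: "(real^'n) set \<Rightarrow> (real^'n) set measure"
  where "torus_volume \<Gamma> =
    distr (restrict_space lborel (fundamental_domain \<Gamma>)) (torus_borel \<Gamma>) (torus_proj \<Gamma>)"

lemma space_torus_borel: "space (torus_borel \<Gamma>) = torus \<Gamma>"
  unfolding torus_borel_def by (rule space_measure_of) auto

lemma sets_torus_borel:
  fixes \<Gamma> :: "(real^'n) set"
  shows "sets (torus_borel \<Gamma>) = {A. A \<subseteq> torus \<Gamma> \<and> torus_proj \<Gamma> -` A \<in> sets borel}"
proof -
  have "sigma_algebra (torus \<Gamma>) {A. A \<subseteq> torus \<Gamma> \<and> torus_proj \<Gamma> -` A \<in> sets borel}"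
  proof (rule sigma_algebra_iff2[THEN iffD2], intro conjI ballI allI impI)
    fix A assume A: "A \<in> {A. A \<subseteq> torus \<Gamma> \<and> torus_proj \<Gamma> -` A \<in> sets borel}"
    have "torus_proj \<Gamma> -` (torus \<Gamma> - A) = - (torus_proj \<Gamma> -` A)"
      by (auto simp: torus_def)
    moreover have "- (torus_proj \<Gamma> -` A) \<in> sets borel"
      using A by (intro borel_comp) auto
    ultimately show "torus \<Gamma> - A \<in> {A. A \<subseteq> torus \<Gamma> \<and> torus_proj \<Gamma> -` A \<in> sets borel}"
      by auto
  next
    fix A :: "nat \<Rightarrow> (real^'n) set set"
    assume "range A \<subseteq> {A. A \<subseteq> torus \<Gamma> \<and> torus_proj \<Gamma> -` A \<in> sets borel}"
    then show "\<Union> (range A) \<in> {A. A \<subseteq> torus \<Gamma> \<and> torus_proj \<Gamma> -` A \<in> sets borel}"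
      by (auto simp: vimage_Union)
  qed auto
  then show ?thesis
    unfolding torus_borel_def by (rule sigma_algebra.sets_measure_of_eq)
qed

lemma measurable_torus_proj: "torus_proj \<Gamma> \<in> borel \<rightarrow>\<^sub>M torus_borel \<Gamma>"
  by (rule measurableI) (auto simp: space_torus_borel sets_torus_borel torus_def)

definition square_integrable :: "'a measure \<Rightarrow> ('a \<Rightarrow> complex) \<Rightarrow> bool"
  where "square_integrable M f \<longleftrightarrow>
    f \<in> borel_measurable M \<and> integrable M (\<lambda>p. (norm (f p))\<^sup>2)"

definition l2_inner :: "'a measure \<Rightarrow> ('a \<Rightarrow> complex) \<Rightarrow> ('a \<Rightarrow> complex) \<Rightarrow> complex"
  where "l2_inner M f g = (\<integral>p. f p * cnj (g p) \<partial>M)"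

definition l2_orthonormal_basis :: "'a measure \<Rightarrow> (nat \<Rightarrow> 'a \<Rightarrow> complex) \<Rightarrow> bool"
  where "l2_orthonormal_basis M e \<longleftrightarrow>
    (\<forall>j. square_integrable M (e j)) \<and>
    (\<forall>i j. l2_inner M (e i) (e j) = (if i = j then 1 else 0)) \<and>
    (\<forall>f. square_integrable M f \<longrightarrow>
      (\<lambda>n. \<integral>p. (norm (f p - (\<Sum>j<n. l2_inner M f (e j) * e j p)))\<^sup>2 \<partial>M) \<longlonglongrightarrow> 0)"

definition smooth_torus_function :: "(real^'n) set \<Rightarrow> ((real^'n) set \<Rightarrow> complex) \<Rightarrow> bool"
  where "smooth_torus_function \<Gamma> f \<longleftrightarrow> smooth_on UNIV (\<lambda>x. f (torus_proj \<Gamma> x))"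

text \<open>In the flat local coordinates given by \<open>torus_proj \<Gamma>\<close> the metric tensor is the identity, so
  the Laplace--Beltrami operator is the Euclidean Laplacian of the periodic lift; the result does
  not depend on the representative of the coset.\<close>

definition torus_laplacian ::
  "(real^'n) set \<Rightarrow> ((real^'n) set \<Rightarrow> complex) \<Rightarrow> (real^'n) set \<Rightarrow> complex"
  where "torus_laplacian \<Gamma> f p =
    euclidean_laplacian (\<lambda>x. f (torus_proj \<Gamma> x)) (SOME x. torus_proj \<Gamma> x = p)"

text \<open>\<open>ev j\<close> is the frequency (the square root of the eigenvalue) of \<open>e j\<close>. Indices start at
  \<open>0\<close>, so \<open>ev 0\<close> is the frequency \<open>0\<close> of the constants.\<close>

definition laplace_eigenbasis ::
  "(real^'n) set \<Rightarrow> (nat \<Rightarrow> (real^'n) set \<Rightarrow> complex) \<Rightarrow> (nat \<Rightarrow> real) \<Rightarrow> bool"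
  where "laplace_eigenbasis \<Gamma> e ev \<longleftrightarrow>
    l2_orthonormal_basis (torus_volume \<Gamma>) e \<and>
    (\<forall>j. smooth_torus_function \<Gamma> (e j)) \<and>
    (\<forall>j. \<forall>p\<in>torus \<Gamma>. - torus_laplacian \<Gamma> (e j) p = complex_of_real ((ev j)\<^sup>2) * e j p) \<and>
    ev 0 = 0 \<and> 0 < ev 1 \<and> mono ev"

text \<open>For a full-rank lattice an eigenbasis exists, the index set of the sum is finite because the
  frequencies tend to infinity, and the value does not depend on the chosen eigenbasis.\<close>

definition local_weyl_count :: "(real^'n) set \<Rightarrow> (real^'n) set \<Rightarrow> real \<Rightarrow> real"
  where "local_weyl_count \<Gamma> p r =
    (let b = (SOME b. laplace_eigenbasis \<Gamma> (fst b) (snd b))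
     in \<Sum>j | snd b j \<le> r. (norm (fst b j p))\<^sup>2)"

end

theory Submission
  imports Defs
begin

text \<open>
  On a flat torus \<open>\<real>\<^sup>d/\<Gamma>\<close> the characters \<open>x \<mapsto> exp (2 \<pi> \<i> \<xi> \<bullet> x)\<close>, for \<open>\<xi>\<close> in the dual
  lattice, are orthogonal eigenfunctions with frequency \<open>2 \<pi> |\<xi>|\<close> and constant modulus. They are
  complete, so the local Weyl counting function is the same at every point:
  \<open>N(x, r) = #{\<xi> : 2 \<pi> |\<xi>| \<le> r} / vol\<close> (\<open>local_weyl_count_eq\<close>). It therefore suffices to find
  two lattices of equal covolume whose duals have the same number of vectors of each length
  but which are not congruent.

  Such a pair comes from the four-dimensional family of Conway and Sloane. Let \<open>S\<close> be the
  antisymmetric \<open>4 \<times> 4\<close> sign matrix with \<open>S\<^sup>2 = -3\<close> given by \<open>skew\<close>, and let the duals be the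
  images of \<open>\<int>\<^sup>4\<close> under \<open>3 + S\<close> and \<open>3 - S\<close>, followed by a diagonal scaling with weights
  \<open>sqrt (wt i)\<close>; in higher dimension the remaining coordinates are left alone. Since
  \<open>(3 + S)(3 - S) = 12\<close>, membership is a divisibility condition modulo \<open>12\<close>.
  Modulo \<open>3\<close> both conditions define the tetracode, in which every word has a zero coordinate;
  modulo \<open>4\<close> they agree on vectors with even entries and differ by a sign change on vectors with
  odd entries. Hence negating, in an odd vector, the first entry divisible by \<open>3\<close> is a bijection
  between the two lattices (\<open>flip_mem\<close>), and it preserves all absolute values of coordinates, so
  it preserves lengths for every choice of weights. The covolumes agree because the linear map
  between the two lattices maps an ellipsoid onto itself and hence preserves Lebesgue measure
  (\<open>vol_linear_image\<close>).

  For non-isometry, an isometry of flat tori lifts locally to an affine isometry, and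
  the linear part is the same everywhere, so the lattices are related by an orthogonal map
  (\<open>isometric_tori_imp_congruent\<close>). If the weights are linearly independent over the rationals,
  an orthogonal map between the lattices can only change the signs of the coordinates, the
  same signs for all vectors (\<open>congruence_preserves_coordinates\<close>, \<open>not_congruent\<close>). The tetracode
  forces these signs to be equal, and \<open>-1\<close> does not exchange the two conditions modulo \<open>4\<close>.

  The analytic core is the completeness of the characters (\<open>trig_dense\<close>, by Stone--Weierstrass on the
  image of the torus in a product of circles) and the fact that the count does not depend on the
  eigenbasis: an eigenfunction has nonzero coefficients only at characters of its own frequency, and
  two orthonormal bases so related have the same local counts (\<open>spectral_counts_agree\<close>).
\<close>

section \<open>Orthonormal bases of L2 and spectral counts\<close>

lemma square_integrableD:
  assumes "square_integrable M f"
  shows "f \<in> borel_measurable M" "integrable M (\<lambda>p. (norm (f p))\<^sup>2)"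
  using assms by (auto simp: square_integrable_def)

lemma integrable_mult_cnj:
  assumes "square_integrable M f" "square_integrable M g"
  shows "integrable M (\<lambda>p. f p * cnj (g p))"
proof (rule Bochner_Integration.integrable_bound)
  show "integrable M (\<lambda>p. (norm (f p))\<^sup>2 + (norm (g p))\<^sup>2)"
    using assms by (auto simp: square_integrable_def)
  have cnj: "(\<lambda>p. cnj (g p)) \<in> borel_measurable M"
    using assms(2) unfolding square_integrable_def
    by (intro borel_measurable_continuous_on[where f = cnj]) (auto intro: continuous_intros)
  show "(\<lambda>p. f p * cnj (g p)) \<in> borel_measurable M"
    using cnj assms(1) by (auto simp: square_integrable_def)
  have "a * b \<le> a\<^sup>2 + b\<^sup>2" if "0 \<le> a" "0 \<le> b" for a b :: real
    using sum_squares_bound[of a b] mult_nonneg_nonneg[OF that] by linarith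
  then show "AE p in M. norm (f p * cnj (g p)) \<le> norm ((norm (f p))\<^sup>2 + (norm (g p))\<^sup>2)"
    by (auto simp: norm_mult)
qed

lemma square_integrable_scale:
  assumes "square_integrable M f"
  shows "square_integrable M (\<lambda>p. c * f p)"
  using assms by (auto simp: square_integrable_def norm_mult power_mult_distrib)

lemma norm_add_power2_le: "(norm (x + y))\<^sup>2 \<le> 2 * (norm x)\<^sup>2 + 2 * (norm (y::complex))\<^sup>2"
proof -
  have "(norm (x + y))\<^sup>2 \<le> (norm x + norm y)\<^sup>2"
    by (intro power_mono norm_triangle_ineq) auto
  also have "\<dots> \<le> 2 * (norm x)\<^sup>2 + 2 * (norm y)\<^sup>2"
    using sum_squares_bound[of "norm x" "norm y"] by (simp add: power2_sum)
  finally show ?thesis .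
qed

lemma square_integrable_add:
  assumes "square_integrable M f" "square_integrable M g"
  shows "square_integrable M (\<lambda>p. f p + g p)"
  unfolding square_integrable_def
proof
  show m: "(\<lambda>p. f p + g p) \<in> borel_measurable M"
    using assms by (auto simp: square_integrable_def)
  show "integrable M (\<lambda>p. (norm (f p + g p))\<^sup>2)"
  proof (rule Bochner_Integration.integrable_bound)
    show "integrable M (\<lambda>p. 2 * (norm (f p))\<^sup>2 + 2 * (norm (g p))\<^sup>2)"
      using assms by (auto simp: square_integrable_def)
    show "(\<lambda>p. (norm (f p + g p))\<^sup>2) \<in> borel_measurable M"
      using m by measurable
    show "AE p in M. norm ((norm (f p + g p))\<^sup>2) \<le> norm (2 * (norm (f p))\<^sup>2 + 2 * (norm (g p))\<^sup>2)"
      using norm_add_power2_le by auto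
  qed
qed

lemma square_integrable_diff:
  assumes "square_integrable M f" "square_integrable M g"
  shows "square_integrable M (\<lambda>p. f p - g p)"
  using square_integrable_add[OF assms(1) square_integrable_scale[OF assms(2), of "-1"]] by simp

lemma square_integrable_sum:
  assumes "finite I" "\<And>i. i \<in> I \<Longrightarrow> square_integrable M (f i)"
  shows "square_integrable M (\<lambda>p. \<Sum>i\<in>I. f i p)"
  using assms
proof (induction I)
  case empty
  then show ?case by (simp add: square_integrable_def)
next
  case (insert i I)
  then show ?case using square_integrable_add[of M "f i" "\<lambda>p. \<Sum>i\<in>I. f i p"] by simp
qed

lemma square_integrable_lincomb:
  assumes "finite I" "\<And>i. i \<in> I \<Longrightarrow> square_integrable M (f i)"
  shows "square_integrable M (\<lambda>p. \<Sum>i\<in>I. a i * f i p)"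
  using assms by (intro square_integrable_sum square_integrable_scale)

lemma l2_inner_commute: "l2_inner M g f = cnj (l2_inner M f g)"
  unfolding l2_inner_def by (simp add: mult.commute flip: Bochner_Integration.integral_cnj)

lemma l2_inner_self: "l2_inner M f f = of_real (\<integral>p. (norm (f p))\<^sup>2 \<partial>M)"
  unfolding l2_inner_def integral_complex_of_real[symmetric]
  by (simp add: complex_norm_square del: of_real_power)

lemma l2_inner_diff_left:
  assumes "square_integrable M f" "square_integrable M g" "square_integrable M h"
  shows "l2_inner M (\<lambda>p. f p - g p) h = l2_inner M f h - l2_inner M g h"
  unfolding l2_inner_def using assms by (simp add: left_diff_distrib integrable_mult_cnj)

lemma l2_inner_diff_right:
  assumes "square_integrable M f" "square_integrable M g" "square_integrable M h"
  shows "l2_inner M h (\<lambda>p. f p - g p) = l2_inner M h f - l2_inner M h g"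
  unfolding l2_inner_def using assms by (simp add: right_diff_distrib integrable_mult_cnj)

lemma l2_inner_lincomb_left:
  assumes "\<And>i. i \<in> I \<Longrightarrow> square_integrable M (f i)" "square_integrable M h"
  shows "l2_inner M (\<lambda>p. \<Sum>i\<in>I. a i * f i p) h = (\<Sum>i\<in>I. a i * l2_inner M (f i) h)"
proof -
  have "l2_inner M (\<lambda>p. \<Sum>i\<in>I. a i * f i p) h = (\<integral>p. (\<Sum>i\<in>I. a i * (f i p * cnj (h p))) \<partial>M)"
    unfolding l2_inner_def by (simp add: sum_distrib_right mult.assoc)
  also have "\<dots> = (\<Sum>i\<in>I. a i * l2_inner M (f i) h)"
    unfolding l2_inner_def using assms
    by (subst Bochner_Integration.integral_sum) (auto intro!: integrable_mult_cnj)
  finally show ?thesis .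
qed

lemma l2_inner_lincomb_right:
  assumes "\<And>i. i \<in> I \<Longrightarrow> square_integrable M (f i)" "square_integrable M h"
  shows "l2_inner M h (\<lambda>p. \<Sum>i\<in>I. a i * f i p) = (\<Sum>i\<in>I. cnj (a i) * l2_inner M h (f i))"
proof -
  have "l2_inner M h (\<lambda>p. \<Sum>i\<in>I. a i * f i p) = cnj (\<Sum>i\<in>I. a i * l2_inner M (f i) h)"
    using l2_inner_lincomb_left[OF assms, where a = a]
    by (subst l2_inner_commute) simp
  also have "\<dots> = (\<Sum>i\<in>I. cnj (a i) * cnj (l2_inner M (f i) h))"
    by simp
  also have "\<dots> = (\<Sum>i\<in>I. cnj (a i) * l2_inner M h (f i))"
    by (simp only: l2_inner_commute[where f = "f _" and g = h])
  finally show ?thesis .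
qed

definition l2_orthonormal_on :: "'a measure \<Rightarrow> 'i set \<Rightarrow> ('i \<Rightarrow> 'a \<Rightarrow> complex) \<Rightarrow> bool"
  where "l2_orthonormal_on M I e \<longleftrightarrow>
    (\<forall>i\<in>I. square_integrable M (e i)) \<and>
    (\<forall>i\<in>I. \<forall>j\<in>I. l2_inner M (e i) (e j) = (if i = j then 1 else 0))"

text \<open>Completing the square in the coefficients; both Bessel's inequality and the optimality of the
  Fourier coefficients can be read off from the right-hand side.\<close>

lemma l2_dist_lincomb:
  assumes "finite I" "l2_orthonormal_on M I e" "square_integrable M f"
  shows "(\<integral>p. (norm (f p - (\<Sum>i\<in>I. a i * e i p)))\<^sup>2 \<partial>M) =
    (\<integral>p. (norm (f p))\<^sup>2 \<partial>M) - (\<Sum>i\<in>I. (norm (l2_inner M f (e i)))\<^sup>2)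
      + (\<Sum>i\<in>I. (norm (l2_inner M f (e i) - a i))\<^sup>2)"
proof -
  define S where "S = (\<lambda>p. \<Sum>i\<in>I. a i * e i p)"
  define c where "c = (\<lambda>i. l2_inner M f (e i))"
  have e: "\<And>i. i \<in> I \<Longrightarrow> square_integrable M (e i)"
    using assms(2) by (auto simp: l2_orthonormal_on_def)
  have S: "square_integrable M S"
    unfolding S_def using assms(1) e by (rule square_integrable_lincomb)
  have Sf: "l2_inner M S f = (\<Sum>i\<in>I. a i * cnj (c i))"
    unfolding S_def using e assms(3)
    by (subst l2_inner_lincomb_left) (auto simp: c_def l2_inner_commute[of M f])
  have fS: "l2_inner M f S = (\<Sum>i\<in>I. cnj (a i) * c i)"
    unfolding S_def using e assms(3) by (subst l2_inner_lincomb_right) (auto simp: c_def)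
  have eS: "l2_inner M (e i) S = cnj (a i)" if "i \<in> I" for i
  proof -
    have "l2_inner M (e i) S = (\<Sum>j\<in>I. cnj (a j) * l2_inner M (e i) (e j))"
      unfolding S_def using e that by (subst l2_inner_lincomb_right) auto
    also have "\<dots> = (\<Sum>j\<in>I. if j = i then cnj (a j) else 0)"
      using assms(2) that by (intro sum.cong) (auto simp: l2_orthonormal_on_def)
    also have "\<dots> = cnj (a i)" using assms(1) that by simp
    finally show ?thesis .
  qed
  have SS: "l2_inner M S S = (\<Sum>i\<in>I. a i * cnj (a i))"
    using e S eS by (subst (1) S_def, subst l2_inner_lincomb_left) auto
  have "complex_of_real (\<integral>p. (norm (f p - S p))\<^sup>2 \<partial>M) = l2_inner M (\<lambda>p. f p - S p) (\<lambda>p. f p - S p)"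
    by (rule l2_inner_self[symmetric])
  also have "\<dots> = l2_inner M f f - l2_inner M f S - (l2_inner M S f - l2_inner M S S)"
    using assms(3) S square_integrable_diff[OF assms(3) S]
    by (simp add: l2_inner_diff_left l2_inner_diff_right)
  also have "\<dots> = l2_inner M f f - (\<Sum>i\<in>I. c i * cnj (c i)) + (\<Sum>i\<in>I. (c i - a i) * cnj (c i - a i))"
    unfolding Sf fS SS by (simp add: algebra_simps sum.distrib sum_subtractf)
  also have "\<dots> = complex_of_real ((\<integral>p. (norm (f p))\<^sup>2 \<partial>M) - (\<Sum>i\<in>I. (norm (c i))\<^sup>2)
      + (\<Sum>i\<in>I. (norm (c i - a i))\<^sup>2))"
    by (simp add: l2_inner_self complex_norm_square del: of_real_power)
  finally show ?thesis unfolding S_def c_def by (simp only: of_real_eq_iff)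
qed

lemma l2_best_approximation:
  assumes "finite I" "l2_orthonormal_on M I e" "square_integrable M f"
  shows "(\<integral>p. (norm (f p - (\<Sum>i\<in>I. l2_inner M f (e i) * e i p)))\<^sup>2 \<partial>M)
    \<le> (\<integral>p. (norm (f p - (\<Sum>i\<in>I. a i * e i p)))\<^sup>2 \<partial>M)"
  by (simp add: l2_dist_lincomb[OF assms] sum_nonneg)

lemma Bessel_inequality:
  assumes "finite I" "l2_orthonormal_on M I e" "square_integrable M f"
  shows "(\<Sum>i\<in>I. (norm (l2_inner M f (e i)))\<^sup>2) \<le> (\<integral>p. (norm (f p))\<^sup>2 \<partial>M)"
proof -
  have "0 \<le> (\<integral>p. (norm (f p - (\<Sum>i\<in>I. l2_inner M f (e i) * e i p)))\<^sup>2 \<partial>M)"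
    by (rule integral_nonneg_AE) auto
  then show ?thesis by (simp add: l2_dist_lincomb[OF assms])
qed

lemma l2_dist_triangle:
  assumes "square_integrable M f" "square_integrable M g" "square_integrable M h"
  shows "(\<integral>p. (norm (f p - h p))\<^sup>2 \<partial>M) \<le>
    2 * (\<integral>p. (norm (f p - g p))\<^sup>2 \<partial>M) + 2 * (\<integral>p. (norm (g p - h p))\<^sup>2 \<partial>M)"
proof -
  have i: "integrable M (\<lambda>p. (norm (f p - g p))\<^sup>2)" "integrable M (\<lambda>p. (norm (g p - h p))\<^sup>2)"
    "integrable M (\<lambda>p. (norm (f p - h p))\<^sup>2)"
    using assms by (auto intro!: square_integrableD square_integrable_diff)
  have "(\<integral>p. (norm (f p - h p))\<^sup>2 \<partial>M) \<le>
      (\<integral>p. 2 * (norm (f p - g p))\<^sup>2 + 2 * (norm (g p - h p))\<^sup>2 \<partial>M)"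
  proof (rule integral_mono)
    fix p show "(norm (f p - h p))\<^sup>2 \<le> 2 * (norm (f p - g p))\<^sup>2 + 2 * (norm (g p - h p))\<^sup>2"
      using norm_add_power2_le[of "f p - g p" "g p - h p"] by simp
  qed (use i in auto)
  also have "\<dots> = 2 * (\<integral>p. (norm (f p - g p))\<^sup>2 \<partial>M) + 2 * (\<integral>p. (norm (g p - h p))\<^sup>2 \<partial>M)"
    using i by simp
  finally show ?thesis .
qed

lemma l2_orthonormal_basisD:
  assumes "l2_orthonormal_basis M e"
  shows "square_integrable M (e j)" "l2_orthonormal_on M I e"
    "l2_inner M (e i) (e j) = (if i = j then 1 else 0)"
    "square_integrable M f \<Longrightarrow>
      (\<lambda>n. \<integral>p. (norm (f p - (\<Sum>j<n. l2_inner M f (e j) * e j p)))\<^sup>2 \<partial>M) \<longlonglongrightarrow> 0"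
  using assms by (auto simp: l2_orthonormal_basis_def l2_orthonormal_on_def)

text \<open>When only finitely many Fourier coefficients are nonzero, the partial sums become constant, so
  convergence in the mean is an identity in \<open>L\<^sup>2\<close>.\<close>

lemma l2_expansion_finite:
  assumes e: "l2_orthonormal_basis M e" and f: "square_integrable M f"
    and I: "finite I" and zero: "\<And>j. j \<notin> I \<Longrightarrow> l2_inner M f (e j) = 0"
  shows "(\<integral>p. (norm (f p - (\<Sum>j\<in>I. l2_inner M f (e j) * e j p)))\<^sup>2 \<partial>M) = 0"
proof -
  obtain N where N: "I \<subseteq> {..<N}"
    using I finite_nat_iff_bounded by blast
  have "(\<Sum>j<n. l2_inner M f (e j) * e j p) = (\<Sum>j\<in>I. l2_inner M f (e j) * e j p)" if "n \<ge> N" for n p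
    using N that zero by (intro sum.mono_neutral_right) auto
  then have "eventually (\<lambda>n. (\<integral>p. (norm (f p - (\<Sum>j<n. l2_inner M f (e j) * e j p)))\<^sup>2 \<partial>M)
      = (\<integral>p. (norm (f p - (\<Sum>j\<in>I. l2_inner M f (e j) * e j p)))\<^sup>2 \<partial>M)) sequentially"
    unfolding eventually_sequentially by (intro exI[of _ N]) simp
  from tendsto_cong[OF this] l2_orthonormal_basisD(4)[OF e f] show ?thesis
    by (simp add: LIMSEQ_const_iff)
qed

text \<open>The matrix \<open>U\<close> of inner products of the two bases is block diagonal along the frequencies. The blocks
  with frequency at most \<open>r\<close> are finite: there are at least as many \<open>f\<close> as \<open>e\<close>, since rows of \<open>U\<close> have
  square sum \<open>1\<close> and columns at most \<open>1\<close>. Thus the two finite families expand in each other, and the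
  kernel \<open>\<Sum>j. e j q * cnj (e j q)\<close> of the spectral projection can be rewritten in terms of \<open>f\<close>.
  The assumption \<open>vanish\<close> turns identities in \<open>L\<^sup>2\<close> into identities at the point \<open>q\<close>.\<close>

lemma spectral_counts_agree:
  fixes e f :: "nat \<Rightarrow> 'a \<Rightarrow> complex" and ev om :: "nat \<Rightarrow> real"
  assumes e: "l2_orthonormal_basis M e" and f: "l2_orthonormal_basis M f"
    and cross: "\<And>j k. l2_inner M (e j) (f k) \<noteq> 0 \<Longrightarrow> ev j = om k"
    and fin: "finite {k. om k \<le> r}"
    and vanish: "\<And>J K a b. finite J \<Longrightarrow> finite K \<Longrightarrow>
      (\<integral>p. (norm ((\<Sum>j\<in>J. a j * e j p) - (\<Sum>k\<in>K. b k * f k p)))\<^sup>2 \<partial>M) = 0 \<Longrightarrow>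
      (\<Sum>j\<in>J. a j * e j q) - (\<Sum>k\<in>K. b k * f k q) = 0"
  shows "(\<Sum>j | ev j \<le> r. (norm (e j q))\<^sup>2) = (\<Sum>k | om k \<le> r. (norm (f k q))\<^sup>2)"
proof -
  define J where "J = {j. ev j \<le> r}"
  define K where "K = {k. om k \<le> r}"
  define U where "U = (\<lambda>j k. l2_inner M (e j) (f k))"
  have sqe: "square_integrable M (e j)" and sqf: "square_integrable M (f j)" for j
    using l2_orthonormal_basisD(1) e f by auto
  have finK: "finite K" using fin by (simp add: K_def)
  have Uzero: "U j k = 0" if "(j \<in> J) \<noteq> (k \<in> K)" for j k
  proof (rule ccontr)
    assume "U j k \<noteq> 0"
    then have "ev j = om k" using cross[of j k] by (simp add: U_def)
    then show False using that by (simp add: J_def K_def)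
  qed
  have fe: "l2_inner M (f k) (e j) = cnj (U j k)" for j k
    unfolding U_def by (rule l2_inner_commute)
  have L2e: "(\<integral>p. (norm (e j p - (\<Sum>k\<in>K. U j k * f k p)))\<^sup>2 \<partial>M) = 0" if "j \<in> J" for j
    using l2_expansion_finite[OF f sqe finK, of j] Uzero that by (auto simp: U_def)
  have e_eq: "e j q = (\<Sum>k\<in>K. U j k * f k q)" if "j \<in> J" for j
    using vanish[of "{j}" K "\<lambda>_. 1" "U j"] L2e[OF that] finK by simp
  have row: "(\<Sum>k\<in>K. (norm (U j k))\<^sup>2) = 1" if "j \<in> J" for j
  proof -
    have "complex_of_real (\<integral>p. (norm (e j p))\<^sup>2 \<partial>M) = 1"
      using l2_orthonormal_basisD(3)[OF e, of j j] by (simp add: l2_inner_self)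
    then have "(\<integral>p. (norm (e j p))\<^sup>2 \<partial>M) = 1" by simp
    moreover have "(\<integral>p. (norm (e j p - (\<Sum>k\<in>K. U j k * f k p)))\<^sup>2 \<partial>M) =
      (\<integral>p. (norm (e j p))\<^sup>2 \<partial>M) - (\<Sum>k\<in>K. (norm (U j k))\<^sup>2)"
      using l2_dist_lincomb[OF finK l2_orthonormal_basisD(2)[OF f] sqe[of j], where a = "U j"]
      by (simp add: U_def)
    ultimately show ?thesis using L2e[OF that] by linarith
  qed
  have col: "(\<Sum>j\<in>F. (norm (U j k))\<^sup>2) \<le> 1" if "finite F" for F k
  proof -
    have "complex_of_real (\<integral>p. (norm (f k p))\<^sup>2 \<partial>M) = 1"
      using l2_orthonormal_basisD(3)[OF f, of k k] by (simp add: l2_inner_self)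
    then have "(\<integral>p. (norm (f k p))\<^sup>2 \<partial>M) = 1" by simp
    with Bessel_inequality[OF that l2_orthonormal_basisD(2)[OF e] sqf[of k]] show ?thesis
      by (simp add: fe)
  qed
  have "card F \<le> card K" if "finite F" "F \<subseteq> J" for F
  proof -
    have "real (card F) = (\<Sum>j\<in>F. \<Sum>k\<in>K. (norm (U j k))\<^sup>2)"
      using row that by (simp add: subset_iff)
    also have "\<dots> = (\<Sum>k\<in>K. \<Sum>j\<in>F. (norm (U j k))\<^sup>2)" by (rule sum.swap)
    also have "\<dots> \<le> (\<Sum>k\<in>K. 1)" using col[OF that(1)] by (intro sum_mono) auto
    finally show ?thesis by simp
  qed
  then have finJ: "finite J"
    using finite_if_finite_subsets_card_bdd[of J "card K"] by simp
  have L2f: "(\<integral>p. (norm (f k p - (\<Sum>j\<in>J. cnj (U j k) * e j p)))\<^sup>2 \<partial>M) = 0" if "k \<in> K" for k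
    using l2_expansion_finite[OF e sqf[of k] finJ] Uzero[of _ k] that by (simp add: fe)
  have f_eq: "f k q = (\<Sum>j\<in>J. cnj (U j k) * e j q)" if "k \<in> K" for k
  proof -
    have "(\<integral>p. (norm ((\<Sum>j\<in>J. cnj (U j k) * e j p) - (\<Sum>k\<in>{k}. 1 * f k p)))\<^sup>2 \<partial>M) = 0"
      using L2f[OF that] by (simp add: norm_minus_commute[of "f k _"])
    from vanish[OF finJ _ this] show ?thesis by simp
  qed
  have "complex_of_real (\<Sum>j\<in>J. (norm (e j q))\<^sup>2) = (\<Sum>j\<in>J. e j q * cnj (e j q))"
    by (simp add: complex_norm_square del: of_real_power)
  also have "\<dots> = (\<Sum>j\<in>J. e j q * cnj (\<Sum>k\<in>K. U j k * f k q))"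
    using e_eq by (intro sum.cong arg_cong2[where f = "(*)"] arg_cong[where f = cnj]) auto
  also have "\<dots> = (\<Sum>j\<in>J. \<Sum>k\<in>K. cnj (f k q) * (cnj (U j k) * e j q))"
    by (simp add: sum_distrib_left mult_ac)
  also have "\<dots> = (\<Sum>k\<in>K. cnj (f k q) * (\<Sum>j\<in>J. cnj (U j k) * e j q))"
    by (subst sum.swap) (simp add: sum_distrib_left)
  also have "\<dots> = (\<Sum>k\<in>K. cnj (f k q) * f k q)"
    using f_eq by (intro sum.cong arg_cong2[where f = "(*)"]) auto
  also have "\<dots> = complex_of_real (\<Sum>k\<in>K. (norm (f k q))\<^sup>2)"
    by (simp add: complex_norm_square mult.commute del: of_real_power)
  finally show ?thesis unfolding J_def K_def by (simp only: of_real_eq_iff)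
qed

section \<open>Lattices, fundamental domains and the volume of a flat torus\<close>

locale flat_torus =
  fixes \<Gamma> :: "(real^'n) set"
  assumes full_rank: "full_rank_lattice \<Gamma>"
begin

abbreviation B :: "real^'n^'n" where "B \<equiv> lattice_basis \<Gamma>"
abbreviation proj :: "real^'n \<Rightarrow> (real^'n) set" where "proj \<equiv> torus_proj \<Gamma>"
abbreviation T :: "(real^'n) set measure" where "T \<equiv> torus_volume \<Gamma>"
abbreviation P :: "(real^'n) set" where "P \<equiv> fundamental_domain \<Gamma>"

definition coord :: "real^'n \<Rightarrow> real^'n" where "coord x = matrix_inv B *v x"

lemma lattice_basis: "invertible B" "\<Gamma> = lattice_generated_by B"
proof -
  have "\<exists>B. invertible B \<and> \<Gamma> = lattice_generated_by B"
    using full_rank by (simp add: full_rank_lattice_def)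
  then show "invertible B" "\<Gamma> = lattice_generated_by B"
    unfolding lattice_basis_def by (metis (mono_tags, lifting) someI_ex)+
qed

lemma matrix_inv_lattice_basis: "B ** matrix_inv B = mat 1" "matrix_inv B ** B = mat 1"
proof -
  have "\<exists>A'. B ** A' = mat 1 \<and> A' ** B = mat 1"
    using lattice_basis(1) by (simp add: invertible_def)
  from someI_ex[OF this] show "B ** matrix_inv B = mat 1" "matrix_inv B ** B = mat 1"
    unfolding matrix_inv_def by auto
qed

lemma B_coord [simp]: "B *v coord x = x"
  by (simp add: coord_def matrix_vector_mul_assoc matrix_inv_lattice_basis)

lemma coord_B [simp]: "coord (B *v t) = t"
  by (simp add: coord_def matrix_vector_mul_assoc matrix_inv_lattice_basis)

lemma linear_coord: "linear coord"
  unfolding coord_def by (rule matrix_vector_mul_linear)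

lemma coord_add: "coord (x + y) = coord x + coord y"
  and coord_diff: "coord (x - y) = coord x - coord y"
  and coord_minus: "coord (- x) = - coord x"
  and coord_0: "coord 0 = 0"
  using linear_coord by (auto simp: linear_add linear_diff linear_neg linear_0)

lemma continuous_on_coord [continuous_intros]:
  "continuous_on S f \<Longrightarrow> continuous_on S (\<lambda>x. coord (f x))"
  using linear_continuous_on[OF linear_conv_bounded_linear[THEN iffD1, OF linear_coord]]
  by (rule continuous_on_compose2) auto

lemma mem_lattice_iff: "\<gamma> \<in> \<Gamma> \<longleftrightarrow> (\<forall>i. coord \<gamma> $ i \<in> \<int>)"
proof
  assume "\<gamma> \<in> \<Gamma>"
  then obtain z where "\<gamma> = B *v z" "\<forall>i. z $ i \<in> \<int>"
    using lattice_basis(2) by (auto simp: lattice_generated_by_def)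
  then show "\<forall>i. coord \<gamma> $ i \<in> \<int>" by simp
next
  assume "\<forall>i. coord \<gamma> $ i \<in> \<int>"
  then have "B *v coord \<gamma> \<in> lattice_generated_by B"
    unfolding lattice_generated_by_def by blast
  then show "\<gamma> \<in> \<Gamma>" using lattice_basis(2) by simp
qed

lemma lattice_0: "0 \<in> \<Gamma>"
  and lattice_add: "x \<in> \<Gamma> \<Longrightarrow> y \<in> \<Gamma> \<Longrightarrow> x + y \<in> \<Gamma>"
  and lattice_diff: "x \<in> \<Gamma> \<Longrightarrow> y \<in> \<Gamma> \<Longrightarrow> x - y \<in> \<Gamma>"
  and lattice_minus: "x \<in> \<Gamma> \<Longrightarrow> - x \<in> \<Gamma>"
  by (auto simp: mem_lattice_iff coord_add coord_diff coord_minus coord_0)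

lemma proj_eq_iff: "proj x = proj y \<longleftrightarrow> x - y \<in> \<Gamma>"
proof
  assume eq: "proj x = proj y"
  have "x \<in> proj x" using lattice_0 by (force simp: torus_proj_def)
  then have "x \<in> proj y" using eq by simp
  then show "x - y \<in> \<Gamma>" by (auto simp: torus_proj_def)
next
  assume xy: "x - y \<in> \<Gamma>"
  have "x + \<gamma> \<in> (\<lambda>\<gamma>. y + \<gamma>) ` \<Gamma>" if "\<gamma> \<in> \<Gamma>" for \<gamma>
    using lattice_add[OF xy that] by (intro image_eqI[of _ _ "x - y + \<gamma>"]) auto
  moreover have "y + \<gamma> \<in> (\<lambda>\<gamma>. x + \<gamma>) ` \<Gamma>" if "\<gamma> \<in> \<Gamma>" for \<gamma>
    using lattice_diff[OF that xy] by (intro image_eqI[of _ _ "\<gamma> - (x - y)"]) auto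
  ultimately show "proj x = proj y" unfolding torus_proj_def by blast
qed

lemma proj_in_torus [simp]: "proj x \<in> torus \<Gamma>"
  by (simp add: torus_def)

lemma countable_lattice: "countable \<Gamma>"
proof -
  have "\<gamma> \<in> range (\<lambda>f :: 'n \<Rightarrow> int. B *v (\<chi> i. of_int (f i)))" if "\<gamma> \<in> \<Gamma>" for \<gamma>
  proof -
    have "coord \<gamma> = (\<chi> i. of_int \<lfloor>coord \<gamma> $ i\<rfloor>)"
      using that by (simp add: vec_eq_iff mem_lattice_iff)
    then have "\<gamma> = B *v (\<chi> i. of_int \<lfloor>coord \<gamma> $ i\<rfloor>)" by (metis B_coord)
    then show ?thesis by (intro range_eqI[of _ _ "\<lambda>i. \<lfloor>coord \<gamma> $ i\<rfloor>"]) simp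
  qed
  then have "\<Gamma> \<subseteq> range (\<lambda>f :: 'n \<Rightarrow> int. B *v (\<chi> i. of_int (f i)))" by blast
  then show ?thesis by (rule countable_subset) simp
qed

lemma lattice_discrete: obtains \<delta> where "\<delta> > 0" "\<And>\<gamma>. \<gamma> \<in> \<Gamma> \<Longrightarrow> norm \<gamma> < \<delta> \<Longrightarrow> \<gamma> = 0"
proof -
  obtain K where K: "K > 0" "\<And>x. norm (coord x) \<le> norm x * K"
    using bounded_linear.pos_bounded[OF linear_conv_bounded_linear[THEN iffD1, OF linear_coord]] by auto
  show thesis
  proof (rule that[of "1 / K"])
    show "1 / K > 0" using K(1) by simp
    fix \<gamma> assume \<gamma>: "\<gamma> \<in> \<Gamma>" "norm \<gamma> < 1 / K"
    have "coord \<gamma> $ i = 0" for i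
    proof -
      have "\<bar>coord \<gamma> $ i\<bar> \<le> norm \<gamma> * K"
        using component_le_norm_cart[of "coord \<gamma>" i] K(2)[of \<gamma>] by linarith
      also have "\<dots> < 1" using \<gamma>(2) K(1) by (simp add: field_simps)
      finally have "\<bar>coord \<gamma> $ i\<bar> < 1" .
      moreover obtain k where "coord \<gamma> $ i = of_int k"
        using \<gamma>(1) by (auto simp: mem_lattice_iff elim: Ints_cases)
      ultimately show ?thesis by simp
    qed
    then have "coord \<gamma> = 0" by (simp add: vec_eq_iff)
    then show "\<gamma> = 0" by (metis B_coord matrix_vector_mult_0_right)
  qed
qed

lemma mem_fundamental_domain_iff: "x \<in> P \<longleftrightarrow> (\<forall>i. 0 \<le> coord x $ i \<and> coord x $ i < 1)"
proof
  assume "\<forall>i. 0 \<le> coord x $ i \<and> coord x $ i < 1"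
  then have "B *v coord x \<in> P" unfolding fundamental_domain_def by blast
  then show "x \<in> P" by simp
qed (auto simp: fundamental_domain_def)

lemma lattice_tiling: "\<exists>!\<gamma>. \<gamma> \<in> \<Gamma> \<and> x - \<gamma> \<in> P"
proof (rule ex1I)
  let ?\<gamma> = "B *v (\<chi> i. of_int \<lfloor>coord x $ i\<rfloor>)"
  show "?\<gamma> \<in> \<Gamma> \<and> x - ?\<gamma> \<in> P"
  proof
    have "coord x $ i - of_int \<lfloor>coord x $ i\<rfloor> < 1" for i by linarith
    then show "x - ?\<gamma> \<in> P" by (simp add: mem_fundamental_domain_iff coord_diff)
  qed (simp add: mem_lattice_iff)
  fix \<gamma> assume \<gamma>: "\<gamma> \<in> \<Gamma> \<and> x - \<gamma> \<in> P"
  have "coord \<gamma> $ i = of_int \<lfloor>coord x $ i\<rfloor>" for i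
  proof -
    obtain k where "coord \<gamma> $ i = of_int k" using \<gamma> by (auto simp: mem_lattice_iff elim: Ints_cases)
    moreover have "0 \<le> coord x $ i - coord \<gamma> $ i" "coord x $ i - coord \<gamma> $ i < 1"
      using \<gamma> by (auto simp: mem_fundamental_domain_iff coord_diff)
    ultimately show ?thesis by (simp add: floor_unique)
  qed
  then have "coord \<gamma> = (\<chi> i. of_int \<lfloor>coord x $ i\<rfloor>)" by (simp add: vec_eq_iff)
  then show "\<gamma> = ?\<gamma>" by (metis B_coord)
qed

lemma borel_fundamental_domain [measurable]: "P \<in> sets borel"
proof -
  have "P = (\<Inter>i. {x. 0 \<le> coord x $ i} \<inter> {x. coord x $ i < 1})"
    by (auto simp: mem_fundamental_domain_iff)
  moreover have "{x. 0 \<le> coord x $ i} \<inter> {x. coord x $ i < 1} \<in> sets borel" for i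
    by (intro sets.Int borel_closed borel_open closed_Collect_le open_Collect_less continuous_intros)
  ultimately show ?thesis by (simp add: sets.countable_INT')
qed

lemma bounded_fundamental_domain: "bounded P"
proof (rule bounded_subset)
  show "bounded (((*v) B) ` cbox 0 (\<chi> i. 1))"
    by (intro bounded_linear_image bounded_cbox matrix_vector_mul_bounded_linear)
  show "P \<subseteq> ((*v) B) ` cbox 0 (\<chi> i. 1)"
  proof
    fix x assume "x \<in> P"
    then have "coord x \<in> cbox 0 (\<chi> i. 1)"
      by (auto simp: mem_fundamental_domain_iff mem_box_cart less_imp_le)
    then show "x \<in> ((*v) B) ` cbox 0 (\<chi> i. 1)"
      by (intro image_eqI[of _ _ "coord x"]) auto
  qed
qed

text \<open>The fundamental domain without its faces is open, and so witnesses that the domain has positive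
  measure.\<close>

definition interior_domain :: "(real^'n) set" where
  "interior_domain = (\<Inter>i. {x. 0 < coord x $ i} \<inter> {x. coord x $ i < 1})"

lemma open_interior_domain: "open interior_domain"
  unfolding interior_domain_def
  by (intro open_Int open_INT ballI open_Collect_less continuous_intros finite)

lemma interior_domain_subset: "interior_domain \<subseteq> P"
  by (auto simp: interior_domain_def mem_fundamental_domain_iff less_imp_le)

lemma center_in_interior_domain: "B *v (\<chi> i. 1/2) \<in> interior_domain"
  by (simp add: interior_domain_def)

lemma emeasure_fundamental_domain:
  "emeasure lborel P < \<infinity>" "0 < emeasure lborel P"
proof -
  show "emeasure lborel P < \<infinity>"
    by (rule emeasure_bounded_finite[OF bounded_fundamental_domain])
  have "emeasure lborel interior_domain \<noteq> 0"
  proof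
    assume "emeasure lborel interior_domain = 0"
    then have "interior_domain \<in> null_sets lborel"
      using open_interior_domain by (simp add: null_sets_def)
    then have "negligible interior_domain"
      by (simp add: negligible_iff_null_sets null_sets_completionI)
    then show False
      using open_not_negligible[OF open_interior_domain] center_in_interior_domain by blast
  qed
  moreover have "emeasure lborel interior_domain \<le> emeasure lborel P"
    by (intro emeasure_mono interior_domain_subset) auto
  ultimately show "0 < emeasure lborel P" by (auto simp: zero_less_iff_neq_zero)
qed

lemma space_T [simp]: "space T = torus \<Gamma>"
  and sets_T [measurable_cong]: "sets T = sets (torus_borel \<Gamma>)"
  by (simp_all add: torus_volume_def space_torus_borel)

lemma measurable_proj_restrict: "proj \<in> restrict_space lborel P \<rightarrow>\<^sub>M torus_borel \<Gamma>"
  by (rule measurable_restrict_space1) (use measurable_torus_proj in \<open>simp add: measurable_def\<close>)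

text \<open>The Borel sets of the torus form the final \<open>\<sigma>\<close>-algebra with respect to the projection.\<close>

lemma measurable_torus_iff:
  "f \<in> torus_borel \<Gamma> \<rightarrow>\<^sub>M N \<longleftrightarrow> (\<lambda>x. f (proj x)) \<in> borel \<rightarrow>\<^sub>M N"
proof
  assume "f \<in> torus_borel \<Gamma> \<rightarrow>\<^sub>M N"
  then show "(\<lambda>x. f (proj x)) \<in> borel \<rightarrow>\<^sub>M N"
    by (rule measurable_compose[OF measurable_torus_proj])
next
  assume m: "(\<lambda>x. f (proj x)) \<in> borel \<rightarrow>\<^sub>M N"
  show "f \<in> torus_borel \<Gamma> \<rightarrow>\<^sub>M N"
  proof (rule measurableI)
    fix p assume "p \<in> space (torus_borel \<Gamma>)"
    then obtain x where "p = proj x" by (auto simp: space_torus_borel torus_def)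
    then show "f p \<in> space N" using measurable_space[OF m, of x] by simp
  next
    fix A assume "A \<in> sets N"
    from measurable_sets[OF m this]
    have "(\<lambda>x. f (proj x)) -` A \<in> sets borel" by simp
    moreover have "proj -` (f -` A \<inter> torus \<Gamma>) = (\<lambda>x. f (proj x)) -` A" by auto
    ultimately show "f -` A \<inter> space (torus_borel \<Gamma>) \<in> sets (torus_borel \<Gamma>)"
      by (simp add: space_torus_borel sets_torus_borel)
  qed
qed

lemma measurable_T_iff: "f \<in> T \<rightarrow>\<^sub>M N \<longleftrightarrow> (\<lambda>x. f (proj x)) \<in> borel \<rightarrow>\<^sub>M N"
  using measurable_torus_iff measurable_cong_sets[OF sets_T refl] by blast

lemma nn_integral_T:
  assumes "f \<in> borel_measurable T"
  shows "(\<integral>\<^sup>+p. f p \<partial>T) = (\<integral>\<^sup>+x. f (proj x) * indicator P x \<partial>lborel)"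
proof -
  have f: "f \<in> borel_measurable (torus_borel \<Gamma>)"
    using assms measurable_cong_sets[OF sets_T refl] by blast
  have "(\<integral>\<^sup>+p. f p \<partial>T) = (\<integral>\<^sup>+x. f (proj x) \<partial>restrict_space lborel P)"
    unfolding torus_volume_def using f by (subst nn_integral_distr[OF measurable_proj_restrict]) auto
  also have "\<dots> = (\<integral>\<^sup>+x. f (proj x) * indicator P x \<partial>lborel)"
    by (subst nn_integral_restrict_space) auto
  finally show ?thesis .
qed

lemma emeasure_T: "emeasure T (torus \<Gamma>) = emeasure lborel P"
proof -
  have "emeasure T (torus \<Gamma>) = (\<integral>\<^sup>+p. indicator (torus \<Gamma>) p \<partial>T)"
    using sets.top[of T] by simp
  also have "\<dots> = (\<integral>\<^sup>+x. indicator P x \<partial>lborel)"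
    using sets.top[of T] by (subst nn_integral_T) (auto intro!: nn_integral_cong)
  finally show ?thesis by simp
qed

sublocale finite_measure T
  using emeasure_fundamental_domain(1) by (intro finite_measureI) (simp add: emeasure_T)

definition vol :: real where "vol = measure lborel P"

lemma vol_pos: "0 < vol"
  using emeasure_fundamental_domain by (simp add: vol_def measure_def enn2real_positive_iff)

lemma measure_T: "measure T (torus \<Gamma>) = vol"
  by (simp add: vol_def measure_def emeasure_T)

text \<open>Any two fundamental domains give the same integral to a periodic function: cut \<open>S\<close> into the pieces
  \<open>S \<inter> (P + \<gamma>)\<close>, move each of them into \<open>P\<close> by \<open>-\<gamma>\<close>, and observe that the moved pieces tile \<open>P\<close>. As
  \<open>S\<close> may be a translate of \<open>P\<close>, this also yields the translation invariance of the measure on the torus.\<close>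

lemma nn_integral_periodic_domain:
  assumes g [measurable]: "g \<in> borel_measurable borel"
    and per: "\<And>x \<gamma>. \<gamma> \<in> \<Gamma> \<Longrightarrow> g (x + \<gamma>) = g x"
    and S [measurable]: "S \<in> sets borel"
    and S_tiles: "\<And>x. \<exists>!\<gamma>. \<gamma> \<in> \<Gamma> \<and> x - \<gamma> \<in> S"
  shows "(\<integral>\<^sup>+x. g x * indicator S x \<partial>lborel) = (\<integral>\<^sup>+x. g x * indicator P x \<partial>lborel)"
proof -
  have trans: "(\<integral>\<^sup>+x. h (x + v) \<partial>lborel) = (\<integral>\<^sup>+x. h x \<partial>lborel)"
    if [measurable]: "h \<in> borel_measurable borel" for h :: "real^'n \<Rightarrow> ennreal" and v
    by (subst lborel_distr_plus[of v, symmetric], subst nn_integral_distr) (auto simp: add.commute)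
  have tile: "(\<integral>\<^sup>+\<gamma>. indicator R (x - \<gamma>) \<partial>count_space \<Gamma>) = 1"
    if R: "\<exists>!\<gamma>. \<gamma> \<in> \<Gamma> \<and> x - \<gamma> \<in> R" for x R
  proof -
    from R obtain \<gamma>0 where \<gamma>0: "\<gamma>0 \<in> \<Gamma> \<and> x - \<gamma>0 \<in> R"
      and uniq: "\<forall>\<gamma>. \<gamma> \<in> \<Gamma> \<and> x - \<gamma> \<in> R \<longrightarrow> \<gamma> = \<gamma>0"
      by (rule ex1E)
    have eq: "indicator R (x - \<gamma>) = (indicator {\<gamma>0} \<gamma> :: ennreal)" if "\<gamma> \<in> \<Gamma>" for \<gamma>
    proof (cases "\<gamma> = \<gamma>0")
      case True
      then show ?thesis using \<gamma>0 by simp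
    next
      case False
      then have "x - \<gamma> \<notin> R" using uniq that by blast
      then show ?thesis using False by simp
    qed
    have "(\<integral>\<^sup>+\<gamma>. indicator R (x - \<gamma>) \<partial>count_space \<Gamma>) = (\<integral>\<^sup>+\<gamma>. indicator {\<gamma>0} \<gamma> \<partial>count_space \<Gamma>)"
      by (intro nn_integral_cong eq) simp
    also have "\<dots> = 1" using \<gamma>0 by simp
    finally show ?thesis .
  qed
  have tileP: "(\<integral>\<^sup>+\<gamma>. indicator P (x - \<gamma>) \<partial>count_space \<Gamma>) = 1" for x
    by (rule tile[OF lattice_tiling])
  have tile': "(\<integral>\<^sup>+\<gamma>. indicator S (x + \<gamma>) \<partial>count_space \<Gamma>) = 1" for x
  proof -
    have "bij_betw uminus \<Gamma> \<Gamma>"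
      by (rule bij_betwI[where g = uminus]) (auto intro: lattice_minus)
    from nn_integral_bij_count_space[OF this, of "\<lambda>\<gamma>. indicator S (x - \<gamma>)"]
    show ?thesis by (simp only: tile[OF S_tiles] diff_minus_eq_add)
  qed
  have "(\<integral>\<^sup>+x. g x * indicator S x \<partial>lborel) =
    (\<integral>\<^sup>+x. (\<integral>\<^sup>+\<gamma>. g x * indicator S x * indicator P (x - \<gamma>) \<partial>count_space \<Gamma>) \<partial>lborel)"
    by (simp add: nn_integral_cmult tileP)
  also have "\<dots> = (\<integral>\<^sup>+\<gamma>. (\<integral>\<^sup>+x. g x * indicator S x * indicator P (x - \<gamma>) \<partial>lborel) \<partial>count_space \<Gamma>)"
    by (rule nn_integral_count_space_nn_integral[OF countable_lattice]) measurable
  also have "\<dots> = (\<integral>\<^sup>+\<gamma>. (\<integral>\<^sup>+x. g x * indicator S (x + \<gamma>) * indicator P x \<partial>lborel) \<partial>count_space \<Gamma>)"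
  proof (rule nn_integral_cong)
    fix \<gamma> assume "\<gamma> \<in> space (count_space \<Gamma>)"
    then have "\<gamma> \<in> \<Gamma>" by simp
    then show "(\<integral>\<^sup>+x. g x * indicator S x * indicator P (x - \<gamma>) \<partial>lborel) =
      (\<integral>\<^sup>+x. g x * indicator S (x + \<gamma>) * indicator P x \<partial>lborel)"
      using trans[of "\<lambda>x. g x * indicator S x * indicator P (x - \<gamma>)" \<gamma>]
      by (simp add: per)
  qed
  also have "\<dots> = (\<integral>\<^sup>+x. (\<integral>\<^sup>+\<gamma>. g x * indicator S (x + \<gamma>) * indicator P x \<partial>count_space \<Gamma>) \<partial>lborel)"
    by (rule nn_integral_count_space_nn_integral[OF countable_lattice, symmetric]) measurable
  also have "\<dots> = (\<integral>\<^sup>+x. g x * indicator P x \<partial>lborel)"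
  proof (rule nn_integral_cong)
    fix x
    have "(\<integral>\<^sup>+\<gamma>. g x * indicator S (x + \<gamma>) * indicator P x \<partial>count_space \<Gamma>) =
      (\<integral>\<^sup>+\<gamma>. (g x * indicator P x) * indicator S (x + \<gamma>) \<partial>count_space \<Gamma>)"
      by (simp add: mult_ac)
    also have "\<dots> = g x * indicator P x"
      by (subst nn_integral_cmult) (simp_all add: tile')
    finally show "(\<integral>\<^sup>+\<gamma>. g x * indicator S (x + \<gamma>) * indicator P x \<partial>count_space \<Gamma>) = g x * indicator P x" .
  qed
  finally show ?thesis .
qed

lemma nn_integral_translate:
  assumes f: "(\<lambda>x. f (proj x)) \<in> borel_measurable borel"
  shows "(\<integral>\<^sup>+x. f (proj (x + v)) * indicator P x \<partial>lborel) =
    (\<integral>\<^sup>+x. f (proj x) * indicator P x \<partial>lborel)"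
proof -
  have [measurable]: "(\<lambda>x. f (proj x)) \<in> borel_measurable borel" by fact
  have per: "f (proj (x + \<gamma>)) = f (proj x)" if "\<gamma> \<in> \<Gamma>" for x \<gamma>
    using that proj_eq_iff[of "x + \<gamma>" x] by simp
  have "(\<integral>\<^sup>+x. f (proj (x + v)) * indicator P x \<partial>lborel) =
      (\<integral>\<^sup>+x. f (proj x) * indicator P (x - v) \<partial>lborel)"
    by (subst (2) lborel_distr_plus[of v, symmetric], subst nn_integral_distr) (auto simp: add.commute)
  also have "\<dots> = (\<integral>\<^sup>+x. f (proj x) * indicator {x. x - v \<in> P} x \<partial>lborel)"
    by (intro nn_integral_cong) (auto split: split_indicator)
  also have "\<dots> = (\<integral>\<^sup>+x. f (proj x) * indicator P x \<partial>lborel)"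
  proof (rule nn_integral_periodic_domain)
    show "\<exists>!\<gamma>. \<gamma> \<in> \<Gamma> \<and> x - \<gamma> \<in> {x. x - v \<in> P}" for x
      using lattice_tiling[of "x - v"] by (simp add: algebra_simps)
  qed (use per in auto)
  finally show ?thesis .
qed

lemma emeasure_tile:
  assumes "S \<in> sets borel" "\<And>x. \<exists>!\<gamma>. \<gamma> \<in> \<Gamma> \<and> x - \<gamma> \<in> S"
  shows "emeasure lborel S = emeasure lborel P"
  using nn_integral_periodic_domain[of "\<lambda>_. 1" S] assms by simp

definition shift :: "real^'n \<Rightarrow> (real^'n) set \<Rightarrow> (real^'n) set" where "shift v p = (\<lambda>x. x + v) ` p"

lemma shift_proj [simp]: "shift v (proj x) = proj (x + v)"
  by (auto simp: shift_def torus_proj_def image_image algebra_simps)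

lemma measurable_shift: "shift v \<in> T \<rightarrow>\<^sub>M T"
proof -
  have "(\<lambda>x. proj (x + v)) \<in> borel \<rightarrow>\<^sub>M torus_borel \<Gamma>"
    by (rule measurable_compose[OF _ measurable_torus_proj]) measurable
  then show ?thesis
    unfolding measurable_T_iff using measurable_cong_sets[OF refl sets_T] by simp
qed

lemma distr_shift: "distr T T (shift v) = T"
proof (rule measure_eqI)
  fix A assume "A \<in> sets (distr T T (shift v))"
  then have A: "A \<in> sets T" by simp
  have i: "(\<lambda>p. indicator A p :: ennreal) \<in> borel_measurable T" using A by measurable
  have "emeasure (distr T T (shift v)) A = (\<integral>\<^sup>+p. indicator A (shift v p) \<partial>T)"
    using A measurable_shift[of v] by (simp add: nn_integral_distr flip: nn_integral_indicator)
  also have "\<dots> = (\<integral>\<^sup>+x. indicator A (proj (x + v)) * indicator P x \<partial>lborel)"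
    using measurable_compose[OF measurable_shift[of v] i] by (subst nn_integral_T) auto
  also have "\<dots> = (\<integral>\<^sup>+x. indicator A (proj x) * indicator P x \<partial>lborel)"
    using i by (intro nn_integral_translate) (simp add: measurable_T_iff)
  also have "\<dots> = emeasure T A"
    using i A by (subst nn_integral_T[symmetric]) auto
  finally show "emeasure (distr T T (shift v)) A = emeasure T A" .
qed simp

lemma integral_shift:
  fixes f :: "(real^'n) set \<Rightarrow> 'b::{banach, second_countable_topology}"
  assumes "f \<in> borel_measurable T"
  shows "(\<integral>p. f (shift v p) \<partial>T) = (\<integral>p. f p \<partial>T)"
  using integral_distr[OF measurable_shift assms, of v] by (simp add: distr_shift)

lemma bounded_of_continuous_lift:
  fixes f :: "(real^'n) set \<Rightarrow> 'b::real_normed_vector"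
  assumes "continuous_on UNIV (\<lambda>x. f (proj x))"
  obtains K where "\<And>p. p \<in> torus \<Gamma> \<Longrightarrow> norm (f p) \<le> K"
proof -
  define Q where "Q = ((*v) B) ` cbox 0 (\<chi> i. 1)"
  have "compact Q" unfolding Q_def
    by (intro compact_continuous_image linear_continuous_on compact_cbox matrix_vector_mul_bounded_linear)
  then have "compact ((\<lambda>x. f (proj x)) ` Q)"
    using assms by (intro compact_continuous_image) (auto intro: continuous_on_subset)
  then obtain K where K: "\<And>x. x \<in> Q \<Longrightarrow> norm (f (proj x)) \<le> K"
    using compact_imp_bounded bounded_iff by (metis imageI)
  show thesis
  proof
    fix p assume "p \<in> torus \<Gamma>"
    then obtain x where p: "p = proj x" by (auto simp: torus_def)
    obtain \<gamma> where \<gamma>: "\<gamma> \<in> \<Gamma>" "x - \<gamma> \<in> P" using lattice_tiling[of x] by blast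
    have "coord (x - \<gamma>) \<in> cbox 0 (\<chi> i. 1)"
      using \<gamma>(2) by (auto simp: mem_fundamental_domain_iff mem_box_cart less_imp_le)
    then have "B *v coord (x - \<gamma>) \<in> Q" unfolding Q_def by (rule imageI)
    then have "x - \<gamma> \<in> Q" by simp
    moreover have "p = proj (x - \<gamma>)" using \<gamma>(1) by (simp add: p proj_eq_iff)
    ultimately show "norm (f p) \<le> K" using K by simp
  qed
qed

lemma measurable_of_continuous_lift:
  fixes f :: "(real^'n) set \<Rightarrow> 'b::topological_space"
  assumes "continuous_on UNIV (\<lambda>x. f (proj x))"
  shows "f \<in> borel_measurable T"
  using assms by (simp add: measurable_T_iff borel_measurable_continuous_onI)

lemma integrable_of_continuous_lift:
  fixes f :: "(real^'n) set \<Rightarrow> 'b::{banach, second_countable_topology}"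
  assumes "continuous_on UNIV (\<lambda>x. f (proj x))"
  shows "integrable T f"
proof -
  obtain K where "\<And>p. p \<in> torus \<Gamma> \<Longrightarrow> norm (f p) \<le> K"
    using bounded_of_continuous_lift[OF assms] by blast
  then show ?thesis
    using measurable_of_continuous_lift[OF assms] by (intro integrable_const_bound[of _ K]) auto
qed

lemma square_integrable_of_continuous_lift:
  assumes "continuous_on UNIV (\<lambda>x. f (proj x))"
  shows "square_integrable T f"
  unfolding square_integrable_def using assms
  by (auto intro!: measurable_of_continuous_lift integrable_of_continuous_lift continuous_intros)

text \<open>If \<open>f\<close> did not vanish at \<open>p\<close>, translate so that \<open>p\<close> is represented by the centre of the fundamental
  domain; then \<open>f\<close> is nonzero on an open subset of the domain, which has positive measure.\<close>

lemma continuous_lift_vanishes: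
  fixes f :: "(real^'n) set \<Rightarrow> complex"
  assumes cont: "continuous_on UNIV (\<lambda>x. f (proj x))"
    and zero: "(\<integral>p. (norm (f p))\<^sup>2 \<partial>T) = 0" and p: "p \<in> torus \<Gamma>"
  shows "f p = 0"
proof (rule ccontr)
  assume nz: "f p \<noteq> 0"
  obtain x0 where x0: "p = proj x0" using p by (auto simp: torus_def)
  define c where "c = B *v (\<chi> i. 1/2)"
  define v where "v = x0 - c"
  define g where "g = (\<lambda>x. (norm (f (proj (x + v))))\<^sup>2)"
  have contg: "continuous_on UNIV g"
    unfolding g_def by (intro continuous_intros continuous_on_compose2[OF cont]) auto
  define U where "U = {x. 0 < g x} \<inter> interior_domain"
  have "open U" unfolding U_def
    by (rule open_Int[OF open_Collect_less[OF continuous_on_const contg] open_interior_domain])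
  have "0 < g c" using nz by (simp add: g_def v_def x0)
  then have "c \<in> U" using center_in_interior_domain by (simp add: U_def c_def)
  have UP: "U \<subseteq> P" unfolding U_def using interior_domain_subset by blast
  have sqm: "(\<lambda>p. (norm (f p))\<^sup>2) \<in> borel_measurable T"
    by (rule measurable_of_continuous_lift) (intro continuous_intros cont)
  have sqi: "integrable T (\<lambda>p. (norm (f (shift v p)))\<^sup>2)"
  proof (rule integrable_of_continuous_lift)
    show "continuous_on UNIV (\<lambda>x. (norm (f (shift v (proj x))))\<^sup>2)"
      using contg by (simp add: g_def)
  qed
  have "(\<integral>p. (norm (f (shift v p)))\<^sup>2 \<partial>T) = 0"
    using integral_shift[OF sqm, of v] zero by simp
  then have "(\<integral>\<^sup>+p. ennreal ((norm (f (shift v p)))\<^sup>2) \<partial>T) = 0"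
    using nn_integral_eq_integral[OF sqi] by simp
  moreover have "(\<integral>\<^sup>+p. ennreal ((norm (f (shift v p)))\<^sup>2) \<partial>T) =
      (\<integral>\<^sup>+x. ennreal (g x) * indicator P x \<partial>lborel)"
    using nn_integral_T[OF measurable_compose[OF borel_measurable_integrable[OF sqi] measurable_ennreal]]
    by (simp only: shift_proj g_def)
  ultimately have "(\<integral>\<^sup>+x. ennreal (g x) * indicator P x \<partial>lborel) = 0" by simp
  moreover have "(\<lambda>x. ennreal (g x) * indicator P x) \<in> borel_measurable lborel"
    using borel_measurable_continuous_onI[OF contg] by measurable
  ultimately have "AE x in lborel. ennreal (g x) * indicator P x = 0"
    by (simp add: nn_integral_0_iff_AE)
  then have "AE x in lborel. x \<notin> U"
  proof eventually_elim
    case (elim x)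
    show ?case
    proof
      assume "x \<in> U"
      then have "x \<in> P" "0 < g x" using UP by (auto simp: U_def)
      then show False using elim by simp
    qed
  qed
  moreover have "U \<in> sets lborel" using \<open>open U\<close> by simp
  ultimately have "U \<in> null_sets lborel"
    by (simp add: AE_iff_null_sets)
  then have "negligible U"
    by (simp add: negligible_iff_null_sets null_sets_completionI)
  moreover have "U \<noteq> {}" using \<open>c \<in> U\<close> by auto
  ultimately show False using open_not_negligible[OF \<open>open U\<close>] by simp
qed

end


text \<open>Uniqueness of Haar measure by the classical double integral \<open>\<integral>\<integral> 1\<^sub>A(x) 1\<^sub>Q(x + y) dN(x) dy\<close>: integrating
  over \<open>y\<close> first gives the left-hand side, while substituting \<open>x - y\<close> for \<open>x\<close> and then integrating over \<open>y\<close>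
  gives the right-hand side.\<close>

lemma translation_invariant_measure_unique:
  fixes N :: "'a::euclidean_space measure"
  assumes N: "sigma_finite_measure N" and sets [measurable_cong, simp]: "sets N = sets borel"
    and inv: "\<And>v h. h \<in> borel_measurable borel \<Longrightarrow> (\<integral>\<^sup>+x. h (x + v) \<partial>N) = (\<integral>\<^sup>+x. h x \<partial>N)"
    and A [measurable]: "A \<in> sets borel" and Q [measurable]: "Q \<in> sets borel"
  shows "emeasure N A * emeasure lborel Q = emeasure lborel A * emeasure N Q"
proof -
  interpret N: sigma_finite_measure N by fact
  interpret pair_sigma_finite N lborel ..
  have trans: "(\<integral>\<^sup>+x. h (x + v) \<partial>lborel) = (\<integral>\<^sup>+x. h x \<partial>lborel)"
    if [measurable]: "h \<in> borel_measurable borel" for h :: "'a \<Rightarrow> ennreal" and v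
    by (subst lborel_distr_plus[of v, symmetric], subst nn_integral_distr) (auto simp: add.commute)
  have reflect: "(\<integral>\<^sup>+y. h (- y) \<partial>lborel) = (\<integral>\<^sup>+y. h y \<partial>lborel)"
    if [measurable]: "h \<in> borel_measurable borel" for h :: "'a \<Rightarrow> ennreal"
    by (subst (2) lborel_affine[of "-1" 0]) (auto simp: density_1 nn_integral_distr)
  have "emeasure N A * emeasure lborel Q = (\<integral>\<^sup>+x. indicator A x * (\<integral>\<^sup>+y. indicator Q y \<partial>lborel) \<partial>N)"
    by (simp add: nn_integral_multc)
  also have "\<dots> = (\<integral>\<^sup>+x. indicator A x * (\<integral>\<^sup>+y. indicator Q (y + x) \<partial>lborel) \<partial>N)"
    by (subst trans) auto
  also have "\<dots> = (\<integral>\<^sup>+x. (\<integral>\<^sup>+y. indicator A x * indicator Q (y + x) \<partial>lborel) \<partial>N)"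
    by (subst nn_integral_cmult) auto
  also have "\<dots> = (\<integral>\<^sup>+y. (\<integral>\<^sup>+x. indicator A x * indicator Q (y + x) \<partial>N) \<partial>lborel)"
    by (rule Fubini'[symmetric]) measurable
  also have "\<dots> = (\<integral>\<^sup>+y. (\<integral>\<^sup>+x. indicator A (x - y) * indicator Q x \<partial>N) \<partial>lborel)"
  proof (rule nn_integral_cong)
    fix y
    show "(\<integral>\<^sup>+x. indicator A x * indicator Q (y + x) \<partial>N) = (\<integral>\<^sup>+x. indicator A (x - y) * indicator Q x \<partial>N)"
      using inv[of "\<lambda>x. indicator A (x - y) * indicator Q x" y] by (simp add: add.commute)
  qed
  also have "\<dots> = (\<integral>\<^sup>+x. (\<integral>\<^sup>+y. indicator A (x - y) * indicator Q x \<partial>lborel) \<partial>N)"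
    by (rule Fubini') measurable
  also have "\<dots> = (\<integral>\<^sup>+x. indicator Q x * (\<integral>\<^sup>+y. indicator A (x - y) \<partial>lborel) \<partial>N)"
    by (subst mult.commute, subst nn_integral_cmult) auto
  also have "\<dots> = (\<integral>\<^sup>+x. indicator Q x * emeasure lborel A \<partial>N)"
  proof (intro nn_integral_cong arg_cong2[where f = "(*)"] refl)
    fix x
    have "(\<integral>\<^sup>+y. indicator A (x - y) \<partial>lborel) = (\<integral>\<^sup>+y. indicator A (x + y) \<partial>lborel :: ennreal)"
      using reflect[of "\<lambda>y. indicator A (x + y)"] by simp
    also have "\<dots> = emeasure lborel A" using trans[of "indicator A" x] by (simp add: add.commute)
    finally show "(\<integral>\<^sup>+y. indicator A (x - y) \<partial>lborel) = emeasure lborel A" .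
  qed
  also have "\<dots> = emeasure lborel A * emeasure N Q"
    by (subst nn_integral_multc) (auto simp: mult.commute)
  finally show ?thesis .
qed

lemma vimage_eq_image_inverse:
  assumes "\<And>x. L (L' x) = x" "\<And>x. L' (L x) = x"
  shows "L' -` S = L ` S"
proof
  show "L' -` S \<subseteq> L ` S"
  proof
    fix x assume "x \<in> L' -` S"
    then show "x \<in> L ` S" using assms(1)[of x] by (intro image_eqI[of _ _ "L' x"]) auto
  qed
  show "L ` S \<subseteq> L' -` S" using assms(2) by auto
qed

text \<open>The image measure of Lebesgue measure under a linear map is translation invariant, hence a multiple of Lebesgue
  measure. The factor is \<open>1\<close> because the measure of \<open>Q\<close> is unchanged, finite and positive. In the
  application \<open>Q\<close> is an ellipsoid.\<close>

lemma emeasure_linear_image_of_invariant_set: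
  fixes L L' :: "'a::euclidean_space \<Rightarrow> 'a"
  assumes L: "linear L" "linear L'" "\<And>x. L (L' x) = x" "\<And>x. L' (L x) = x"
    and Q: "open Q" "bounded Q" "Q \<noteq> {}" "L ` Q = Q" and A: "A \<in> sets borel"
  shows "emeasure lborel (L ` A) = emeasure lborel A"
proof -
  have [measurable]: "L \<in> borel_measurable borel" "L' \<in> borel_measurable borel"
    using L by (auto intro!: borel_measurable_continuous_onI linear_continuous_on simp: linear_conv_bounded_linear)
  have Qb [measurable]: "Q \<in> sets borel" using Q(1) by simp
  define N where "N = distr lborel borel L'"
  have N: "emeasure N S = emeasure lborel (L ` S)" if S: "S \<in> sets borel" for S
    using S by (simp add: N_def emeasure_distr vimage_eq_image_inverse[OF L(3,4)])
  have inv: "(\<integral>\<^sup>+x. h (x + v) \<partial>N) = (\<integral>\<^sup>+x. h x \<partial>N)" if [measurable]: "h \<in> borel_measurable borel" for h v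
  proof -
    have "(\<integral>\<^sup>+x. h (x + v) \<partial>N) = (\<integral>\<^sup>+x. h (L' (L v + x)) \<partial>lborel)"
      by (simp add: N_def nn_integral_distr linear_add[OF L(2)] L(4) add.commute)
    also have "\<dots> = (\<integral>\<^sup>+x. h (L' x) \<partial>lborel)"
      by (subst (2) lborel_distr_plus[of "L v", symmetric], subst nn_integral_distr) auto
    finally show ?thesis by (simp add: N_def nn_integral_distr)
  qed
  have finQ: "emeasure lborel Q < \<infinity>" by (rule emeasure_bounded_finite[OF Q(2)])
  have posQ: "emeasure lborel Q \<noteq> 0"
  proof
    assume "emeasure lborel Q = 0"
    then have "Q \<in> null_sets lborel" by (simp add: null_sets_def)
    then have "negligible Q" by (simp add: negligible_iff_null_sets null_sets_completionI)
    then show False using open_not_negligible[OF Q(1,3)] by blast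
  qed
  have "sigma_finite_measure N"
  proof
    let ?C = "range (\<lambda>n::nat. L' ` ball 0 (real n))"
    have im: "L' ` ball 0 r = L -` ball 0 r" for r
      by (rule vimage_eq_image_inverse[OF L(4,3), symmetric])
    have bo: "L -` ball 0 r \<in> sets borel" for r
      using measurable_sets[of L borel borel "ball 0 r"] by simp
    have "L ` L -` ball 0 (real n) = ball 0 (real n)" for n
      by (rule surj_image_vimage_eq) (rule surjI[of L L'], rule L(3))
    then have "emeasure N (L' ` ball 0 (real n)) \<noteq> \<infinity>" for n
      using N[OF bo[of "real n"]] emeasure_bounded_finite[of "ball (0::'a) (real n)"]
      by (simp add: im)
    moreover have "\<Union>?C = space N"
    proof -
      have "x \<in> \<Union>?C" for x
        using reals_Archimedean2[of "norm (L x)"] by (auto simp: im)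
      then show ?thesis by (auto simp: N_def)
    qed
    moreover have "?C \<subseteq> sets N" using bo by (auto simp: N_def im)
    ultimately show "\<exists>A. countable A \<and> A \<subseteq> sets N \<and> \<Union>A = space N \<and> (\<forall>a\<in>A. emeasure N a \<noteq> \<infinity>)"
      by (intro exI[of _ ?C]) auto
  qed
  from translation_invariant_measure_unique[OF this _ inv A Qb]
  have "emeasure lborel (L ` A) * emeasure lborel Q = emeasure lborel A * emeasure lborel Q"
    using A Q(4) N[OF A] N[OF Qb] by (simp add: N_def)
  then show ?thesis using finQ posQ
    by (auto simp: mult.commute[of _ "emeasure lborel Q"] ennreal_mult_cancel_left)
qed

text \<open>The image of a fundamental domain of \<open>\<Gamma>\<close> tiles the image lattice, so it has the same measure as the
  fundamental domain chosen for \<open>\<Gamma>'\<close>.\<close>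

lemma vol_linear_image:
  fixes \<Gamma> \<Gamma>' :: "(real^'n) set"
  assumes "full_rank_lattice \<Gamma>" "full_rank_lattice \<Gamma>'"
    and L: "linear L" "linear L'" "\<And>x. L (L' x) = x" "\<And>x. L' (L x) = x"
    and Q: "open Q" "bounded Q" "Q \<noteq> {}" "L ` Q = Q"
    and im: "\<Gamma>' = L ` \<Gamma>"
  shows "flat_torus.vol \<Gamma>' = flat_torus.vol \<Gamma>"
proof -
  interpret G: flat_torus \<Gamma> by standard fact
  interpret G': flat_torus \<Gamma>' by standard fact
  let ?P = "fundamental_domain \<Gamma>"
  have "L' \<in> borel_measurable borel"
    using L by (auto intro!: borel_measurable_continuous_onI linear_continuous_on simp: linear_conv_bounded_linear)
  from measurable_sets[OF this G.borel_fundamental_domain]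
  have "L' -` ?P \<in> sets borel" by simp
  moreover have imP: "L ` ?P = L' -` ?P"
    by (rule vimage_eq_image_inverse[OF L(3,4), symmetric])
  ultimately have "L ` ?P \<in> sets borel" by simp
  then have "emeasure lborel (L ` ?P) = emeasure lborel (fundamental_domain \<Gamma>')"
  proof (rule G'.emeasure_tile)
    fix x
    obtain \<gamma> where \<gamma>: "\<gamma> \<in> \<Gamma>" "L' x - \<gamma> \<in> ?P"
      and uniq: "\<And>\<gamma>'. \<gamma>' \<in> \<Gamma> \<Longrightarrow> L' x - \<gamma>' \<in> ?P \<Longrightarrow> \<gamma>' = \<gamma>"
      using G.lattice_tiling[of "L' x"] by blast
    show "\<exists>!\<gamma>. \<gamma> \<in> \<Gamma>' \<and> x - \<gamma> \<in> L ` ?P"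
    proof (rule ex1I[of _ "L \<gamma>"])
      show "L \<gamma> \<in> \<Gamma>' \<and> x - L \<gamma> \<in> L ` ?P"
        using \<gamma> by (simp add: im imP linear_diff[OF L(2)] L(4))
      fix \<gamma>' assume \<gamma>': "\<gamma>' \<in> \<Gamma>' \<and> x - \<gamma>' \<in> L ` ?P"
      then obtain \<delta> where "\<delta> \<in> \<Gamma>" "\<gamma>' = L \<delta>" by (auto simp: im)
      then show "\<gamma>' = L \<gamma>"
        using uniq[of \<delta>] \<gamma>' by (simp add: imP linear_diff[OF L(2)] L(4))
    qed
  qed
  then show ?thesis
    using emeasure_linear_image_of_invariant_set[OF L Q G.borel_fundamental_domain]
    by (simp add: G.vol_def G'.vol_def measure_def)
qed

section \<open>Characters and trigonometric polynomials\<close>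

definition dual_lattice :: "(real^'n) set \<Rightarrow> (real^'n) set"
  where "dual_lattice \<Gamma> = {\<xi>. \<forall>\<gamma>\<in>\<Gamma>. \<xi> \<bullet> \<gamma> \<in> \<int>}"

lemma cis_eq_imp_diff:
  assumes "cis a = cis b" obtains k :: int where "a - b = 2 * pi * of_int k"
proof -
  have "cis (a - b) = 1" using assms by (simp add: cis_divide[symmetric])
  then have "cos (a - b) = 1" by (simp add: complex_eq_iff)
  then obtain n :: int where "a - b = of_int n * 2 * pi" using cos_one_2pi_int by blast
  then show thesis using that[of n] by simp
qed

text \<open>A Borel measurable right inverse of \<open>cis\<close> on the unit circle. The clamp makes the argument of \<open>arccos\<close>
  admissible everywhere, so measurability follows from continuity.\<close>

definition circle_angle :: "complex \<Rightarrow> real"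
  where "circle_angle w = (if 0 \<le> Im w then 1 else -1) * arccos (max (-1) (min 1 (Re w)))"

lemma cis_circle_angle: assumes "norm w = 1" shows "cis (circle_angle w) = w"
proof -
  have Re: "-1 \<le> Re w" "Re w \<le> 1" using abs_Re_le_cmod[of w] assms by linarith+
  have sq: "(Re w)\<^sup>2 + (Im w)\<^sup>2 = 1" using assms by (metis cmod_power2 one_power2)
  have c: "cos (arccos (Re w)) = Re w" using Re by simp
  have s: "sin (arccos (Re w)) = \<bar>Im w\<bar>"
    using sq by (simp add: sin_arccos[OF Re] algebra_simps flip: real_sqrt_abs)
  show ?thesis using c s Re by (auto simp: circle_angle_def complex_eq_iff min_def max_def)
qed

lemma measurable_circle_angle [measurable]: "circle_angle \<in> borel_measurable borel"
proof -
  have "continuous_on UNIV (\<lambda>x::real. arccos (max (-1) (min 1 x)))"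
    by (rule continuous_on_compose2[OF continuous_on_arccos'])
       (auto intro!: continuous_intros)
  from borel_measurable_continuous_onI[OF this] have [measurable]: "(\<lambda>x::real. arccos (max (-1) (min 1 x))) \<in> borel_measurable borel" .
  show ?thesis unfolding circle_angle_def by measurable
qed

context flat_torus
begin

abbreviation dual :: "(real^'n) set" where "dual \<equiv> dual_lattice \<Gamma>"

definition rep :: "(real^'n) set \<Rightarrow> real^'n" where "rep p = (SOME x. proj x = p)"

lemma proj_rep: "p \<in> torus \<Gamma> \<Longrightarrow> proj (rep p) = p"
  unfolding rep_def by (rule someI_ex) (auto simp: torus_def)

lemma rep_proj_diff: "rep (proj x) - x \<in> \<Gamma>"
  using proj_rep[of "proj x"] by (simp add: proj_eq_iff)

text \<open>Evaluation at a chosen representative makes the algebraic identities for characters hold without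
  side conditions; the choice is immaterial for \<open>\<xi>\<close> in the dual lattice (\<open>char_proj\<close>).\<close>

definition char :: "real^'n \<Rightarrow> (real^'n) set \<Rightarrow> complex"
  where "char \<xi> p = cis (2 * pi * (\<xi> \<bullet> rep p))"

lemma char_proj: assumes "\<xi> \<in> dual" shows "char \<xi> (proj x) = cis (2 * pi * (\<xi> \<bullet> x))"
proof -
  have "\<xi> \<bullet> (rep (proj x) - x) \<in> \<int>"
    using assms rep_proj_diff by (auto simp: dual_lattice_def)
  then have "cis (2 * pi * (\<xi> \<bullet> (rep (proj x) - x))) = 1" by (rule cis_multiple_2pi)
  moreover have "char \<xi> (proj x) =
      cis (2 * pi * (\<xi> \<bullet> x)) * cis (2 * pi * (\<xi> \<bullet> (rep (proj x) - x)))"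
    by (simp add: char_def cis_mult inner_diff_right algebra_simps)
  ultimately show ?thesis by simp
qed

lemma char_0 [simp]: "char 0 p = 1"
  and char_add: "char (\<xi> + \<eta>) p = char \<xi> p * char \<eta> p"
  and cnj_char: "cnj (char \<xi> p) = char (- \<xi>) p"
  and norm_char [simp]: "norm (char \<xi> p) = 1"
  by (simp_all add: char_def cis_mult inner_add_left cis_cnj algebra_simps)

lemma dual_0: "0 \<in> dual"
  and dual_add: "\<xi> \<in> dual \<Longrightarrow> \<eta> \<in> dual \<Longrightarrow> \<xi> + \<eta> \<in> dual"
  and dual_diff: "\<xi> \<in> dual \<Longrightarrow> \<eta> \<in> dual \<Longrightarrow> \<xi> - \<eta> \<in> dual"
  and dual_minus: "\<xi> \<in> dual \<Longrightarrow> - \<xi> \<in> dual"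
  by (auto simp: dual_lattice_def inner_add_left inner_diff_left)

lemma continuous_on_char_lift: "\<xi> \<in> dual \<Longrightarrow> continuous_on UNIV (\<lambda>x. char \<xi> (proj x))"
  by (simp add: char_proj) (intro continuous_intros)

lemma square_integrable_char: "\<xi> \<in> dual \<Longrightarrow> square_integrable T (char \<xi>)"
  by (intro square_integrable_of_continuous_lift continuous_on_char_lift)

lemma char_shift:
  assumes "\<xi> \<in> dual" "p \<in> torus \<Gamma>"
  shows "char \<xi> (shift v p) = cis (2 * pi * (\<xi> \<bullet> v)) * char \<xi> p"
proof -
  obtain x where "p = proj x" using assms(2) by (auto simp: torus_def)
  then show ?thesis using assms(1) by (simp add: char_proj inner_add_right cis_mult algebra_simps)
qed

text \<open>Translation by a vector \<open>v\<close> with \<open>\<xi> \<bullet> v = 1/2\<close> multiplies the character by \<open>-1\<close> and preserves the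
  integral.\<close>

lemma integral_char:
  assumes "\<xi> \<in> dual"
  shows "(\<integral>p. char \<xi> p \<partial>T) = (if \<xi> = 0 then of_real vol else 0)"
proof (cases "\<xi> = 0")
  case True
  then show ?thesis using measure_T by (simp add: scaleR_conv_of_real)
next
  case False
  define v where "v = (1 / (2 * (\<xi> \<bullet> \<xi>))) *\<^sub>R \<xi>"
  have v: "2 * pi * (\<xi> \<bullet> v) = pi" using False by (simp add: v_def)
  have "(\<integral>p. char \<xi> p \<partial>T) = (\<integral>p. char \<xi> (shift v p) \<partial>T)"
    by (rule integral_shift[symmetric])
       (rule measurable_of_continuous_lift[OF continuous_on_char_lift[OF assms]])
  also have "\<dots> = (\<integral>p. - char \<xi> p \<partial>T)"
    by (rule Bochner_Integration.integral_cong) (simp_all add: char_shift[OF assms] v)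
  finally show ?thesis using False by simp
qed

lemma l2_inner_char:
  assumes "\<xi> \<in> dual" "\<eta> \<in> dual"
  shows "l2_inner T (char \<xi>) (char \<eta>) = (if \<xi> = \<eta> then of_real vol else 0)"
proof -
  have "l2_inner T (char \<xi>) (char \<eta>) = (\<integral>p. char (\<xi> - \<eta>) p \<partial>T)"
    unfolding l2_inner_def cnj_char char_add[symmetric] by simp
  then show ?thesis using integral_char[OF dual_diff[OF assms]] by simp
qed

inductive trig :: "((real^'n) set \<Rightarrow> complex) \<Rightarrow> bool" where
  char: "\<xi> \<in> dual \<Longrightarrow> trig (char \<xi>)"
| add: "trig f \<Longrightarrow> trig g \<Longrightarrow> trig (\<lambda>p. f p + g p)"
| scale: "trig f \<Longrightarrow> trig (\<lambda>p. c * f p)"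

lemma trig_const: "trig (\<lambda>p. c)"
  using trig.scale[OF trig.char[OF dual_0], of c] by simp

lemma trig_sum: "finite I \<Longrightarrow> (\<And>i. i \<in> I \<Longrightarrow> trig (f i)) \<Longrightarrow> trig (\<lambda>p. \<Sum>i\<in>I. f i p)"
  by (induction I rule: finite_induct) (auto intro: trig_const trig.add)

lemma trig_mult: assumes "trig f" "trig g" shows "trig (\<lambda>p. f p * g p)"
  using assms(1)
proof induction
  case (char \<xi>)
  from assms(2) show ?case
  proof induction
    case (char \<eta>)
    have "(\<lambda>p. char \<xi> p * char \<eta> p) = char (\<xi> + \<eta>)" by (simp add: char_add fun_eq_iff)
    then show ?case using trig.char[OF dual_add[OF \<open>\<xi> \<in> dual\<close> \<open>\<eta> \<in> dual\<close>]] by simp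
  next
    case (add f g)
    then show ?case using trig.add[OF add.IH] by (simp add: distrib_left)
  next
    case (scale f c)
    then show ?case using trig.scale[OF scale.IH, of c] by (simp add: mult_ac)
  qed
next
  case (add f h)
  then show ?case using trig.add[OF add.IH] by (simp add: distrib_right)
next
  case (scale f c)
  then show ?case using trig.scale[OF scale.IH, of c] by (simp add: mult_ac)
qed

lemma trig_cong: "trig f \<Longrightarrow> (\<And>p. f p = g p) \<Longrightarrow> trig g"
  by (metis ext)

lemma trig_continuous_lift: "trig f \<Longrightarrow> continuous_on UNIV (\<lambda>x. f (proj x))"
  by (induction rule: trig.induct) (auto intro: continuous_on_char_lift continuous_intros)

lemma trig_lincomb:
  assumes "trig f"
  shows "\<exists>F a. finite F \<and> F \<subseteq> dual \<and> f = (\<lambda>p. \<Sum>\<xi>\<in>F. a \<xi> * char \<xi> p)"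
  using assms
proof induction
  case (char \<xi>)
  then show ?case by (intro exI[of _ "{\<xi>}"] exI[of _ "\<lambda>_. 1"]) auto
next
  case (add f g)
  then obtain F a G b where F: "finite F" "F \<subseteq> dual" "f = (\<lambda>p. \<Sum>\<xi>\<in>F. a \<xi> * char \<xi> p)"
    and G: "finite G" "G \<subseteq> dual" "g = (\<lambda>p. \<Sum>\<xi>\<in>G. b \<xi> * char \<xi> p)" by auto
  define c where "c = (\<lambda>\<xi>. (if \<xi> \<in> F then a \<xi> else 0) + (if \<xi> \<in> G then b \<xi> else 0))"
  have "f p + g p = (\<Sum>\<xi>\<in>F \<union> G. c \<xi> * char \<xi> p)" for p
  proof -
    have "(\<Sum>\<xi>\<in>F \<union> G. c \<xi> * char \<xi> p) =
        (\<Sum>\<xi>\<in>F \<union> G. if \<xi> \<in> F then a \<xi> * char \<xi> p else 0) + (\<Sum>\<xi>\<in>F \<union> G. if \<xi> \<in> G then b \<xi> * char \<xi> p else 0)"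
      unfolding sum.distrib[symmetric] by (intro sum.cong) (auto simp: c_def distrib_right)
    also have "\<dots> = (\<Sum>\<xi>\<in>(F \<union> G) \<inter> F. a \<xi> * char \<xi> p) + (\<Sum>\<xi>\<in>(F \<union> G) \<inter> G. b \<xi> * char \<xi> p)"
      using F(1) G(1) by (simp only: sum.inter_restrict finite_Un)
    also have "(F \<union> G) \<inter> F = F" by auto
    also have "(F \<union> G) \<inter> G = G" by auto
    finally show ?thesis by (simp add: F(3) G(3))
  qed
  then show ?case using F(1,2) G(1,2) by (intro exI[of _ "F \<union> G"] exI[of _ c]) auto
next
  case (scale f c)
  then obtain F a where "finite F" "F \<subseteq> dual" "f = (\<lambda>p. \<Sum>\<xi>\<in>F. a \<xi> * char \<xi> p)" by auto
  then show ?case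
    by (intro exI[of _ F] exI[of _ "\<lambda>\<xi>. c * a \<xi>"]) (auto simp: sum_distrib_left mult_ac)
qed

definition dual_vector :: "'n \<Rightarrow> real^'n" where "dual_vector i = matrix_inv B $ i"

lemma dual_vector_inner: "dual_vector i \<bullet> x = coord x $ i"
  by (simp add: dual_vector_def coord_def matrix_vector_mul_component)

lemma dual_vector_in_dual: "dual_vector i \<in> dual"
  by (auto simp: dual_lattice_def dual_vector_inner mem_lattice_iff)

text \<open>An embedding of the torus into a product of circles. Its coordinates are characters, so real polynomials in them are
  trigonometric polynomials.\<close>

definition emb :: "(real^'n) set \<Rightarrow> complex^'n" where "emb p = (\<chi> i. char (dual_vector i) p)"

lemma continuous_on_emb_lift: "continuous_on UNIV (\<lambda>x. emb (proj x))"
  unfolding emb_def by (intro continuous_intros continuous_on_char_lift dual_vector_in_dual)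

lemma measurable_emb [measurable]: "emb \<in> borel_measurable T"
  by (rule measurable_of_continuous_lift[OF continuous_on_emb_lift])

lemma trig_real_polynomial:
  assumes "real_polynomial_function q"
  shows "trig (\<lambda>p. of_real (q (emb p)))"
  using assms
proof induction
  case (linear f)
  interpret f: bounded_linear f by fact
  have comp: "trig (\<lambda>p. of_real (emb p \<bullet> b))" if b: "b \<in> Basis" for b
  proof -
    obtain i u where b: "b = axis i u" "u = 1 \<or> u = \<i>"
      using b by (auto simp: Basis_vec_def Basis_complex_def)
    let ?\<chi> = "char (dual_vector i)" and ?\<chi>' = "char (- dual_vector i)"
    have t: "trig ?\<chi>" "trig ?\<chi>'" by (intro trig.char dual_minus dual_vector_in_dual)+
    from b(2) show ?thesis
    proof
      assume "u = 1"
      have "(1/2) * (?\<chi> p + ?\<chi>' p) = of_real (emb p \<bullet> b)" for p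
        using b(1) \<open>u = 1\<close> by (simp add: inner_axis emb_def complex_eq_iff flip: cnj_char)
      then show ?thesis by (rule trig_cong[OF trig.scale[OF trig.add[OF t]], rotated])
    next
      assume "u = \<i>"
      have "(1/(2*\<i>)) * (?\<chi> p + (-1) * ?\<chi>' p) = of_real (emb p \<bullet> b)" for p
        using b(1) \<open>u = \<i>\<close> by (simp add: inner_axis emb_def complex_eq_iff flip: cnj_char)
      then show ?thesis
        by (rule trig_cong[OF trig.scale[OF trig.add[OF t(1) trig.scale[OF t(2)]]], rotated])
    qed
  qed
  have "(\<Sum>b\<in>Basis. of_real (f b) * of_real (emb p \<bullet> b)) = (of_real (f (emb p)) :: complex)" for p
  proof -
    have "f (emb p) = f (\<Sum>b\<in>Basis. (emb p \<bullet> b) *\<^sub>R b)" by (simp add: euclidean_representation)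
    also have "\<dots> = (\<Sum>b\<in>Basis. (emb p \<bullet> b) * f b)" by (simp add: f.sum f.scaleR)
    finally show ?thesis by (simp add: mult.commute)
  qed
  then show ?case
    by (rule trig_cong[OF trig_sum[OF finite_Basis trig.scale[OF comp]], rotated]) auto
next
  case (const c)
  then show ?case by (rule trig_const)
next
  case (add f g)
  then show ?case using trig.add[OF add.IH] by simp
next
  case (mult f g)
  then show ?case using trig_mult[OF mult.IH] by simp
qed

section \<open>Trigonometric polynomials are dense in L2\<close>

text \<open>Membership in the closure, in \<open>L\<^sup>2\<close>, of the trigonometric polynomials.\<close>

definition approximable :: "((real^'n) set \<Rightarrow> complex) \<Rightarrow> bool"
  where "approximable f \<longleftrightarrow> square_integrable T f \<and>
    (\<forall>\<epsilon>>0. \<exists>g. trig g \<and> (\<integral>p. (norm (f p - g p))\<^sup>2 \<partial>T) < \<epsilon>)"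

lemma square_integrable_trig: "trig g \<Longrightarrow> square_integrable T g"
  by (intro square_integrable_of_continuous_lift trig_continuous_lift)

lemma approximable_limit:
  assumes f: "square_integrable T f"
    and lim: "\<And>\<epsilon>. \<epsilon> > 0 \<Longrightarrow> \<exists>g. approximable g \<and> (\<integral>p. (norm (f p - g p))\<^sup>2 \<partial>T) < \<epsilon>"
  shows "approximable f"
  unfolding approximable_def
proof (intro conjI allI impI f)
  fix \<epsilon> :: real assume "\<epsilon> > 0"
  then have e4: "\<epsilon> / 4 > 0" by simp
  obtain g where g: "approximable g" "(\<integral>p. (norm (f p - g p))\<^sup>2 \<partial>T) < \<epsilon> / 4"
    using lim[OF e4] by blast
  obtain h where h: "trig h" "(\<integral>p. (norm (g p - h p))\<^sup>2 \<partial>T) < \<epsilon> / 4"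
    using g(1) e4 unfolding approximable_def by blast
  have "(\<integral>p. (norm (f p - h p))\<^sup>2 \<partial>T) < \<epsilon>"
    using l2_dist_triangle[OF f _ square_integrable_trig[OF h(1)], of g] g h
    by (simp add: approximable_def)
  then show "\<exists>g. trig g \<and> (\<integral>p. (norm (f p - g p))\<^sup>2 \<partial>T) < \<epsilon>" using h(1) by blast
qed

lemma approximable_trig: "trig g \<Longrightarrow> approximable g"
  unfolding approximable_def by (auto intro: square_integrable_trig)

lemma approximable_add:
  assumes f: "approximable f" and g: "approximable g" shows "approximable (\<lambda>p. f p + g p)"
  unfolding approximable_def
proof (intro conjI allI impI)
  have sf: "square_integrable T f" and sg: "square_integrable T g"
    using f g by (auto simp: approximable_def)
  then show "square_integrable T (\<lambda>p. f p + g p)" by (rule square_integrable_add)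
  fix \<epsilon> :: real assume "\<epsilon> > 0"
  then have e4: "\<epsilon> / 4 > 0" by simp
  obtain u where u: "trig u" "(\<integral>p. (norm (f p - u p))\<^sup>2 \<partial>T) < \<epsilon> / 4"
    using f e4 unfolding approximable_def by blast
  obtain v where v: "trig v" "(\<integral>p. (norm (g p - v p))\<^sup>2 \<partial>T) < \<epsilon> / 4"
    using g e4 unfolding approximable_def by blast
  have su: "square_integrable T u" and sv: "square_integrable T v"
    using u v by (auto intro: square_integrable_trig)
  have "(\<integral>p. (norm ((f p + g p) - (u p + v p)))\<^sup>2 \<partial>T) \<le>
      2 * (\<integral>p. (norm ((f p + g p) - (u p + g p)))\<^sup>2 \<partial>T) + 2 * (\<integral>p. (norm ((u p + g p) - (u p + v p)))\<^sup>2 \<partial>T)"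
    using l2_dist_triangle[OF square_integrable_add[OF sf sg] square_integrable_add[OF su sg]
        square_integrable_add[OF su sv]] .
  also have "\<dots> < \<epsilon>" using u v by simp
  finally show "\<exists>w. trig w \<and> (\<integral>p. (norm ((f p + g p) - w p))\<^sup>2 \<partial>T) < \<epsilon>"
    using trig.add[OF u(1) v(1)] by blast
qed

lemma approximable_scale:
  assumes f: "approximable f" shows "approximable (\<lambda>p. c * f p)"
  unfolding approximable_def
proof (intro conjI allI impI)
  have sf: "square_integrable T f" using f by (auto simp: approximable_def)
  then show "square_integrable T (\<lambda>p. c * f p)" by (rule square_integrable_scale)
  fix \<epsilon> :: real assume \<epsilon>: "\<epsilon> > 0"
  define \<delta> where "\<delta> = \<epsilon> / ((norm c)\<^sup>2 + 1)"
  have pos: "(norm c)\<^sup>2 + 1 > 0" by (simp add: add_nonneg_pos)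
  have "\<delta> > 0" using \<epsilon> pos by (simp add: \<delta>_def)
  then obtain u where u: "trig u" "(\<integral>p. (norm (f p - u p))\<^sup>2 \<partial>T) < \<delta>"
    using f unfolding approximable_def by blast
  have "(\<integral>p. (norm (c * f p - c * u p))\<^sup>2 \<partial>T) = (norm c)\<^sup>2 * (\<integral>p. (norm (f p - u p))\<^sup>2 \<partial>T)"
    by (simp add: norm_mult power_mult_distrib flip: right_diff_distrib)
  also have "\<dots> \<le> (norm c)\<^sup>2 * \<delta>" using u(2) by (intro mult_left_mono) auto
  also have "\<dots> < \<epsilon>" using \<epsilon> pos unfolding \<delta>_def by (simp add: field_simps)
  finally show "\<exists>g. trig g \<and> (\<integral>p. (norm (c * f p - g p))\<^sup>2 \<partial>T) < \<epsilon>"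
    using trig.scale[OF u(1)] by blast
qed

lemma approximable_sum:
  "finite I \<Longrightarrow> (\<And>i. i \<in> I \<Longrightarrow> approximable (f i)) \<Longrightarrow> approximable (\<lambda>p. \<Sum>i\<in>I. f i p)"
  by (induction I rule: finite_induct) (auto intro: approximable_trig trig_const approximable_add)

lemma approximable_cong:
  assumes "approximable f" "\<And>p. p \<in> torus \<Gamma> \<Longrightarrow> f p = g p" shows "approximable g"
proof -
  have "square_integrable T g \<longleftrightarrow> square_integrable T f"
    unfolding square_integrable_def using assms(2)
    by (intro conj_cong measurable_cong Bochner_Integration.integrable_cong) simp_all
  moreover have "(\<integral>p. (norm (g p - h p))\<^sup>2 \<partial>T) = (\<integral>p. (norm (f p - h p))\<^sup>2 \<partial>T)" for h
    using assms(2) by (intro Bochner_Integration.integral_cong) simp_all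
  ultimately show ?thesis using assms(1) by (simp add: approximable_def)
qed

text \<open>Stone--Weierstrass on a ball containing the compact image of the embedding; uniform approximation
  implies approximation in \<open>L\<^sup>2\<close> since the volume is finite.\<close>

lemma approximable_continuous:
  fixes h :: "complex^'n \<Rightarrow> real"
  assumes h: "continuous_on UNIV h"
  shows "approximable (\<lambda>p. of_real (h (emb p)))"
  unfolding approximable_def
proof (intro conjI allI impI)
  show "square_integrable T (\<lambda>p. of_real (h (emb p)))"
    by (intro square_integrable_of_continuous_lift continuous_intros
        continuous_on_compose2[OF h continuous_on_emb_lift]) auto
  fix \<epsilon> :: real assume \<epsilon>: "\<epsilon> > 0"
  obtain K where K: "\<And>p. p \<in> torus \<Gamma> \<Longrightarrow> norm (emb p) \<le> K"
    using bounded_of_continuous_lift[OF continuous_on_emb_lift] by blast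
  define \<delta> where "\<delta> = sqrt (\<epsilon> / (2 * vol))"
  have \<delta>: "\<delta> > 0" "\<delta>\<^sup>2 * vol < \<epsilon>" using \<epsilon> vol_pos by (auto simp: \<delta>_def)
  obtain q where q: "real_polynomial_function q" "\<And>w. w \<in> cball 0 K \<Longrightarrow> \<bar>h w - q w\<bar> < \<delta>"
    using Stone_Weierstrass_real_polynomial_function[OF compact_cball continuous_on_subset[OF h] \<delta>(1)]
    by (metis subset_UNIV)
  have bd: "(norm (of_real (h (emb p)) - of_real (q (emb p)) :: complex))\<^sup>2 \<le> \<delta>\<^sup>2" if "p \<in> torus \<Gamma>" for p
  proof -
    have "\<bar>h (emb p) - q (emb p)\<bar> \<le> \<delta>" using q(2)[of "emb p"] K[OF that] by simp
    then have "\<bar>h (emb p) - q (emb p)\<bar>\<^sup>2 \<le> \<delta>\<^sup>2" by (intro power_mono) auto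
    then show ?thesis by (simp flip: of_real_diff)
  qed
  have "(\<integral>p. (norm (of_real (h (emb p)) - of_real (q (emb p)) :: complex))\<^sup>2 \<partial>T) \<le> (\<integral>p. \<delta>\<^sup>2 \<partial>T)"
    by (rule integral_mono')  (use bd in auto)
  also have "\<dots> = \<delta>\<^sup>2 * vol" using measure_T by simp
  finally show "\<exists>g. trig g \<and> (\<integral>p. (norm (of_real (h (emb p)) - g p))\<^sup>2 \<partial>T) < \<epsilon>"
    using trig_real_polynomial[OF q(1)] \<delta>(2) by (intro exI[of _ "\<lambda>p. of_real (q (emb p))"]) auto
qed

text \<open>Regularity of the image measure encloses \<open>A\<close> between a compact \<open>K\<close> and an open \<open>U\<close> whose difference has
  small measure, and a Urysohn function for \<open>K\<close> and \<open>U\<close> is close to the indicator of \<open>A\<close>.\<close>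

lemma approximable_indicator_emb:
  assumes A: "A \<in> sets borel"
  shows "approximable (\<lambda>p. indicator A (emb p))"
proof (rule approximable_limit)
  have m: "(\<lambda>p. indicator A (emb p) :: complex) \<in> borel_measurable T" using A by measurable
  show "square_integrable T (\<lambda>p. indicator A (emb p))"
    unfolding square_integrable_def using m
    by (auto intro!: integrable_const_bound[of _ 1] split: split_indicator)
  define N where "N = distr T borel emb"
  interpret N: finite_measure N unfolding N_def by (rule finite_measure_distr) measurable
  have sN: "sets N = sets borel" "space N = UNIV" by (auto simp: N_def)
  have AN: "A \<in> sets borel" using A .
  have fin: "emeasure N (space N) \<noteq> \<infinity>" by simp
  fix \<epsilon> :: real assume \<epsilon>: "\<epsilon> > 0"
  define e where "e = \<epsilon> / 3"
  have e: "e > 0" using \<epsilon> by (simp add: e_def)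
  obtain K where K: "K \<subseteq> A" "compact K" "emeasure N A < emeasure N K + ennreal e"
  proof -
    have "\<exists>K\<in>{K. K \<subseteq> A \<and> compact K}. emeasure N A < emeasure N K + ennreal e"
      using e by (intro SUP_approx_ennreal inner_regular[OF sN(1) fin AN]) auto
    then show thesis using that by blast
  qed
  obtain U where U: "A \<subseteq> U" "open U" "emeasure N U < emeasure N A + ennreal e"
  proof -
    have "\<exists>U\<in>{U. A \<subseteq> U \<and> open U}. emeasure N U < emeasure N A + ennreal e"
      using e by (intro INF_approx_ennreal outer_regular[OF sN(1) fin AN]) auto
    then show thesis using that by blast
  qed
  have KN: "K \<in> sets N" "U \<in> sets N" "A \<in> sets N"
    using K(2) U(2) A by (auto simp: sN compact_imp_closed)
  have "measure N A < measure N K + e"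
    using K(3) e by (simp add: N.emeasure_eq_measure ennreal_less_iff flip: ennreal_plus)
  moreover have "measure N U < measure N A + e"
    using U(3) e by (simp add: N.emeasure_eq_measure ennreal_less_iff flip: ennreal_plus)
  ultimately have UK: "measure N (U - K) < 2 * e"
    using N.finite_measure_Diff[OF KN(2,1)] K(1) U(1) by auto
  obtain h :: "complex^'n \<Rightarrow> real" where h: "continuous_on UNIV h"
    "\<And>x. h x \<in> closed_segment 1 0" "\<And>x. x \<in> K \<Longrightarrow> h x = 1" "\<And>x. x \<in> - U \<Longrightarrow> h x = 0"
    using Urysohn[of K "- U" "1::real" 0] K U compact_imp_closed[OF K(2)] by (auto simp: closed_Compl)
  have bd: "(norm (indicator A (emb p) - of_real (h (emb p)) :: complex))\<^sup>2 \<le> indicator (U - K) (emb p)" for p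
  proof (cases "emb p \<in> U - K")
    case True
    have "0 \<le> h (emb p)" "h (emb p) \<le> 1" using h(2)[of "emb p"] by (auto simp: closed_segment_eq_real_ivl)
    then have "\<bar>indicator A (emb p) - h (emb p)\<bar> \<le> 1"
      by (simp add: indicator_def)
    moreover have "indicator A (emb p) - of_real (h (emb p)) =
        (of_real (indicator A (emb p) - h (emb p)) :: complex)"
      by (simp add: indicator_def)
    ultimately have "norm (indicator A (emb p) - of_real (h (emb p)) :: complex) \<le> 1"
      by (simp only: norm_of_real)
    then show ?thesis using True by (simp add: power_le_one)
  next
    case False
    then have "(emb p \<in> A \<and> h (emb p) = 1) \<or> (emb p \<notin> A \<and> h (emb p) = 0)"
      using h(3,4) K(1) U(1) by blast
    then show ?thesis using False by auto
  qed
  have "(\<integral>p. (norm (indicator A (emb p) - of_real (h (emb p)) :: complex))\<^sup>2 \<partial>T) \<le>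
      (\<integral>p. indicator (U - K) (emb p) \<partial>T)"
  proof (rule integral_mono')
    show "integrable T (\<lambda>p. indicator (U - K) (emb p) :: real)"
      using KN by (intro integrable_const_bound[of _ 1]) (auto simp: sN split: split_indicator)
  qed (use bd in auto)
  also have "\<dots> = (\<integral>w. indicator (U - K) w \<partial>N)"
    unfolding N_def using KN by (subst integral_distr) (auto simp: sN)
  also have "\<dots> = measure N (U - K)" using KN by simp
  also have "\<dots> < \<epsilon>" using UK e by (simp add: e_def)
  finally show "\<exists>g. approximable g \<and> (\<integral>p. (norm (indicator A (emb p) - g p))\<^sup>2 \<partial>T) < \<epsilon>"
    using approximable_continuous[OF h(1)] by blast
qed

text \<open>The embedding has a Borel measurable left inverse, so each Borel set of the torus is
  the preimage of a Borel set.\<close>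

lemma approximable_indicator:
  assumes A: "A \<in> sets T"
  shows "approximable (\<lambda>p. indicator A p)"
proof -
  define inv where "inv = (\<lambda>w :: complex^'n. proj (B *v (\<chi> i. circle_angle (w $ i) / (2 * pi))))"
  have inv_emb: "inv (emb (proj x)) = proj x" for x
  proof -
    have "coord (B *v (\<chi> i. circle_angle (emb (proj x) $ i) / (2 * pi)) - x) $ i \<in> \<int>" for i
    proof -
      have "cis (circle_angle (emb (proj x) $ i)) = cis (2 * pi * coord x $ i)"
        by (subst cis_circle_angle)
           (simp_all add: emb_def char_proj dual_vector_in_dual dual_vector_inner)
      then obtain k :: int where "circle_angle (emb (proj x) $ i) - 2 * pi * coord x $ i = 2 * pi * of_int k"
        by (rule cis_eq_imp_diff)
      then have "coord (B *v (\<chi> i. circle_angle (emb (proj x) $ i) / (2 * pi)) - x) $ i = of_int k"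
        by (simp add: coord_diff field_simps)
      then show ?thesis by simp
    qed
    then show ?thesis unfolding inv_def proj_eq_iff mem_lattice_iff by blast
  qed
  have c: "(\<lambda>w :: complex^'n. w $ i) \<in> borel_measurable borel" for i
    by (intro borel_measurable_continuous_onI continuous_intros)
  have "(\<lambda>w. \<chi> i. circle_angle (w $ i) / (2 * pi)) \<in> borel_measurable (borel :: (complex^'n) measure)"
  proof (rule borel_measurable_euclidean_space[THEN iffD2], rule ballI)
    fix b :: "real^'n" assume "b \<in> Basis"
    then obtain i where b: "b = axis i 1" by (auto simp: Basis_vec_def)
    have "(\<lambda>w :: complex^'n. circle_angle (w $ i) / (2 * pi)) \<in> borel_measurable borel"
      using measurable_compose[OF c measurable_circle_angle] by measurable
    then show "(\<lambda>w :: complex^'n. (\<chi> i. circle_angle (w $ i) / (2 * pi)) \<bullet> b) \<in> borel_measurable borel"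
      by (simp add: b inner_axis)
  qed
  moreover have "(\<lambda>t. B *v t) \<in> borel_measurable borel"
    by (intro borel_measurable_continuous_onI linear_continuous_on matrix_vector_mul_bounded_linear)
  ultimately have "inv \<in> borel \<rightarrow>\<^sub>M torus_borel \<Gamma>"
    unfolding inv_def
    by (intro measurable_compose[OF _ measurable_torus_proj])
       (rule measurable_compose[where g = "\<lambda>t. B *v t"])
  then have "inv -` A \<in> sets borel"
    using measurable_sets[of inv borel "torus_borel \<Gamma>" A] A by (simp add: sets_T)
  from approximable_indicator_emb[OF this] show ?thesis
  proof (rule approximable_cong)
    fix p assume "p \<in> torus \<Gamma>"
    then obtain x where "p = proj x" by (auto simp: torus_def)
    then show "indicator (inv -` A) (emb p) = (indicator A p :: complex)"
      using inv_emb by (simp add: indicator_def)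
  qed
qed

lemma approximable_simple:
  assumes s: "simple_function T s"
  shows "approximable s"
proof -
  have "approximable (\<lambda>p. \<Sum>y\<in>s ` space T. y * indicator (s -` {y} \<inter> space T) p)"
    using s by (intro approximable_sum approximable_scale approximable_indicator)
      (auto simp: simple_function_def)
  then show ?thesis
  proof (rule approximable_cong)
    fix p assume p: "p \<in> torus \<Gamma>"
    have "(\<Sum>y\<in>s ` space T. y * indicator (s -` {y} \<inter> space T) p) = (\<Sum>y\<in>s ` space T. if y = s p then y else 0)"
      using p by (intro sum.cong) (auto simp: indicator_def)
    also have "\<dots> = s p" using s p by (simp add: simple_function_def)
    finally show "(\<Sum>y\<in>s ` space T. y * indicator (s -` {y} \<inter> space T) p) = s p" .
  qed
qed

lemma trig_dense:
  assumes f: "square_integrable T f"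
  shows "approximable f"
proof (rule approximable_limit[OF f])
  fix \<epsilon> :: real assume \<epsilon>: "\<epsilon> > 0"
  have fm: "f \<in> borel_measurable T" using f by (rule square_integrableD)
  obtain s where s: "\<And>i. simple_function T (s i)" "\<And>x. x \<in> space T \<Longrightarrow> (\<lambda>i. s i x) \<longlonglongrightarrow> f x"
    "\<And>i x. x \<in> space T \<Longrightarrow> dist (s i x) 0 \<le> 2 * dist (f x) 0"
    using borel_measurable_implies_sequence_metric[OF fm, of 0] by metis
  have sm: "s i \<in> borel_measurable T" for i using s(1) by (rule borel_measurable_simple_function)
  have "(\<lambda>i. \<integral>p. (norm (f p - s i p))\<^sup>2 \<partial>T) \<longlonglongrightarrow> (\<integral>p. 0 \<partial>T)"
  proof (rule integral_dominated_convergence)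
    show "integrable T (\<lambda>p. 9 * (norm (f p))\<^sup>2)" using f by (simp add: square_integrable_def)
    show "AE p in T. (\<lambda>i. (norm (f p - s i p))\<^sup>2) \<longlonglongrightarrow> 0"
    proof (rule AE_I2)
      fix p assume "p \<in> space T"
      from s(2)[OF this] have "(\<lambda>i. (norm (f p - s i p))\<^sup>2) \<longlonglongrightarrow> (norm (f p - f p))\<^sup>2"
        by (intro tendsto_intros)
      then show "(\<lambda>i. (norm (f p - s i p))\<^sup>2) \<longlonglongrightarrow> 0" by simp
    qed
    show "AE p in T. norm ((norm (f p - s i p))\<^sup>2) \<le> 9 * (norm (f p))\<^sup>2" for i
    proof (rule AE_I2)
      fix p assume "p \<in> space T"
      from s(3)[OF this, of i] have "norm (f p - s i p) \<le> 3 * norm (f p)"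
        using norm_triangle_ineq4[of "f p" "s i p"] by simp
      then have "(norm (f p - s i p))\<^sup>2 \<le> (3 * norm (f p))\<^sup>2" by (intro power_mono) auto
      then show "norm ((norm (f p - s i p))\<^sup>2) \<le> 9 * (norm (f p))\<^sup>2" by (simp add: power_mult_distrib)
    qed
  qed (use fm sm in measurable)
  then have "eventually (\<lambda>i. (\<integral>p. (norm (f p - s i p))\<^sup>2 \<partial>T) < \<epsilon>) sequentially"
    using \<epsilon> by (intro order_tendstoD(2)[where y = 0]) auto
  then obtain i where "(\<integral>p. (norm (f p - s i p))\<^sup>2 \<partial>T) < \<epsilon>"
    by (auto simp: eventually_sequentially)
  then show "\<exists>g. approximable g \<and> (\<integral>p. (norm (f p - g p))\<^sup>2 \<partial>T) < \<epsilon>"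
    using approximable_simple[OF s(1)] by blast
qed

end

section \<open>The spectrum of a flat torus and its local Weyl counting function\<close>

text \<open>Always pick a smallest element not yet chosen. An element that is never chosen would bound the sizes of
  all chosen ones, contradicting the finiteness of the sublevel sets.\<close>

lemma enumerate_by_size:
  fixes f :: "'a \<Rightarrow> real"
  assumes inf: "infinite X" and fin: "\<And>r. finite {x \<in> X. f x \<le> r}"
  obtains g :: "nat \<Rightarrow> 'a" where "bij_betw g UNIV X" "mono (\<lambda>n. f (g n))"
proof -
  have least: "\<exists>x. x \<in> X - S \<and> (\<forall>y\<in>X - S. f x \<le> f y)" if S: "finite S" for S
  proof -
    have "infinite (X - S)" using Diff_infinite_finite[OF S inf] .
    then have "X - S \<noteq> {}" by (metis finite.emptyI)
    then obtain y0 where y0: "y0 \<in> X - S" by blast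
    let ?Y = "{y \<in> X - S. f y \<le> f y0}"
    have Y: "finite ?Y" "?Y \<noteq> {}" using y0 finite_subset[OF _ fin[of "f y0"], of ?Y] by auto
    define x where "x = arg_min_on f ?Y"
    have x: "x \<in> ?Y" "\<forall>y\<in>?Y. f x \<le> f y"
      unfolding x_def using arg_min_if_finite(1)[OF Y, of f] arg_min_if_finite(2)[OF Y, of f]
      by (auto simp del: mem_Collect_eq simp: not_less Bex_def)
    have "f x \<le> f y" if "y \<in> X - S" for y
    proof (cases "f y \<le> f y0")
      case True
      then show ?thesis using x(2) that by simp
    next
      case False
      then show ?thesis using x(1) by simp
    qed
    moreover have "x \<in> X - S" using x(1) by simp
    ultimately show ?thesis by (intro exI[of _ x]) simp
  qed
  define m where "m = (\<lambda>S. SOME x. x \<in> X - S \<and> (\<forall>y\<in>X - S. f x \<le> f y))"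
  have m: "m S \<in> X - S" "\<And>y. y \<in> X - S \<Longrightarrow> f (m S) \<le> f y" if "finite S" for S
    using someI_ex[OF least[OF that]] by (auto simp: m_def)
  define S where "S = rec_nat {} (\<lambda>_ S. insert (m S) S)"
  define g where "g = (\<lambda>n. m (S n))"
  have S0: "S 0 = {}" and SS: "S (Suc n) = insert (g n) (S n)" for n
    by (simp_all add: S_def g_def)
  have fS: "finite (S n)" for n by (induction n) (auto simp: S0 SS)
  have Simg: "S n = g ` {..<n}" for n
    by (induction n) (auto simp: S0 SS lessThan_Suc)
  have gX: "g n \<in> X" "g n \<notin> S n" and gle: "\<And>y. y \<in> X - S n \<Longrightarrow> f (g n) \<le> f y" for n
    using m[OF fS[of n]] by (auto simp: g_def)
  have inj: "inj g"
  proof (rule linorder_injI)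
    fix i j :: nat assume "i < j"
    then have "g i \<in> S j" by (simp add: Simg)
    then show "g i \<noteq> g j" using gX(2)[of j] by metis
  qed
  have mono: "mono (\<lambda>n. f (g n))"
  proof (rule monoI, rule gle)
    fix i j :: nat assume "i \<le> j"
    then have "S i \<subseteq> S j" by (auto simp: Simg)
    then show "g j \<in> X - S i" using gX[of j] by blast
  qed
  have "y \<in> range g" if y: "y \<in> X" for y
  proof (rule ccontr)
    assume ny: "y \<notin> range g"
    have "f (g n) \<le> f y" for n
      by (rule gle) (use y ny in \<open>auto simp: Simg\<close>)
    then have "range g \<subseteq> {x \<in> X. f x \<le> f y}"
      using gX(1) by blast
    then have "finite (range g)" using fin finite_subset by blast
    then show False using inj finite_imageD[of g UNIV] by simp
  qed
  then have "bij_betw g UNIV X" using inj gX(1) by (auto simp: bij_betw_def)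
  then show thesis using mono that by blast
qed

lemma has_derivative_cis_inner:
  fixes \<xi> :: "'a::real_inner"
  shows "((\<lambda>x. c * cis (2 * pi * (\<xi> \<bullet> x))) has_derivative
    (\<lambda>v. c * of_real (2 * pi * (\<xi> \<bullet> v)) * \<i> * cis (2 * pi * (\<xi> \<bullet> x)))) (at x)"
proof -
  have "((\<lambda>x. \<i> * of_real (2 * pi * (\<xi> \<bullet> x))) has_derivative (\<lambda>v. \<i> * of_real (2 * pi * (\<xi> \<bullet> v)))) (at x)"
    by (intro has_derivative_mult_right has_derivative_of_real has_derivative_inner_right has_derivative_ident)
  from has_derivative_compose[OF this DERIV_exp[unfolded has_field_derivative_def]]
  have "((\<lambda>x. c * exp (\<i> * of_real (2 * pi * (\<xi> \<bullet> x)))) has_derivative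
      (\<lambda>v. c * (exp (\<i> * of_real (2 * pi * (\<xi> \<bullet> x))) * (\<i> * of_real (2 * pi * (\<xi> \<bullet> v)))))) (at x)"
    by (rule has_derivative_mult_right)
  then show ?thesis by (simp add: cis_conv_exp mult_ac)
qed

lemma frechet_derivative_cis_inner:
  fixes \<xi> :: "'a::real_inner"
  shows "frechet_derivative (\<lambda>x. c * cis (2 * pi * (\<xi> \<bullet> x))) (at x) v =
    (c * of_real (2 * pi * (\<xi> \<bullet> v)) * \<i>) * cis (2 * pi * (\<xi> \<bullet> x))"
  by (simp add: frechet_derivative_at[OF has_derivative_cis_inner, symmetric])

lemma C_k_on_cis_inner: "C_k_on k UNIV (\<lambda>x. c * cis (2 * pi * (\<xi> \<bullet> x)))"
proof (induction k arbitrary: c)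
  case 0
  show ?case by (auto simp: cis_conv_exp intro!: continuous_intros)
next
  case (Suc k)
  show ?case
    using has_derivative_cis_inner[of c \<xi>] Suc
    by (auto simp: frechet_derivative_cis_inner differentiable_def simp del: of_real_mult)
qed

lemma euclidean_laplacian_cis_inner:
  fixes \<xi> :: "'a::euclidean_space"
  shows "euclidean_laplacian (\<lambda>x. c * cis (2 * pi * (\<xi> \<bullet> x))) x =
    - of_real ((2 * pi * norm \<xi>)\<^sup>2) * (c * cis (2 * pi * (\<xi> \<bullet> x)))"
proof -
  have "euclidean_laplacian (\<lambda>x. c * cis (2 * pi * (\<xi> \<bullet> x))) x =
    (\<Sum>b\<in>Basis. - of_real ((2 * pi)\<^sup>2 * ((\<xi> \<bullet> b) * (\<xi> \<bullet> b))) * (c * cis (2 * pi * (\<xi> \<bullet> x))))"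
    unfolding euclidean_laplacian_def frechet_derivative_cis_inner
    by (intro sum.cong refl) (simp add: power2_eq_square mult_ac)
  also have "\<dots> = - of_real (\<Sum>b\<in>Basis. (2 * pi)\<^sup>2 * ((\<xi> \<bullet> b) * (\<xi> \<bullet> b))) * (c * cis (2 * pi * (\<xi> \<bullet> x)))"
    by (simp add: sum_distrib_right sum_negf)
  also have "(\<Sum>b\<in>Basis. (2 * pi)\<^sup>2 * ((\<xi> \<bullet> b) * (\<xi> \<bullet> b))) = (2 * pi * norm \<xi>)\<^sup>2"
    by (simp add: power_mult_distrib power2_norm_eq_inner euclidean_inner[of \<xi> \<xi>] sum_distrib_left)
  finally show ?thesis .
qed

lemma has_vector_derivative_quotient:
  assumes "(F has_vector_derivative D) (at 0)"
  shows "((\<lambda>t. (F t - F 0) /\<^sub>R t) \<longlongrightarrow> D) (at 0)"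
proof -
  have lim: "((\<lambda>t. norm (F t - F 0 - t *\<^sub>R D) / norm t) \<longlongrightarrow> 0) (at 0)"
    using assms by (simp add: has_vector_derivative_def has_derivative_at)
  have "((\<lambda>t. norm ((F t - F 0) /\<^sub>R t - D)) \<longlongrightarrow> 0) (at 0)"
  proof (rule Lim_transform_eventually[OF lim])
    have "norm (F t - F 0 - t *\<^sub>R D) / norm t = norm ((F t - F 0) /\<^sub>R t - D)" if "t \<noteq> 0" for t
    proof -
      have "(F t - F 0) /\<^sub>R t - D = (F t - F 0 - t *\<^sub>R D) /\<^sub>R t"
        using that by (simp add: scaleR_diff_right)
      then show ?thesis by (simp add: divide_inverse mult.commute)
    qed
    then show "eventually (\<lambda>t. norm (F t - F 0 - t *\<^sub>R D) / norm t = norm ((F t - F 0) /\<^sub>R t - D)) (at 0)"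
      by (auto simp: eventually_at_filter)
  qed
  then have "((\<lambda>t. (F t - F 0) /\<^sub>R t - D) \<longlongrightarrow> 0) (at 0)" by (rule tendsto_norm_zero_cancel)
  then show ?thesis by (rule LIM_zero_cancel)
qed

context flat_torus
begin

text \<open>The pairings with a lattice basis are integers that determine \<open>\<xi>\<close> and are bounded by a multiple of
  its norm.\<close>

lemma finite_dual_ball: "finite {\<xi> \<in> dual. norm \<xi> \<le> r}"
proof -
  have "linear (\<lambda>x. x v* B)"
    using matrix_vector_mul_linear[of "transpose B"] by simp
  then obtain K where K: "K > 0" "\<And>x. norm (x v* B) \<le> norm x * K"
    using bounded_linear.pos_bounded[OF linear_conv_bounded_linear[THEN iffD1]] by blast
  define k where "k = \<lceil>\<bar>r\<bar> * K\<rceil>"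
  define h where "h = (\<lambda>\<xi>. \<lambda>i. \<lfloor>(\<xi> v* B) $ i\<rfloor>)"
  let ?X = "{\<xi> \<in> dual. norm \<xi> \<le> r}"
  have int: "(\<xi> v* B) $ i \<in> \<int>" if "\<xi> \<in> dual" for \<xi> i
  proof -
    have "B *v axis i 1 \<in> \<Gamma>" by (simp add: mem_lattice_iff axis_def)
    then have "\<xi> \<bullet> (B *v axis i 1) \<in> \<int>" using that by (simp add: dual_lattice_def)
    moreover have "\<xi> \<bullet> (B *v axis i 1) = (\<xi> v* B) \<bullet> axis i 1"
      by (simp add: dot_lmul_matrix)
    ultimately show ?thesis by (simp add: inner_axis)
  qed
  have "inj_on h ?X"
  proof (rule inj_onI)
    fix x y assume x: "x \<in> ?X" and y: "y \<in> ?X" and eq: "h x = h y"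
    have "(x v* B) $ i = (y v* B) $ i" for i
      using int[of x i] int[of y i] x y fun_cong[OF eq, of i] unfolding h_def
      by (metis (mono_tags, lifting) Ints_cases floor_of_int mem_Collect_eq)
    then have eq': "x v* B = y v* B" by (simp add: vec_eq_iff)
    have "x \<bullet> w = y \<bullet> w" for w
      using dot_lmul_matrix[of x B "coord w"] dot_lmul_matrix[of y B "coord w"] by (simp add: eq')
    then show "x = y" using vector_eq_rdot[of x y] by simp
  qed
  moreover have "h ` ?X \<subseteq> PiE UNIV (\<lambda>_. {-k..k})"
  proof safe
    fix \<xi> i assume \<xi>: "\<xi> \<in> dual" "norm \<xi> \<le> r"
    have "\<bar>(\<xi> v* B) $ i\<bar> \<le> norm \<xi> * K"
      using component_le_norm_cart[of "\<xi> v* B" i] K(2)[of \<xi>] by linarith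
    also have "\<dots> \<le> \<bar>r\<bar> * K" using \<xi>(2) K(1) by (intro mult_right_mono) auto
    finally have "\<bar>(\<xi> v* B) $ i\<bar> \<le> of_int k" unfolding k_def by linarith
    then have "- of_int k \<le> (\<xi> v* B) $ i" "(\<xi> v* B) $ i < of_int k + 1" by linarith+
    then show "h \<xi> i \<in> {-k..k}" unfolding h_def by (simp add: le_floor_iff floor_le_iff)
  qed auto
  ultimately show ?thesis
    by (rule inj_on_finite) (intro finite_PiE, auto)
qed

lemma infinite_dual: "infinite (dual)"
proof
  assume fin: "finite (dual)"
  obtain i :: 'n where True by simp
  let ?b = "dual_vector i"
  have nz: "?b \<noteq> 0"
    using dual_vector_inner[of i "B *v axis i 1"] by (auto simp: axis_def)
  have "of_nat n *\<^sub>R ?b \<in> dual" for n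
    using dual_vector_in_dual[of i] by (auto simp: dual_lattice_def intro: Ints_mult)
  then have "range (\<lambda>n :: nat. of_nat n *\<^sub>R ?b) \<subseteq> dual" by blast
  then have "finite (range (\<lambda>n :: nat. of_nat n *\<^sub>R ?b))" using fin finite_subset by blast
  moreover have "inj (\<lambda>n :: nat. of_nat n *\<^sub>R ?b)" using nz by (auto intro: injI)
  ultimately show False using finite_imageD by blast
qed

definition eigenfunction :: "real^'n \<Rightarrow> (real^'n) set \<Rightarrow> complex"
  where "eigenfunction \<xi> p = of_real (1 / sqrt vol) * char \<xi> p"

lemma eigenfunction_lift:
  assumes "\<xi> \<in> dual"
  shows "(\<lambda>x. eigenfunction \<xi> (proj x)) = (\<lambda>x. of_real (1 / sqrt vol) * cis (2 * pi * (\<xi> \<bullet> x)))"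
  using assms by (simp add: eigenfunction_def char_proj fun_eq_iff)

lemma l2_inner_eigenfunction:
  assumes "\<xi> \<in> dual" "\<eta> \<in> dual"
  shows "l2_inner T (eigenfunction \<xi>) (eigenfunction \<eta>) = (if \<xi> = \<eta> then 1 else 0)"
proof -
  define a where "a = 1 / sqrt vol"
  have a: "a * a = 1 / vol" using vol_pos by (simp add: a_def)
  have "l2_inner T (eigenfunction \<xi>) (eigenfunction \<eta>) =
      (\<integral>p. of_real (a * a) * (char \<xi> p * cnj (char \<eta> p)) \<partial>T)"
    unfolding l2_inner_def eigenfunction_def a_def[symmetric] by (simp add: mult_ac)
  also have "\<dots> = of_real (a * a) * l2_inner T (char \<xi>) (char \<eta>)"
    unfolding l2_inner_def by (rule integral_mult_right_zero)
  finally show ?thesis unfolding a using vol_pos by (simp add: l2_inner_char[OF assms])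
qed

lemma l2_orthonormal_basis_eigenfunction:
  assumes g: "bij_betw g (UNIV :: nat set) (dual)"
  shows "l2_orthonormal_basis T (\<lambda>j. eigenfunction (g j))"
  unfolding l2_orthonormal_basis_def
proof (intro conjI allI impI)
  have gd: "g j \<in> dual" for j using g by (auto simp: bij_betw_def)
  have ginj: "g i = g j \<longleftrightarrow> i = j" for i j using g by (auto simp: bij_betw_def inj_on_def)
  show sq: "square_integrable T (eigenfunction (g j))" for j
    unfolding eigenfunction_def by (intro square_integrable_scale square_integrable_char gd)
  show on: "l2_inner T (eigenfunction (g i)) (eigenfunction (g j)) = (if i = j then 1 else 0)" for i j
    by (simp add: l2_inner_eigenfunction gd ginj)
  have ons: "l2_orthonormal_on T I (\<lambda>j. eigenfunction (g j))" for I
    using sq on by (simp add: l2_orthonormal_on_def)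
  fix f assume f: "square_integrable T f"
  define c where "c = (\<lambda>j. l2_inner T f (eigenfunction (g j)))"
  show "(\<lambda>n. \<integral>p. (norm (f p - (\<Sum>j<n. l2_inner T f (eigenfunction (g j)) * eigenfunction (g j) p)))\<^sup>2 \<partial>T) \<longlonglongrightarrow> 0"
  proof (rule LIMSEQ_I)
    fix \<epsilon> :: real assume "\<epsilon> > 0"
    then obtain u where u: "trig u" "(\<integral>p. (norm (f p - u p))\<^sup>2 \<partial>T) < \<epsilon>"
      using trig_dense[OF f] unfolding approximable_def by blast
    obtain F a where F: "finite F" "F \<subseteq> dual" "u = (\<lambda>p. \<Sum>\<xi>\<in>F. a \<xi> * char \<xi> p)"
      using trig_lincomb[OF u(1)] by blast
    define G where "G = g -` F"
    have G: "finite G" "g ` G = F" "inj_on g G"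
      using g F(1,2) by (auto simp: G_def bij_betw_def intro: finite_vimageI inj_on_subset)
    obtain N where N: "G \<subseteq> {..<N}" using G(1) finite_nat_iff_bounded by blast
    have "(\<integral>p. (norm (f p - (\<Sum>j<n. c j * eigenfunction (g j) p)))\<^sup>2 \<partial>T) < \<epsilon>" if n: "n \<ge> N" for n
    proof -
      define b where "b = (\<lambda>j. if j \<in> G then a (g j) * of_real (sqrt vol) else 0)"
      have "u p = (\<Sum>j<n. b j * eigenfunction (g j) p)" for p
      proof -
        have "u p = (\<Sum>j\<in>G. a (g j) * char (g j) p)"
          unfolding F(3) G(2)[symmetric] by (rule sum.reindex[OF G(3), simplified o_def])
        also have "\<dots> = (\<Sum>j\<in>G. b j * eigenfunction (g j) p)"
          using vol_pos by (intro sum.cong) (auto simp: b_def eigenfunction_def)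
        also have "\<dots> = (\<Sum>j<n. b j * eigenfunction (g j) p)"
          using N n by (intro sum.mono_neutral_left) (auto simp: b_def)
        finally show ?thesis .
      qed
      then show ?thesis
        using l2_best_approximation[OF finite_lessThan ons f, of n b] u(2) by (simp add: c_def)
    qed
    moreover have "0 \<le> (\<integral>p. (norm (f p - (\<Sum>j<n. c j * eigenfunction (g j) p)))\<^sup>2 \<partial>T)" for n
      by (rule integral_nonneg_AE) auto
    ultimately show "\<exists>no. \<forall>n\<ge>no. norm ((\<integral>p. (norm (f p - (\<Sum>j<n. l2_inner T f (eigenfunction (g j)) *
        eigenfunction (g j) p)))\<^sup>2 \<partial>T) - 0) < \<epsilon>"
      unfolding c_def by (intro exI[of _ N]) simp
  qed
qed

lemma dual_enumeration:
  obtains g where "bij_betw g (UNIV :: nat set) (dual)" "mono (\<lambda>n. norm (g n))"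
  using enumerate_by_size[OF infinite_dual finite_dual_ball] by blast

lemma laplace_eigenbasis_eigenfunction:
  assumes g: "bij_betw g (UNIV :: nat set) (dual)" and mono: "mono (\<lambda>n. norm (g n))"
  shows "laplace_eigenbasis \<Gamma> (\<lambda>j. eigenfunction (g j)) (\<lambda>j. 2 * pi * norm (g j))"
  unfolding laplace_eigenbasis_def
proof (intro conjI allI ballI)
  have gd: "g j \<in> dual" for j using g by (auto simp: bij_betw_def)
  show "l2_orthonormal_basis T (\<lambda>j. eigenfunction (g j))"
    by (rule l2_orthonormal_basis_eigenfunction[OF g])
  show "smooth_torus_function \<Gamma> (eigenfunction (g j))" for j
    unfolding smooth_torus_function_def smooth_on_def eigenfunction_lift[OF gd]
    by (intro allI C_k_on_cis_inner)
  show "- torus_laplacian \<Gamma> (eigenfunction (g j)) p =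
      complex_of_real ((2 * pi * norm (g j))\<^sup>2) * eigenfunction (g j) p" for j p
    unfolding torus_laplacian_def eigenfunction_lift[OF gd] euclidean_laplacian_cis_inner
    by (simp add: eigenfunction_def char_def rep_def)
  obtain j0 where j0: "g j0 = 0" using g dual_0 by (metis bij_betw_def imageE)
  have "norm (g 0) \<le> norm (g j0)" using mono by (auto dest: monoD)
  then have g0: "g 0 = 0" using j0 by simp
  then show "2 * pi * norm (g 0) = 0" by simp
  have "g 1 \<noteq> g 0" using g by (auto simp: bij_betw_def inj_on_def)
  then show "0 < 2 * pi * norm (g 1)" using g0 by simp
  show "mono (\<lambda>j. 2 * pi * norm (g j))"
    using mono by (auto simp: mono_def)
qed

definition dirderiv :: "real^'n \<Rightarrow> ((real^'n) set \<Rightarrow> complex) \<Rightarrow> (real^'n) set \<Rightarrow> complex"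
  where "dirderiv v f p = frechet_derivative (\<lambda>x. f (proj x)) (at (rep p)) v"

lemma dirderiv_proj: "dirderiv v f (proj x) = frechet_derivative (\<lambda>x. f (proj x)) (at x) v"
proof -
  let ?F = "\<lambda>x. f (proj x)"
  have shift: "(?F has_derivative D) (at x)" if "(?F has_derivative D) (at (x + \<gamma>))" "\<gamma> \<in> \<Gamma>" for D x \<gamma>
  proof -
    have "((\<lambda>y. ?F (y + \<gamma>)) has_derivative D) (at x)"
      by (rule has_derivative_compose[where f = "\<lambda>y. y + \<gamma>" and g = ?F and f' = "\<lambda>y. y" and s = UNIV, simplified])
         (use that in \<open>auto intro!: derivative_eq_intros\<close>)
    moreover have "?F (y + \<gamma>) = ?F y" for y using that(2) proj_eq_iff[of "y + \<gamma>" y] by simp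
    ultimately show ?thesis by simp
  qed
  let ?\<gamma> = "rep (proj x) - x"
  have \<gamma>: "?\<gamma> \<in> \<Gamma>" "- ?\<gamma> \<in> \<Gamma>" using rep_proj_diff lattice_minus by blast+
  have "(?F has_derivative D) (at (rep (proj x))) \<longleftrightarrow> (?F has_derivative D) (at x)" for D
    using shift[of D x ?\<gamma>] shift[of D "rep (proj x)" "- ?\<gamma>"] \<gamma> by (auto simp: algebra_simps)
  then show ?thesis unfolding dirderiv_def frechet_derivative_def by simp
qed

lemma torus_laplacian_dirderiv: "torus_laplacian \<Gamma> f p = (\<Sum>b\<in>Basis. dirderiv b (dirderiv b f) p)"
  unfolding torus_laplacian_def euclidean_laplacian_def
  by (simp add: dirderiv_def[of _ "dirderiv _ f"] dirderiv_proj rep_def)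

text \<open>This replaces integration by parts. By translation invariance, shifting \<open>f\<close> by \<open>t v\<close> multiplies its Fourier coefficient
  by \<open>exp (2 \<pi> \<i> t \<xi> \<bullet> v)\<close>; differentiate at \<open>t = 0\<close>, with dominated convergence for the difference
  quotients along \<open>t = 1/(m+1)\<close>.\<close>

lemma l2_inner_dirderiv_char:
  assumes diff: "\<And>x. (\<lambda>x. f (proj x)) differentiable (at x)"
    and cont: "continuous_on UNIV (\<lambda>x. dirderiv v f (proj x))"
    and \<xi>: "\<xi> \<in> dual"
  shows "l2_inner T (dirderiv v f) (char \<xi>) = of_real (2 * pi * (\<xi> \<bullet> v)) * \<i> * l2_inner T f (char \<xi>)"
proof -
  let ?F = "\<lambda>x. f (proj x)"
  have contF: "continuous_on UNIV ?F"
    using diff by (intro differentiable_imp_continuous_on) (simp add: differentiable_on_def)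
  have deriv: "((\<lambda>t. ?F (x + t *\<^sub>R v)) has_vector_derivative dirderiv v f (proj (x + t *\<^sub>R v))) (at t)" for x t
  proof -
    have outer: "(?F has_derivative frechet_derivative ?F (at (x + t *\<^sub>R v))) (at (x + t *\<^sub>R v))"
      by (rule frechet_derivative_works[THEN iffD1, OF diff])
    have inner: "((\<lambda>t. x + t *\<^sub>R v) has_derivative (\<lambda>t. t *\<^sub>R v)) (at t)"
      by (auto intro!: derivative_eq_intros)
    have "((\<lambda>t. ?F (x + t *\<^sub>R v)) has_derivative
        (\<lambda>t'. frechet_derivative ?F (at (x + t *\<^sub>R v)) (t' *\<^sub>R v))) (at t)"
      by (rule has_derivative_compose[where f = "\<lambda>t. x + t *\<^sub>R v" and x = t and s = UNIV, OF inner outer])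
    then show ?thesis
      by (simp add: has_vector_derivative_def dirderiv_proj
          linear_scale[OF linear_frechet_derivative[OF diff]])
  qed
  obtain K where K: "\<And>p. p \<in> torus \<Gamma> \<Longrightarrow> norm (dirderiv v f p) \<le> K"
    using bounded_of_continuous_lift[OF cont] by blast
  define s where "s = (\<lambda>m :: nat. 1 / real (Suc m))"
  have s: "s m > 0" for m by (simp add: s_def)
  have s0: "filterlim s (at 0) sequentially"
    using LIMSEQ_inverse_real_of_nat by (simp add: s_def filterlim_at inverse_eq_divide)
  define q where "q = (\<lambda>m p. (f (shift (s m *\<^sub>R v) p) - f p) / of_real (s m))"
  have q_lim: "(\<lambda>m. q m p) \<longlonglongrightarrow> dirderiv v f p" if p: "p \<in> torus \<Gamma>" for p
  proof -
    obtain x where x: "p = proj x" using p by (auto simp: torus_def)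
    have "((\<lambda>t. (?F (x + t *\<^sub>R v) - ?F x) /\<^sub>R t) \<longlongrightarrow> dirderiv v f p) (at 0)"
      using has_vector_derivative_quotient[OF deriv[of x 0]] by (simp add: x)
    from filterlim_compose[OF this s0] show ?thesis
      by (simp add: q_def x o_def scaleR_conv_of_real divide_inverse mult.commute)
  qed
  have q_bd: "norm (q m p) \<le> K" if p: "p \<in> torus \<Gamma>" for m p
  proof -
    obtain x where x: "p = proj x" using p by (auto simp: torus_def)
    have "norm (?F (x + s m *\<^sub>R v) - ?F (x + 0 *\<^sub>R v)) \<le> K * norm (s m - 0)"
    proof (rule differentiable_bound[where S = UNIV])
      have K0: "0 \<le> K" by (rule order_trans[OF norm_ge_zero K[of "proj x"]]) simp
      show "((\<lambda>t. ?F (x + t *\<^sub>R v)) has_derivative (\<lambda>u. u *\<^sub>R dirderiv v f (proj (x + t *\<^sub>R v)))) (at t within UNIV)" for t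
        using deriv by (simp add: has_vector_derivative_def)
      show "onorm (\<lambda>u. u *\<^sub>R dirderiv v f (proj (x + t *\<^sub>R v))) \<le> K" for t
        using K[of "proj (x + t *\<^sub>R v)"] K0
        by (intro onorm_bound) (simp_all add: mult.commute[of K] mult_left_mono)
    qed auto
    then show ?thesis using s[of m] by (simp add: q_def x norm_divide divide_le_eq)
  qed
  have contq: "continuous_on UNIV (\<lambda>x. f (shift w (proj x)))" for w
    unfolding shift_proj by (rule continuous_on_compose2[OF contF]) (auto intro: continuous_intros)
  have contq': "continuous_on UNIV (\<lambda>x. q m (proj x))" for m
    unfolding q_def using s[of m]
    by (intro continuous_on_divide continuous_on_diff contq contF continuous_on_const) auto
  have lim1: "(\<lambda>m. l2_inner T (q m) (char \<xi>)) \<longlonglongrightarrow> l2_inner T (dirderiv v f) (char \<xi>)"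
    unfolding l2_inner_def
  proof (rule integral_dominated_convergence)
    show "(\<lambda>p. dirderiv v f p * cnj (char \<xi> p)) \<in> borel_measurable T"
      by (intro measurable_of_continuous_lift continuous_on_mult continuous_on_cnj cont
          continuous_on_char_lift \<xi>)
    show "(\<lambda>p. q m p * cnj (char \<xi> p)) \<in> borel_measurable T" for m
      by (intro measurable_of_continuous_lift continuous_on_mult continuous_on_cnj contq'
          continuous_on_char_lift \<xi>)
    show "integrable T (\<lambda>_. K)" by simp
    show "AE p in T. (\<lambda>m. q m p * cnj (char \<xi> p)) \<longlonglongrightarrow> dirderiv v f p * cnj (char \<xi> p)"
      using q_lim by (intro AE_I2 tendsto_mult tendsto_const) simp
    show "AE p in T. norm (q m p * cnj (char \<xi> p)) \<le> K" for m
      using q_bd by (intro AE_I2) (simp add: norm_mult)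
  qed
  have trans: "l2_inner T (\<lambda>p. f (shift w p)) (char \<xi>) = cis (2 * pi * (\<xi> \<bullet> w)) * l2_inner T f (char \<xi>)" for w
  proof -
    have "l2_inner T (\<lambda>p. f (shift w p)) (char \<xi>) =
        (\<integral>p. cis (2 * pi * (\<xi> \<bullet> w)) * (f (shift w p) * cnj (char \<xi> (shift w p))) \<partial>T)"
      unfolding l2_inner_def
      by (rule Bochner_Integration.integral_cong)
         (auto simp: char_shift[OF \<xi>] cis_cnj cis_mult mult.assoc[symmetric] mult.commute[of "f _"])
    also have "\<dots> = cis (2 * pi * (\<xi> \<bullet> w)) * (\<integral>p. f (shift w p) * cnj (char \<xi> (shift w p)) \<partial>T)"
      by (rule integral_mult_right_zero)
    also have "(\<integral>p. f (shift w p) * cnj (char \<xi> (shift w p)) \<partial>T) = l2_inner T f (char \<xi>)"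
      unfolding l2_inner_def
      by (rule integral_shift) (intro measurable_of_continuous_lift continuous_intros contF continuous_on_char_lift[OF \<xi>])
    finally show ?thesis .
  qed
  have lim2: "(\<lambda>m. l2_inner T (q m) (char \<xi>)) \<longlonglongrightarrow> of_real (2 * pi * (\<xi> \<bullet> v)) * \<i> * l2_inner T f (char \<xi>)"
  proof -
    have val: "l2_inner T (q m) (char \<xi>) =
        ((cis (2 * pi * ((\<xi> \<bullet> v) * s m)) - 1) /\<^sub>R s m) * l2_inner T f (char \<xi>)" for m
    proof -
      have "l2_inner T (q m) (char \<xi>) =
          (\<integral>p. of_real (1 / s m) * ((f (shift (s m *\<^sub>R v) p) - f p) * cnj (char \<xi> p)) \<partial>T)"
        unfolding l2_inner_def q_def by (simp add: divide_inverse mult_ac)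
      also have "\<dots> = of_real (1 / s m) * l2_inner T (\<lambda>p. f (shift (s m *\<^sub>R v) p) - f p) (char \<xi>)"
        unfolding l2_inner_def by (rule integral_mult_right_zero)
      also have "l2_inner T (\<lambda>p. f (shift (s m *\<^sub>R v) p) - f p) (char \<xi>) =
          cis (2 * pi * (\<xi> \<bullet> (s m *\<^sub>R v))) * l2_inner T f (char \<xi>) - l2_inner T f (char \<xi>)"
        by (subst l2_inner_diff_left)
           (auto intro: square_integrable_of_continuous_lift contq contF continuous_on_char_lift \<xi> simp: trans)
      also have "\<xi> \<bullet> (s m *\<^sub>R v) = (\<xi> \<bullet> v) * s m" by simp
      also have "of_real (1 / s m) * (z * l2_inner T f (char \<xi>) - l2_inner T f (char \<xi>)) =
          ((z - 1) /\<^sub>R s m) * l2_inner T f (char \<xi>)" for z :: complex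
        by (simp add: scaleR_conv_of_real divide_inverse algebra_simps)
      finally show ?thesis .
    qed
    have "((\<lambda>t. cis (2 * pi * ((\<xi> \<bullet> v) * t))) has_vector_derivative of_real (2 * pi * (\<xi> \<bullet> v)) * \<i>) (at 0)"
      using has_derivative_cis_inner[of 1 "\<xi> \<bullet> v" 0]
      by (simp add: has_vector_derivative_def scaleR_conv_of_real mult_ac)
    from filterlim_compose[OF has_vector_derivative_quotient[OF this] s0]
    have "(\<lambda>m. (cis (2 * pi * ((\<xi> \<bullet> v) * s m)) - 1) /\<^sub>R s m) \<longlonglongrightarrow> of_real (2 * pi * (\<xi> \<bullet> v)) * \<i>"
      by simp
    then show ?thesis unfolding val by (intro tendsto_mult tendsto_const)
  qed
  show ?thesis by (rule LIMSEQ_unique[OF lim1 lim2])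
qed


lemma dirderiv_smooth:
  assumes "smooth_torus_function \<Gamma> f"
  shows "smooth_torus_function \<Gamma> (dirderiv v f)"
  unfolding smooth_torus_function_def smooth_on_def dirderiv_proj
proof
  fix k
  have "C_k_on (Suc k) UNIV (\<lambda>x. f (proj x))"
    using assms by (simp only: smooth_torus_function_def smooth_on_def)
  then show "C_k_on k UNIV (\<lambda>x. frechet_derivative (\<lambda>x. f (proj x)) (at x) v)" by simp
qed

lemma smooth_torus_functionD:
  assumes "smooth_torus_function \<Gamma> f"
  shows "(\<lambda>x. f (proj x)) differentiable (at x)" "continuous_on UNIV (\<lambda>x. f (proj x))"
proof -
  have "C_k_on (Suc 0) UNIV (\<lambda>x. f (proj x))" "C_k_on 0 UNIV (\<lambda>x. f (proj x))"
    using assms by (simp_all only: smooth_torus_function_def smooth_on_def)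
  then show "(\<lambda>x. f (proj x)) differentiable (at x)" "continuous_on UNIV (\<lambda>x. f (proj x))" by simp_all
qed

lemma l2_inner_laplacian_char:
  assumes f: "smooth_torus_function \<Gamma> f" and \<xi>: "\<xi> \<in> dual"
  shows "l2_inner T (torus_laplacian \<Gamma> f) (char \<xi>) = - of_real ((2 * pi * norm \<xi>)\<^sup>2) * l2_inner T f (char \<xi>)"
proof -
  have smooth: "smooth_torus_function \<Gamma> (dirderiv b f)" "smooth_torus_function \<Gamma> (dirderiv b (dirderiv b f))" for b
    using f dirderiv_smooth by blast+
  have dd: "l2_inner T (dirderiv b (dirderiv b f)) (char \<xi>) =
      (of_real (2 * pi * (\<xi> \<bullet> b)) * \<i>) * ((of_real (2 * pi * (\<xi> \<bullet> b)) * \<i>) * l2_inner T f (char \<xi>))" for b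
    by (simp only: l2_inner_dirderiv_char[OF smooth_torus_functionD(1)[OF smooth(1)] smooth_torus_functionD(2)[OF smooth(2)] \<xi>]
        l2_inner_dirderiv_char[OF smooth_torus_functionD(1)[OF f] smooth_torus_functionD(2)[OF smooth(1)] \<xi>])
  have "l2_inner T (torus_laplacian \<Gamma> f) (char \<xi>) =
      l2_inner T (\<lambda>p. \<Sum>b\<in>Basis. 1 * dirderiv b (dirderiv b f) p) (char \<xi>)"
    by (simp add: torus_laplacian_dirderiv l2_inner_def)
  also have "\<dots> = (\<Sum>b\<in>Basis. 1 * l2_inner T (dirderiv b (dirderiv b f)) (char \<xi>))"
    by (rule l2_inner_lincomb_left)
       (intro square_integrable_of_continuous_lift smooth_torus_functionD(2)[OF smooth(2)]
         continuous_on_char_lift \<xi>)+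
  also have "\<dots> = (\<Sum>b\<in>Basis. - of_real ((2 * pi)\<^sup>2 * ((\<xi> \<bullet> b) * (\<xi> \<bullet> b))) * l2_inner T f (char \<xi>))"
    unfolding dd by (intro sum.cong refl) (simp add: power2_eq_square mult_ac)
  also have "\<dots> = - of_real (\<Sum>b\<in>Basis. (2 * pi)\<^sup>2 * ((\<xi> \<bullet> b) * (\<xi> \<bullet> b))) * l2_inner T f (char \<xi>)"
    by (simp add: sum_distrib_right sum_negf)
  also have "(\<Sum>b\<in>Basis. (2 * pi)\<^sup>2 * ((\<xi> \<bullet> b) * (\<xi> \<bullet> b))) = (2 * pi * norm \<xi>)\<^sup>2"
    by (simp add: power_mult_distrib power2_norm_eq_inner euclidean_inner[of \<xi> \<xi>] sum_distrib_left)
  finally show ?thesis .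
qed

text \<open>The definition chooses an arbitrary eigenbasis \<open>e\<close>. Comparing the two ways to compute the coefficient of
  \<open>\<Delta> (e j)\<close> at a character shows that it vanishes unless the frequencies agree, so the count can be computed with
  the characters, each of which contributes \<open>1/vol\<close>.\<close>

lemma local_weyl_count_eq:
  assumes p: "p \<in> torus \<Gamma>"
  shows "local_weyl_count \<Gamma> p r = real (card {\<xi> \<in> dual. 2 * pi * norm \<xi> \<le> r}) / vol"
proof -
  obtain g where g: "bij_betw g (UNIV :: nat set) (dual)" "mono (\<lambda>n. norm (g n))"
    by (rule dual_enumeration)
  have gd: "g j \<in> dual" for j using g(1) by (auto simp: bij_betw_def)
  define b where "b = (SOME b. laplace_eigenbasis \<Gamma> (fst b) (snd b))"
  define e ev where "e = fst b" and "ev = snd b"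
  have "\<exists>b. laplace_eigenbasis \<Gamma> (fst b) (snd b)"
    using laplace_eigenbasis_eigenfunction[OF g] by (metis fst_conv snd_conv)
  from someI_ex[OF this] have "laplace_eigenbasis \<Gamma> e ev" by (simp add: b_def e_def ev_def)
  then have basis: "l2_orthonormal_basis T e" and smooth: "\<And>j. smooth_torus_function \<Gamma> (e j)"
    and eigen: "\<And>j p. p \<in> torus \<Gamma> \<Longrightarrow> - torus_laplacian \<Gamma> (e j) p = complex_of_real ((ev j)\<^sup>2) * e j p"
    and ev: "ev 0 = 0" "mono ev"
    unfolding laplace_eigenbasis_def by blast+
  have ev_nonneg: "0 \<le> ev j" for j using monoD[OF ev(2), of 0 j] ev(1) by simp
  define f where "f = (\<lambda>k. eigenfunction (g k))"
  define om where "om = (\<lambda>k. 2 * pi * norm (g k))"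
  have cross: "ev j = om k" if nz: "l2_inner T (e j) (f k) \<noteq> 0" for j k
  proof -
    have eq: "l2_inner T (e j) (f k) = of_real (1 / sqrt vol) * l2_inner T (e j) (char (g k))"
      unfolding l2_inner_def f_def eigenfunction_def
      by (subst integral_mult_right_zero[symmetric]) (simp add: mult_ac)
    have "l2_inner T (torus_laplacian \<Gamma> (e j)) (char (g k)) =
        (\<integral>p. (- of_real ((ev j)\<^sup>2)) * (e j p * cnj (char (g k) p)) \<partial>T)"
      unfolding l2_inner_def
    proof (rule Bochner_Integration.integral_cong)
      fix p assume "p \<in> space T"
      then have "torus_laplacian \<Gamma> (e j) p = - (of_real ((ev j)\<^sup>2) * e j p)"
        using arg_cong[OF eigen[of p j], of uminus] by simp
      then show "torus_laplacian \<Gamma> (e j) p * cnj (char (g k) p) =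
          (- of_real ((ev j)\<^sup>2)) * (e j p * cnj (char (g k) p))" by simp
    qed simp
    also have "\<dots> = (- of_real ((ev j)\<^sup>2)) * l2_inner T (e j) (char (g k))"
      unfolding l2_inner_def by (rule integral_mult_right_zero)
    finally have mult: "- of_real ((om k)\<^sup>2) * l2_inner T (e j) (char (g k)) =
        - of_real ((ev j)\<^sup>2) * l2_inner T (e j) (char (g k))"
      by (simp only: om_def l2_inner_laplacian_char[OF smooth gd])
    have nz': "l2_inner T (e j) (char (g k)) \<noteq> 0"
    proof
      assume "l2_inner T (e j) (char (g k)) = 0"
      then show False using nz unfolding eq by simp
    qed
    have "- complex_of_real ((om k)\<^sup>2) = - of_real ((ev j)\<^sup>2)"
      using mult unfolding mult_right_cancel[OF nz'] .
    then have "(om k)\<^sup>2 = (ev j)\<^sup>2" by (simp only: neg_equal_iff_equal of_real_eq_iff)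
    then show ?thesis
      using power2_eq_imp_eq[of "om k" "ev j"] ev_nonneg[of j] by (simp add: om_def)
  qed
  have inj: "inj g" using g(1) by (auto simp: bij_betw_def)
  have img: "g ` {k. om k \<le> r} = {\<xi> \<in> dual. 2 * pi * norm \<xi> \<le> r}"
    using g(1) by (auto simp: bij_betw_def om_def)
  have "finite {\<xi> \<in> dual. 2 * pi * norm \<xi> \<le> r}"
    by (rule finite_subset[OF _ finite_dual_ball[of "r / (2 * pi)"]]) (auto simp: field_simps)
  then have fin: "finite {k. om k \<le> r}"
    unfolding img[symmetric] using inj by (auto dest: finite_imageD intro: inj_on_subset)
  have f_lift: "continuous_on UNIV (\<lambda>x. f k (proj x))" for k
    unfolding f_def eigenfunction_def
    by (intro continuous_on_mult continuous_on_const continuous_on_char_lift gd)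
  have "local_weyl_count \<Gamma> p r = (\<Sum>j | ev j \<le> r. (norm (e j p))\<^sup>2)"
    by (simp add: local_weyl_count_def Let_def b_def e_def ev_def)
  also have "\<dots> = (\<Sum>k | om k \<le> r. (norm (f k p))\<^sup>2)"
  proof (rule spectral_counts_agree[OF basis _ cross fin])
    show "l2_orthonormal_basis T f"
      unfolding f_def by (rule l2_orthonormal_basis_eigenfunction[OF g(1)])
    fix J K :: "nat set" and a b :: "nat \<Rightarrow> complex"
    assume zero: "(\<integral>p. (norm ((\<Sum>j\<in>J. a j * e j p) - (\<Sum>k\<in>K. b k * f k p)))\<^sup>2 \<partial>T) = 0"
    have "continuous_on UNIV (\<lambda>x. (\<Sum>j\<in>J. a j * e j (proj x)) - (\<Sum>k\<in>K. b k * f k (proj x)))"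
      by (intro continuous_on_diff continuous_on_sum continuous_on_mult continuous_on_const
          smooth_torus_functionD(2)[OF smooth] f_lift)
    from continuous_lift_vanishes[OF this zero p]
    show "(\<Sum>j\<in>J. a j * e j p) - (\<Sum>k\<in>K. b k * f k p) = 0" .
  qed
  also have "\<dots> = (\<Sum>k | om k \<le> r. 1 / vol)"
    using vol_pos by (intro sum.cong) (auto simp: f_def eigenfunction_def norm_mult norm_divide power_divide)
  also have "\<dots> = real (card {\<xi> \<in> dual. 2 * pi * norm \<xi> \<le> r}) / vol"
    unfolding img[symmetric] using inj by (simp add: card_image inj_on_subset)
  finally show ?thesis .
qed

end

section \<open>Isometries of flat tori are induced by orthogonal maps\<close>

text \<open>With the base point moved to the origin, \<open>F\<close> becomes a map \<open>g\<close> that preserves inner products of small vectors.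
  Applied to \<open>t w\<close> and \<open>w\<close> as \<open>t \<rightarrow> 0\<close> this gives \<open>A w \<bullet> g w = w \<bullet> w\<close>; as \<open>A w\<close> and \<open>g w\<close>
  have the same norm as \<open>w\<close>, they coincide.\<close>

lemma distance_preserving_imp_affine:
  fixes F :: "'a::real_inner \<Rightarrow> 'b::real_inner"
  assumes dist: "\<And>z z'. z \<in> ball x r \<Longrightarrow> z' \<in> ball x r \<Longrightarrow> norm (F z - F z') = norm (z - z')"
    and deriv: "(F has_derivative A) (at x)" and iso: "\<And>v. norm (A v) = norm v"
    and z: "z \<in> ball x r"
  shows "F z = F x + A (z - x)"
proof -
  define w where "w = z - x"
  define g where "g = (\<lambda>v. F (x + v) - F x)"
  have w: "norm w < r" using z by (simp add: w_def dist_norm norm_minus_commute)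
  have inner: "g u \<bullet> g w = u \<bullet> w" if u: "norm u < r" for u
  proof -
    have b: "x + u \<in> ball x r" "x + w \<in> ball x r" "x \<in> ball x r"
      using u w by (auto simp: dist_norm intro: le_less_trans[OF norm_ge_zero])
    have n: "norm (g u) = norm u" "norm (g w) = norm w" "norm (g u - g w) = norm (u - w)"
      using dist[OF b(1) b(3)] dist[OF b(2) b(3)] dist[OF b(1) b(2)] by (simp_all add: g_def)
    show ?thesis by (simp add: dot_norm_neg n)
  qed
  have lin: "A (t *\<^sub>R w) = t *\<^sub>R A w" for t
    using linear_scale[OF has_derivative_linear[OF deriv]] .
  have "((\<lambda>t. F (x + t *\<^sub>R w)) has_derivative (\<lambda>t. A (t *\<^sub>R w))) (at 0)"
  proof (rule has_derivative_compose[where f = "\<lambda>t. x + t *\<^sub>R w" and x = 0 and s = UNIV])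
    show "((\<lambda>t. x + t *\<^sub>R w) has_derivative (\<lambda>t. t *\<^sub>R w)) (at 0)"
      by (auto intro!: derivative_eq_intros)
    show "(F has_derivative A) (at (x + 0 *\<^sub>R w))" using deriv by simp
  qed
  then have "((\<lambda>t. F (x + t *\<^sub>R w)) has_vector_derivative A w) (at 0)"
    by (simp add: has_vector_derivative_def lin)
  from has_vector_derivative_quotient[OF this]
  have lim0: "((\<lambda>t. g (t *\<^sub>R w) /\<^sub>R t) \<longlongrightarrow> A w) (at 0)" by (simp add: g_def)
  have lim: "((\<lambda>t. (g (t *\<^sub>R w) /\<^sub>R t) \<bullet> g w) \<longlongrightarrow> A w \<bullet> g w) (at 0)"
    by (intro tendsto_inner lim0 tendsto_const)
  have "((\<lambda>t. w \<bullet> w) \<longlongrightarrow> A w \<bullet> g w) (at (0::real))"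
  proof (rule Lim_transform_eventually[OF lim])
    have "eventually (\<lambda>t::real. norm (t *\<^sub>R w) < r) (at 0)"
    proof (rule order_tendstoD(2))
      show "((\<lambda>t. norm (t *\<^sub>R w)) \<longlongrightarrow> norm (0 *\<^sub>R w)) (at 0)" by (intro tendsto_intros)
      show "norm (0 *\<^sub>R w) < r" using w by (simp add: le_less_trans[OF norm_ge_zero])
    qed
    moreover have "eventually (\<lambda>t::real. t \<noteq> 0) (at 0)" by (simp add: eventually_at_filter)
    ultimately show "eventually (\<lambda>t. (g (t *\<^sub>R w) /\<^sub>R t) \<bullet> g w = w \<bullet> w) (at 0)"
    proof eventually_elim
      case (elim t)
      then show ?case using inner[OF elim(1)] by simp
    qed
  qed
  then have Aw: "A w \<bullet> g w = w \<bullet> w" by (simp add: tendsto_const_iff)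
  have "(g w - A w) \<bullet> (g w - A w) = g w \<bullet> g w - 2 * (A w \<bullet> g w) + A w \<bullet> A w"
    by (simp add: inner_diff_left inner_diff_right inner_commute)
  also have "A w \<bullet> A w = w \<bullet> w" using iso[of w] by (simp add: power2_norm_eq_inner[symmetric])
  finally have "g w = A w" using Aw inner[OF w] by simp
  then show ?thesis by (simp add: g_def w_def algebra_simps)
qed

lemma norm_diff_le_of_isometric_derivative:
  assumes "\<And>z. z \<in> ball x r \<Longrightarrow> (F has_derivative F' z) (at z)"
    and "\<And>z v. z \<in> ball x r \<Longrightarrow> norm (F' z v) = norm v"
    and "z \<in> ball x r" "z' \<in> ball x r"
  shows "norm (F z - F z') \<le> norm (z - z')"
proof -
  have "norm (F z - F z') \<le> 1 * norm (z - z')"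
  proof (rule differentiable_bound[where S = "ball x r" and f' = F'])
    show "(F has_derivative F' y) (at y within ball x r)" if "y \<in> ball x r" for y
      using assms(1)[OF that] by (rule has_derivative_at_withinI)
    show "onorm (F' y) \<le> 1" if "y \<in> ball x r" for y
      using assms(2)[OF that] by (intro onorm_bound) auto
  qed (use assms in auto)
  then show ?thesis by simp
qed

lemma smooth_on_has_derivative:
  assumes "smooth_on U F" "z \<in> U"
  shows "(F has_derivative frechet_derivative F (at z)) (at z)"
proof -
  have "C_k_on (Suc 0) U F" using assms(1) unfolding smooth_on_def by blast
  then have "F differentiable (at z)" using assms(2) by simp
  then show ?thesis by (rule frechet_derivative_works[THEN iffD1])
qed

text \<open>A continuous function with values in a discrete set is constant near \<open>z\<close>; here it is \<open>h y - y\<close>.\<close>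

lemma locally_identity:
  assumes h: "isCont h z" "h z = z"
    and per: "eventually (\<lambda>y. h y - y \<in> \<Lambda>) (nhds z)"
    and disc: "\<delta> > 0" "\<And>\<gamma>. \<gamma> \<in> \<Lambda> \<Longrightarrow> norm \<gamma> < \<delta> \<Longrightarrow> \<gamma> = 0"
  shows "eventually (\<lambda>y. h y = y) (nhds (z :: 'a::real_normed_vector))"
proof -
  have "((\<lambda>y. norm (h y - y)) \<longlongrightarrow> norm (h z - z)) (nhds z)"
    using h(1) unfolding isCont_def tendsto_at_iff_tendsto_nhds
    by (intro tendsto_norm tendsto_diff filterlim_ident)
  then have "eventually (\<lambda>y. norm (h y - y) < \<delta>) (nhds z)"
    using disc(1) h(2) by (intro order_tendstoD(2)) auto
  then show ?thesis
    using per
  proof eventually_elim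
    case (elim y)
    then show ?case using disc(2)[of "h y - y"] by simp
  qed
qed

locale torus_isometry_pair =
  G: flat_torus \<Gamma> + G': flat_torus \<Gamma>'
  for \<Gamma> \<Gamma>' :: "(real^'n) set" +
  fixes \<phi> :: "(real^'n) set \<Rightarrow> (real^'n) set"
  assumes isometry: "torus_isometry \<Gamma> \<Gamma>' \<phi>"
begin

lemma bij_\<phi>: "bij_betw \<phi> (torus \<Gamma>) (torus \<Gamma>')"
  using isometry by (simp add: torus_isometry_def torus_diffeomorphism_def)

abbreviation \<psi> where "\<psi> \<equiv> inv_into (torus \<Gamma>) \<phi>"

lemma \<psi>\<phi>: "\<psi> (\<phi> (G.proj z)) = G.proj z"
  using bij_\<phi> by (simp add: bij_betw_def)

lemma \<phi>\<psi>: "\<phi> (\<psi> (G'.proj w)) = G'.proj w"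
  using bij_betw_inv_into_right[OF bij_\<phi>] by simp

text \<open>Lifts of \<open>\<phi>\<close> and of its inverse, with base points matched by a lattice vector, are inverse to each other
  near the base points. Both have isometric derivatives, so both are 1-Lipschitz on small balls,
  and hence \<open>F\<close> preserves distances.\<close>

lemma locally_affine:
  "\<exists>A c \<epsilon>. orthogonal_transformation A \<and> \<epsilon> > 0 \<and>
    (\<forall>y\<in>ball x \<epsilon>. \<phi> (G.proj y) = G'.proj (A y + c))"
proof -
  have "smooth_torus_map \<Gamma> \<Gamma>' \<phi>" "smooth_torus_map \<Gamma>' \<Gamma> \<psi>"
    using isometry by (simp_all add: torus_isometry_def torus_diffeomorphism_def)
  then obtain U F where xU: "x \<in> U" and lift: "local_lift \<Gamma> \<Gamma>' \<phi> U F"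
    unfolding smooth_torus_map_def by blast
  define y0 where "y0 = F x"
  obtain V H where yV: "y0 \<in> V" and lift': "local_lift \<Gamma>' \<Gamma> \<psi> V H"
    using \<open>smooth_torus_map \<Gamma>' \<Gamma> \<psi>\<close> unfolding smooth_torus_map_def by blast
  have U: "open U" "smooth_on U F" "\<And>z. z \<in> U \<Longrightarrow> \<phi> (G.proj z) = G'.proj (F z)"
    using lift by (auto simp: local_lift_def)
  have V: "open V" "smooth_on V H" "\<And>w. w \<in> V \<Longrightarrow> \<psi> (G'.proj w) = G.proj (H w)"
    using lift' by (auto simp: local_lift_def)
  let ?F' = "\<lambda>z. frechet_derivative F (at z)" and ?H' = "\<lambda>z. frechet_derivative H (at z)"
  have dF: "(F has_derivative ?F' z) (at z)" if "z \<in> U" for z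
    using smooth_on_has_derivative[OF U(2) that] .
  have nF: "norm (?F' z v) = norm v" if "z \<in> U" for z v
  proof -
    have "?F' z v \<bullet> ?F' z v = v \<bullet> v" using isometry lift that by (auto simp: torus_isometry_def)
    then show ?thesis by (simp add: norm_eq_sqrt_inner)
  qed
  \<comment> \<open>the lift of the inverse, corrected by a lattice vector so that it maps \<open>F x\<close> back to \<open>x\<close>\<close>
  define K where "K = (\<lambda>w. H w + (x - H y0))"
  have Ky: "K y0 = x" by (simp add: K_def)
  have dK: "(K has_derivative ?H' w) (at w)" if "w \<in> V" for w
    using has_derivative_add[OF smooth_on_has_derivative[OF V(2) that] has_derivative_const[of "x - H y0"]]
    by (simp add: K_def)
  have "G.proj (H y0) = G.proj x" using V(3)[OF yV] U(3)[OF xU] \<psi>\<phi>[of x] by (simp add: y0_def)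
  then have \<delta>: "H y0 - x \<in> \<Gamma>" by (simp add: G.proj_eq_iff)
  have KV: "\<psi> (G'.proj w) = G.proj (K w)" if "w \<in> V" for w
    using V(3)[OF that] \<delta> by (simp add: K_def G.proj_eq_iff)
  have contF: "isCont F x" using dF[OF xU] by (rule has_derivative_continuous)
  have contK: "isCont K y0" using dK[OF yV] by (rule has_derivative_continuous)
  have evU: "eventually (\<lambda>z. z \<in> U) (nhds x)" using U(1) xU by (rule eventually_nhds_in_open)
  have evV: "eventually (\<lambda>z. z \<in> V) (nhds y0)" using V(1) yV by (rule eventually_nhds_in_open)
  have evFV: "eventually (\<lambda>z. F z \<in> V) (nhds x)"
    by (rule eventually_compose_filterlim[OF evV])
       (use contF in \<open>simp add: isCont_def tendsto_at_iff_tendsto_nhds y0_def\<close>)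
  have evKU: "eventually (\<lambda>z. K z \<in> U) (nhds y0)"
    by (rule eventually_compose_filterlim[OF evU])
       (use contK tendsto_at_iff_tendsto_nhds[of K y0] in \<open>simp add: isCont_def Ky\<close>)
  obtain \<rho> where \<rho>: "\<rho> > 0" "\<And>\<gamma>. \<gamma> \<in> \<Gamma> \<Longrightarrow> norm \<gamma> < \<rho> \<Longrightarrow> \<gamma> = 0" using G.lattice_discrete by blast
  obtain \<rho>' where \<rho>': "\<rho>' > 0" "\<And>\<gamma>. \<gamma> \<in> \<Gamma>' \<Longrightarrow> norm \<gamma> < \<rho>' \<Longrightarrow> \<gamma> = 0" using G'.lattice_discrete by blast
  have KF: "eventually (\<lambda>z. K (F z) = z) (nhds x)"
  proof (rule locally_identity[OF _ _ _ \<rho>])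
    show "isCont (\<lambda>z. K (F z)) x" using isCont_o2[OF contF] contK by (simp add: y0_def)
    show "K (F x) = x" using Ky by (simp add: y0_def)
    show "eventually (\<lambda>z. K (F z) - z \<in> \<Gamma>) (nhds x)"
      using evU evFV
    proof eventually_elim
      case (elim z)
      then have "G.proj (K (F z)) = G.proj z" using KV U(3) \<psi>\<phi> by metis
      then show ?case by (simp add: G.proj_eq_iff)
    qed
  qed
  have FK: "eventually (\<lambda>w. F (K w) = w) (nhds y0)"
  proof (rule locally_identity[OF _ _ _ \<rho>'])
    show "isCont (\<lambda>w. F (K w)) y0" using isCont_o2[OF contK] contF Ky by simp
    show "F (K y0) = y0" using Ky by (simp add: y0_def)
    show "eventually (\<lambda>w. F (K w) - w \<in> \<Gamma>') (nhds y0)"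
      using evV evKU
    proof eventually_elim
      case (elim w)
      then have "G'.proj (F (K w)) = G'.proj w" using KV U(3) \<phi>\<psi> by metis
      then show ?case by (simp add: G'.proj_eq_iff)
    qed
  qed
  have "eventually (\<lambda>z. z \<in> U \<and> K (F z) = z) (nhds x)"
    using evU KF by (rule eventually_conj)
  then obtain r1 where r1: "r1 > 0" "\<And>z. z \<in> ball x r1 \<Longrightarrow> z \<in> U \<and> K (F z) = z"
    by (auto simp: eventually_nhds_metric dist_commute)
  have "eventually (\<lambda>w. (w \<in> V \<and> K w \<in> U) \<and> F (K w) = w) (nhds y0)"
    using eventually_conj[OF evV evKU] FK by (rule eventually_conj)
  then obtain r2 where r2: "r2 > 0" "\<And>w. w \<in> ball y0 r2 \<Longrightarrow> (w \<in> V \<and> K w \<in> U) \<and> F (K w) = w"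
    by (auto simp: eventually_nhds_metric dist_commute)
  have nK: "norm (?H' w v) = norm v" if w: "w \<in> ball y0 r2" for w v
  proof -
    have wV: "w \<in> V" "K w \<in> U" using r2(2)[OF w] by auto
    have "((\<lambda>w. F (K w)) has_derivative (\<lambda>v. ?F' (K w) (?H' w v))) (at w)"
      by (rule has_derivative_compose[OF dK[OF wV(1)] dF[OF wV(2)]])
    moreover have "((\<lambda>w. F (K w)) has_derivative (\<lambda>v. v)) (at w)"
    proof (rule has_derivative_transform_within_open[of "\<lambda>w. w" _ _ _ "ball y0 r2"])
      show "((\<lambda>w. w) has_derivative (\<lambda>v. v)) (at w)" by (rule has_derivative_ident)
    qed (use w r2(2) in auto)
    ultimately have "(\<lambda>v. ?F' (K w) (?H' w v)) = (\<lambda>v. v)" by (rule has_derivative_unique)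
    then show ?thesis using nF[OF wV(2), of "?H' w v"] by (metis)
  qed
  define r where "r = min r1 r2"
  have r: "r > 0" using r1(1) r2(1) by (simp add: r_def)
  have lipF: "norm (F z - F z') \<le> norm (z - z')" if "z \<in> ball x r" "z' \<in> ball x r" for z z'
    by (rule norm_diff_le_of_isometric_derivative[of x r, OF dF nF])
       (use that r1(2) in \<open>auto simp: r_def\<close>)
  have lipK: "norm (K w - K w') \<le> norm (w - w')" if "w \<in> ball y0 r2" "w' \<in> ball y0 r2" for w w'
    by (rule norm_diff_le_of_isometric_derivative[of y0 r2, OF dK nK])
       (use that r2(2) in auto)
  have Fball: "F z \<in> ball y0 r2" if "z \<in> ball x r" for z
  proof -
    have "x \<in> ball x r" using r by simp
    then have "norm (F x - F z) \<le> norm (x - z)" using lipF that by blast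
    then show ?thesis using that by (simp add: y0_def dist_norm r_def)
  qed
  have iso: "norm (F z - F z') = norm (z - z')" if "z \<in> ball x r" "z' \<in> ball x r" for z z'
  proof (rule antisym[OF lipF[OF that]])
    have "K (F z) = z" "K (F z') = z'" using r1(2) that by (auto simp: r_def)
    then show "norm (z - z') \<le> norm (F z - F z')"
      using lipK[OF Fball[OF that(1)] Fball[OF that(2)]] by simp
  qed
  let ?A = "?F' x"
  have lin: "linear ?A" using dF[OF xU] by (rule has_derivative_linear)
  have aff: "F z = F x + ?A (z - x)" if "z \<in> ball x r" for z
    using distance_preserving_imp_affine[OF iso dF[OF xU] nF[OF xU] that] .
  have "orthogonal_transformation ?A"
    using lin nF[OF xU] by (simp add: orthogonal_transformation)
  moreover have "\<forall>y\<in>ball x r. \<phi> (G.proj y) = G'.proj (?A y + (F x - ?A x))"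
  proof
    fix y assume y: "y \<in> ball x r"
    then have "y \<in> U" using r1(2) by (auto simp: r_def)
    moreover have "F y = ?A y + (F x - ?A x)" using aff[OF y] by (simp add: linear_diff[OF lin])
    ultimately show "\<phi> (G.proj y) = G'.proj (?A y + (F x - ?A x))"
      using U(3)[of y] by (simp only:)
  qed
  ultimately show ?thesis using r by blast
qed

text \<open>The difference of the two affine maps takes values in the discrete set \<open>\<Gamma>'\<close> near \<open>x\<close>; so its linear part vanishes.\<close>

lemma affine_germ_unique:
  fixes A A' :: "real^'n \<Rightarrow> real^'n"
  assumes A: "linear A" "linear A'" and \<epsilon>: "\<epsilon> > 0"
    and eq: "\<And>y. y \<in> ball x \<epsilon> \<Longrightarrow> G'.proj (A y + c) = G'.proj (A' y + c')"
  shows "A = A'" "G'.proj c = G'.proj c'"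
proof -
  obtain \<rho> where \<rho>: "\<rho> > 0" "\<And>\<gamma>. \<gamma> \<in> \<Gamma>' \<Longrightarrow> norm \<gamma> < \<rho> \<Longrightarrow> \<gamma> = 0" using G'.lattice_discrete by blast
  define L where "L = (\<lambda>y. A y - A' y)"
  have L: "linear L" unfolding L_def by (intro linear_compose_sub A)
  have mem: "L y + (c - c') \<in> \<Gamma>'" if "y \<in> ball x \<epsilon>" for y
    using eq[OF that] by (simp add: G'.proj_eq_iff L_def algebra_simps)
  have "L v = 0" for v
  proof -
    have lim: "((\<lambda>t. norm (t *\<^sub>R u)) \<longlongrightarrow> norm (0 *\<^sub>R u)) (at_right 0)" for u :: "real^'n"
      by (intro tendsto_intros)
    have "eventually (\<lambda>t. norm (t *\<^sub>R v) < \<epsilon>) (at_right 0)"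
      by (rule order_tendstoD(2)[OF lim]) (use \<epsilon> in simp)
    moreover have "eventually (\<lambda>t. norm (t *\<^sub>R L v) < \<rho>) (at_right 0)"
      by (rule order_tendstoD(2)[OF lim]) (use \<rho> in simp)
    moreover have "eventually (\<lambda>t::real. t > 0) (at_right 0)" by (rule eventually_at_right_less)
    ultimately have "eventually (\<lambda>t. norm (t *\<^sub>R v) < \<epsilon> \<and> norm (t *\<^sub>R L v) < \<rho> \<and> t > 0) (at_right 0)"
      by eventually_elim simp
    then obtain t :: real where t: "norm (t *\<^sub>R v) < \<epsilon>" "norm (t *\<^sub>R L v) < \<rho>" "t > 0"
      using eventually_happens'[OF trivial_limit_at_right_real] by blast
    have "L (x + t *\<^sub>R v) + (c - c') - (L x + (c - c')) \<in> \<Gamma>'"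
      using t(1) \<epsilon> by (intro G'.lattice_diff mem) (auto simp: dist_norm)
    then have "t *\<^sub>R L v \<in> \<Gamma>'" by (simp add: linear_add[OF L] linear_scale[OF L])
    then have "t *\<^sub>R L v = 0" using \<rho>(2) t(2) by blast
    then show ?thesis using t(3) by simp
  qed
  then show "A = A'" by (auto simp: L_def fun_eq_iff)
  then show "G'.proj c = G'.proj c'" using mem[of x] \<epsilon> by (simp add: L_def G'.proj_eq_iff)
qed

text \<open>The affine germs of \<open>\<phi>\<close>, taken modulo \<open>\<Gamma>'\<close>, depend on the base point in a locally constant way, so by
  connectedness one affine map describes \<open>\<phi>\<close> everywhere.\<close>

lemma orthogonal_lattice_map: "\<exists>A. orthogonal_transformation A \<and> A ` \<Gamma> = \<Gamma>'"
proof -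
  have "\<forall>x. \<exists>A c \<epsilon>. orthogonal_transformation A \<and> \<epsilon> > 0 \<and>
    (\<forall>y\<in>ball x \<epsilon>. \<phi> (G.proj y) = G'.proj (A y + c))" using locally_affine by blast
  then obtain A c \<epsilon> where Ac: "\<And>x. orthogonal_transformation (A x)" "\<And>x. \<epsilon> x > 0"
    "\<And>x y. y \<in> ball x (\<epsilon> x) \<Longrightarrow> \<phi> (G.proj y) = G'.proj (A x y + c x)"
    by metis
  have "(\<lambda>x. (A x, G'.proj (c x))) constant_on UNIV"
  proof (rule locally_constant_imp_constant[OF connected_UNIV])
    fix a :: "real^'n"
    show "\<exists>W. openin (top_of_set UNIV) W \<and> a \<in> W \<and>
      (\<forall>x\<in>W. (A x, G'.proj (c x)) = (A a, G'.proj (c a)))"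
    proof (intro exI[of _ "ball a (\<epsilon> a)"] conjI ballI)
      show "openin (top_of_set UNIV) (ball a (\<epsilon> a))" by simp
      show "a \<in> ball a (\<epsilon> a)" using Ac(2) by simp
      fix x assume "x \<in> ball a (\<epsilon> a)"
      then obtain \<eta> where \<eta>: "\<eta> > 0" "ball x \<eta> \<subseteq> ball a (\<epsilon> a)"
        using openE[OF open_ball] by blast
      define \<theta> where "\<theta> = min \<eta> (\<epsilon> x)"
      have \<theta>: "\<theta> > 0" using \<eta>(1) Ac(2) by (simp add: \<theta>_def)
      have e: "G'.proj (A x y + c x) = G'.proj (A a y + c a)" if "y \<in> ball x \<theta>" for y
      proof -
        have "y \<in> ball x (\<epsilon> x)" "y \<in> ball a (\<epsilon> a)" using that \<eta>(2) by (auto simp: \<theta>_def)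
        then show ?thesis using Ac(3)[of y x] Ac(3)[of y a] by simp
      qed
      have l: "linear (A x)" "linear (A a)" using Ac(1) by (simp_all add: orthogonal_transformation_def)
      show "(A x, G'.proj (c x)) = (A a, G'.proj (c a))"
        using affine_germ_unique[OF l \<theta> e] by simp
    qed
  qed
  then obtain A0 C0 where const: "\<And>x. A x = A0" "\<And>x. G'.proj (c x) = C0"
    unfolding constant_on_def by auto
  define c0 where "c0 = c 0"
  have orth: "orthogonal_transformation A0" using Ac(1) const(1) by metis
  have lin: "linear A0" using orth by (simp add: orthogonal_transformation_def)
  have glob: "\<phi> (G.proj x) = G'.proj (A0 x + c0)" for x
  proof -
    have "G'.proj (c x) = G'.proj c0" using const(2) by (simp add: c0_def)
    then have "c x - c0 \<in> \<Gamma>'" by (simp add: G'.proj_eq_iff)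
    moreover have "\<phi> (G.proj x) = G'.proj (A0 x + c x)"
      using Ac(3)[of x x] Ac(2) const(1) by simp
    ultimately show ?thesis by (simp add: G'.proj_eq_iff)
  qed
  have iff: "A0 v \<in> \<Gamma>' \<longleftrightarrow> v \<in> \<Gamma>" for v
  proof -
    have "A0 v \<in> \<Gamma>' \<longleftrightarrow> \<phi> (G.proj v) = \<phi> (G.proj 0)"
      unfolding glob G'.proj_eq_iff by (simp add: linear_0[OF lin])
    also have "\<dots> \<longleftrightarrow> G.proj v = G.proj 0"
      using bij_\<phi> by (intro inj_on_eq_iff[of \<phi> "torus \<Gamma>"]) (auto simp: bij_betw_def)
    also have "\<dots> \<longleftrightarrow> v \<in> \<Gamma>" by (simp add: G.proj_eq_iff)
    finally show ?thesis .
  qed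
  have "A0 ` \<Gamma> = \<Gamma>'"
  proof
    show "A0 ` \<Gamma> \<subseteq> \<Gamma>'" using iff by auto
    show "\<Gamma>' \<subseteq> A0 ` \<Gamma>"
    proof
      fix \<gamma> assume \<gamma>: "\<gamma> \<in> \<Gamma>'"
      obtain v where v: "\<gamma> = A0 v" using surjD[OF orthogonal_transformation_surj[OF orth], of \<gamma>] by blast
      then have "v \<in> \<Gamma>" using iff \<gamma> by simp
      then show "\<gamma> \<in> A0 ` \<Gamma>" using v by (rule rev_image_eqI)
    qed
  qed
  then show ?thesis using orth by blast
qed

end

lemma isometric_tori_imp_congruent:
  fixes \<Gamma> \<Gamma>' :: "(real^'n) set"
  assumes "full_rank_lattice \<Gamma>" "full_rank_lattice \<Gamma>'" "isometric_tori \<Gamma> \<Gamma>'"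
  obtains A where "orthogonal_transformation A" "A ` \<Gamma> = \<Gamma>'"
proof -
  obtain \<phi> where "torus_isometry \<Gamma> \<Gamma>' \<phi>" using assms(3) by (auto simp: isometric_tori_def)
  then interpret torus_isometry_pair \<Gamma> \<Gamma>' \<phi>
    using assms by unfold_locales
  show thesis using orthogonal_lattice_map that by blast
qed

section \<open>Arithmetic of the glueing conditions\<close>

text \<open>The integral vectors in the image of \<open>3 + s S\<close>, for \<open>s = 1\<close> or \<open>s = -1\<close>: the four numbers are the
  entries of the product with \<open>3 - s S\<close>, the inverse up to the factor \<open>12\<close>.\<close>

definition glue :: "int \<Rightarrow> int \<Rightarrow> int \<Rightarrow> int \<Rightarrow> int \<Rightarrow> bool"
  where "glue s w x y z \<longleftrightarrow>
    12 dvd 3 * w - s * (x + y + z) \<and> 12 dvd 3 * x - s * (- w - y + z) \<and>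
    12 dvd 3 * y - s * (- w + x - z) \<and> 12 dvd 3 * z - s * (- w - x + y)"

lemma glueI:
  assumes "3 * w - s * (x + y + z) = 6 * a" "3 * x - s * (- w - y + z) = 6 * b"
    "3 * y - s * (- w + x - z) = 6 * c" "3 * z - s * (- w - x + y) = 6 * d"
    and "even a" "even b" "even c" "even d"
  shows "glue s w x y z"
  using assms(5-8) unfolding glue_def assms(1-4) by (auto elim!: evenE)

text \<open>With \<open>(w, x, y, z) = (3 + s S)(a, b, c, d)\<close>, the four numbers that decide membership for the opposite
  sign are the entries of \<open>(3 + s S)\<^sup>2 (a, b, c, d) = 6 (1 + s S)(a, b, c, d)\<close>. Modulo \<open>2\<close> all entries of \<open>S\<close> off the
  diagonal are \<open>1\<close>, so everything has the parity of \<open>a + b + c + d\<close>.\<close>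

lemma glue_opposite:
  assumes "glue s w x y z" and s: "s = 1 \<or> s = -1"
  obtains a b c d where
    "3 * w + s * (x + y + z) = 6 * a" "3 * x + s * (- w - y + z) = 6 * b"
    "3 * y + s * (- w + x - z) = 6 * c" "3 * z + s * (- w - x + y) = 6 * d"
    "even a \<longleftrightarrow> even w" "even b \<longleftrightarrow> even w" "even c \<longleftrightarrow> even w" "even d \<longleftrightarrow> even w"
    "even x \<longleftrightarrow> even w" "even y \<longleftrightarrow> even w" "even z \<longleftrightarrow> even w"
proof -
  obtain a b c d where e: "3 * w - s * (x + y + z) = 12 * a" "3 * x - s * (- w - y + z) = 12 * b"
    "3 * y - s * (- w + x - z) = 12 * c" "3 * z - s * (- w - x + y) = 12 * d"
    using assms(1) unfolding glue_def dvd_def by blast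
  have v: "w = 3 * a + s * (b + c + d)" "x = 3 * b + s * (- a - c + d)"
    "y = 3 * c + s * (- a + b - d)" "z = 3 * d + s * (- a - b + c)"
    using e s by auto
  show thesis
    by (rule that[of "a + s * (b + c + d)" "b + s * (- a - c + d)" "c + s * (- a + b - d)" "d + s * (- a - b + c)"])
       (use s in \<open>auto simp: v\<close>)
qed

lemma glue_even:
  assumes "glue s w x y z" "s = 1 \<or> s = -1" "even w" shows "glue (- s) w x y z"
proof -
  obtain a b c d where
    "3 * w + s * (x + y + z) = 6 * a" "3 * x + s * (- w - y + z) = 6 * b"
    "3 * y + s * (- w + x - z) = 6 * c" "3 * z + s * (- w - x + y) = 6 * d"
    "even a" "even b" "even c" "even d"
    by (rule glue_opposite[OF assms(1,2)]) (use \<open>even w\<close> in auto)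
  then show ?thesis by (intro glueI[of _ _ _ _ _ a b c d]) simp_all
qed

text \<open>For odd entries the numbers in \<open>glue_opposite\<close> are odd multiples of \<open>6\<close>. Negating an entry \<open>3 u\<close>,
  with \<open>u\<close> odd, changes each of them by an odd multiple of \<open>6\<close>: by \<open>\<plusminus>18 u\<close> or \<open>\<plusminus>6 u\<close>.\<close>

lemma glue_flip:
  assumes g: "glue s w x y z" and s: "s = 1 \<or> s = -1" and "odd w"
  shows "3 dvd w \<Longrightarrow> glue (- s) (- w) x y z"
    "3 dvd x \<Longrightarrow> glue (- s) w (- x) y z"
    "3 dvd y \<Longrightarrow> glue (- s) w x (- y) z"
    "3 dvd z \<Longrightarrow> glue (- s) w x y (- z)"
proof -
  obtain a b c d where e: "3 * w + s * (x + y + z) = 6 * a" "3 * x + s * (- w - y + z) = 6 * b"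
    "3 * y + s * (- w + x - z) = 6 * c" "3 * z + s * (- w - x + y) = 6 * d"
    and par: "odd a" "odd b" "odd c" "odd d" and odd: "odd w" "odd x" "odd y" "odd z"
    by (rule glue_opposite[OF g s]) (use \<open>odd w\<close> in auto)
  show "glue (- s) (- w) x y z" if "3 dvd w"
  proof -
    from \<open>3 dvd w\<close> obtain u where u: "w = 3 * u" by (rule dvdE)
    then have "odd u" using odd by auto
    show ?thesis
      by (rule glueI[of _ _ _ _ _ "a - 3 * u" "b + s * u" "c + s * u" "d + s * u"]) (use e s u par \<open>odd u\<close> in auto)
  qed
  show "glue (- s) w (- x) y z" if "3 dvd x"
  proof -
    from \<open>3 dvd x\<close> obtain u where u: "x = 3 * u" by (rule dvdE)
    then have "odd u" using odd by auto
    show ?thesis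
      by (rule glueI[of _ _ _ _ _ "a - s * u" "b - 3 * u" "c - s * u" "d + s * u"]) (use e s u par \<open>odd u\<close> in auto)
  qed
  show "glue (- s) w x (- y) z" if "3 dvd y"
  proof -
    from \<open>3 dvd y\<close> obtain u where u: "y = 3 * u" by (rule dvdE)
    then have "odd u" using odd by auto
    show ?thesis
      by (rule glueI[of _ _ _ _ _ "a - s * u" "b + s * u" "c - 3 * u" "d - s * u"]) (use e s u par \<open>odd u\<close> in auto)
  qed
  show "glue (- s) w x y (- z)" if "3 dvd z"
  proof -
    from \<open>3 dvd z\<close> obtain u where u: "z = 3 * u" by (rule dvdE)
    then have "odd u" using odd by auto
    show ?thesis
      by (rule glueI[of _ _ _ _ _ "a - s * u" "b - s * u" "c + s * u" "d - 3 * u"]) (use e s u par \<open>odd u\<close> in auto)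
  qed
qed

text \<open>Modulo \<open>3\<close> the conditions define the tetracode, whose words all have a zero coordinate.\<close>

lemma glue_multiple_of_3:
  assumes "glue s w x y z" and s: "s = 1 \<or> s = -1"
  shows "3 dvd w \<or> 3 dvd x \<or> 3 dvd y \<or> 3 dvd z"
proof -
  obtain a b where e: "3 * w - s * (x + y + z) = 12 * a" "3 * x - s * (- w - y + z) = 12 * b"
    using assms(1) unfolding glue_def dvd_def by blast
  have "x + y + z = 3 * (s * (w - 4 * a))" "w + y - z = 3 * (s * (4 * b - x))"
    using e s by auto
  then obtain k m where km: "x + y + z = 3 * k" "w + y - z = 3 * m" by blast
  define p q where "p = x div 3" and "q = y div 3"
  have res: "x = 3 * p \<or> x = 3 * p + 1 \<or> x = 3 * p + 2" "y = 3 * q \<or> y = 3 * q + 1 \<or> y = 3 * q + 2"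
    unfolding p_def q_def by linarith+
  have "x = 3 * p \<or> y = 3 * q \<or> z = 3 * (k - p - q - 1) \<or> w = 3 * (m + k - p - 2 * q - 1)
    \<or> w = 3 * (m + k - p - 2 * q - 2)"
    using res km by (elim disjE; simp)
  then show ?thesis by (metis dvd_triv_left)
qed

lemma glue_sign_contradiction:
  assumes "glue (-1) (3 * a) (- b) (- c) (- d)" "glue (-1) a (3 * b) c (- d)"
    and "a = 1 \<or> a = -1" "b = 1 \<or> b = -1" "c = 1 \<or> c = -1" "d = 1 \<or> d = -1"
  shows False
  using assms(3-6) assms(1,2) unfolding glue_def by (elim disjE) simp_all

lemma int_div_12: "of_int k / 12 \<in> (\<int> :: real set) \<longleftrightarrow> 12 dvd k"
proof
  assume "of_int k / 12 \<in> (\<int> :: real set)"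
  then obtain m where "of_int k / 12 = (of_int m :: real)" by (auto elim: Ints_cases)
  then have "(of_int k :: real) = of_int (12 * m)" by simp
  then have "k = 12 * m" by (simp only: of_int_eq_iff)
  then show "12 dvd k" by simp
next
  assume "12 dvd k"
  then obtain m where "k = 12 * m" by (elim dvdE)
  then show "of_int k / 12 \<in> (\<int> :: real set)" by simp
qed

lemma floor_minus_Ints: "x \<in> \<int> \<Longrightarrow> \<lfloor>- x :: real\<rfloor> = - \<lfloor>x\<rfloor>"
  by (auto elim!: Ints_cases)

section \<open>The two tori\<close>

text \<open>The weights are distinct powers of a number \<open>t\<close>. A nontrivial relation makes \<open>t\<close> a root of a nonzero integer polynomial, and
  there are only countably many such roots.\<close>

lemma exists_independent_weights:
  "\<exists>wt :: 'n::finite \<Rightarrow> real. (\<forall>i. 0 < wt i) \<and>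
    (\<forall>a :: 'n \<Rightarrow> int. (\<Sum>i\<in>UNIV. wt i * of_int (a i)) = 0 \<longrightarrow> (\<forall>i. a i = 0))"
proof -
  obtain idx :: "'n \<Rightarrow> nat" where idx: "inj idx"
    using finite_imp_inj_to_nat_seg[of "UNIV :: 'n set"] by auto
  define R where "R = (\<lambda>a :: 'n \<Rightarrow> int. {t :: real. (\<Sum>i\<in>UNIV. t ^ idx i * of_int (a i)) = 0})"
  have fin: "finite (R a)" if a: "a j \<noteq> 0" for a j
  proof -
    define N where "N = Max (range idx)"
    have N: "idx i \<le> N" for i unfolding N_def by (intro Max_ge) auto
    define c where "c = (\<lambda>k. if k \<in> range idx then (of_int (a (inv idx k)) :: real) else 0)"
    have eq: "(\<Sum>i\<in>UNIV. t ^ idx i * of_int (a i)) = (\<Sum>k\<le>N. c k * t ^ k)" for t :: real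
    proof -
      have "(\<Sum>k\<le>N. c k * t ^ k) = (\<Sum>k\<in>range idx. c k * t ^ k)"
        using N by (intro sum.mono_neutral_right) (auto simp: c_def)
      also have "\<dots> = (\<Sum>i\<in>UNIV. c (idx i) * t ^ idx i)"
        by (rule sum.reindex[OF idx, simplified o_def])
      also have "\<dots> = (\<Sum>i\<in>UNIV. t ^ idx i * of_int (a i))"
        using idx by (intro sum.cong) (auto simp: c_def)
      finally show ?thesis by simp
    qed
    have "c (idx j) \<noteq> 0" using a idx by (simp add: c_def)
    then have "finite {t. (\<Sum>k\<le>N. c k * t ^ k) = 0}"
      using N[of j] polyfun_finite_roots[of c N] by blast
    then show ?thesis by (simp add: R_def eq)
  qed
  let ?bad = "\<Union>a\<in>{a. \<exists>j. a j \<noteq> 0}. R a"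
  have "countable ?bad"
    by (intro countable_UN countableI_type) (auto intro: countable_finite fin)
  moreover have "uncountable {0<..<1::real}" by (simp add: uncountable_open_interval)
  ultimately have "\<not> {0<..<1} \<subseteq> ?bad" using countable_subset by blast
  then obtain t where "t \<in> {0<..<1}" and t': "t \<notin> ?bad" unfolding subset_iff by blast
  then have t: "0 < t" by simp
  show ?thesis
  proof (intro exI[of _ "\<lambda>i. t ^ idx i"] conjI allI impI)
    show "0 < t ^ idx i" for i using t by simp
    fix a :: "'n \<Rightarrow> int" and i
    assume "(\<Sum>i\<in>UNIV. t ^ idx i * of_int (a i)) = 0"
    then have "t \<in> R a" by (simp add: R_def)
    then show "a i = 0" using t' by auto
  qed
qed

text \<open>Four chosen coordinates carry the Conway--Sloane lattices. The weights rescale all coordinates, and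
  their independence over the rationals will exclude accidental isometries.\<close>

locale conway_sloane =
  fixes i0 i1 i2 i3 :: "'n::finite" and wt :: "'n \<Rightarrow> real"
  assumes dist: "distinct [i0, i1, i2, i3]" and wt_pos: "0 < wt i"
    and independent: "(\<Sum>i\<in>UNIV. wt i * of_int (a i)) = 0 \<Longrightarrow> a j = 0"
begin

abbreviation block :: "'n set" where "block \<equiv> {i0, i1, i2, i3}"

definition skew :: "real^'n \<Rightarrow> real^'n" where
  "skew x = (\<chi> i. if i = i0 then x$i1 + x$i2 + x$i3 else
    if i = i1 then - x$i0 - x$i2 + x$i3 else
    if i = i2 then - x$i0 + x$i1 - x$i3 else
    if i = i3 then - x$i0 - x$i1 + x$i2 else 0)"

text \<open>The map \<open>3 + s S\<close> on the four chosen coordinates, where \<open>S\<close> is \<open>skew\<close>, and the identity on the other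
  coordinates. The sign \<open>s\<close> distinguishes the two tori; changing it transposes the map.\<close>

definition twist :: "int \<Rightarrow> real^'n \<Rightarrow> real^'n" where
  "twist s x = (\<chi> i. (if i \<in> block then 3 else 1) * x$i + of_int s * skew x $ i)"

definition \<nu> :: "'n \<Rightarrow> real" where "\<nu> i = (if i \<in> block then 12 else 1)"

lemma \<nu>_pos: "0 < \<nu> i" by (simp add: \<nu>_def)

lemma distinct_indices: "i0 \<noteq> i1" "i0 \<noteq> i2" "i0 \<noteq> i3" "i1 \<noteq> i2" "i1 \<noteq> i3" "i2 \<noteq> i3"
  "i1 \<noteq> i0" "i2 \<noteq> i0" "i3 \<noteq> i0" "i2 \<noteq> i1" "i3 \<noteq> i1" "i3 \<noteq> i2"
  using dist by auto

lemma skew_component: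
  "skew x $ i0 = x$i1 + x$i2 + x$i3" "skew x $ i1 = - x$i0 - x$i2 + x$i3"
  "skew x $ i2 = - x$i0 + x$i1 - x$i3" "skew x $ i3 = - x$i0 - x$i1 + x$i2"
  "i \<notin> block \<Longrightarrow> skew x $ i = 0"
  by (simp_all add: skew_def distinct_indices)

lemma twist_component:
  "twist s x $ i0 = 3 * x$i0 + of_int s * (x$i1 + x$i2 + x$i3)"
  "twist s x $ i1 = 3 * x$i1 + of_int s * (- x$i0 - x$i2 + x$i3)"
  "twist s x $ i2 = 3 * x$i2 + of_int s * (- x$i0 + x$i1 - x$i3)"
  "twist s x $ i3 = 3 * x$i3 + of_int s * (- x$i0 - x$i1 + x$i2)"
  "i \<notin> block \<Longrightarrow> twist s x $ i = x $ i"
  by (simp_all add: twist_def skew_component)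

lemma linear_twist: "linear (twist s)"
  by (rule linearI) (simp_all add: twist_def skew_def vec_eq_iff algebra_simps)

lemma twist_opposite: assumes "s = 1 \<or> s = -1" shows "twist (- s) (twist s x) $ i = \<nu> i * x $ i"
proof (cases "i \<in> block")
  case True
  then show ?thesis using assms by (auto simp: twist_component \<nu>_def algebra_simps)
next
  case False
  then show ?thesis by (simp add: twist_component \<nu>_def)
qed

lemma sum_block: assumes "\<And>i. i \<notin> block \<Longrightarrow> f i = 0" shows "sum f UNIV = f i0 + f i1 + f i2 + (f i3 :: real)"
proof -
  have "sum f UNIV = sum f block" using assms by (intro sum.mono_neutral_right) auto
  then show ?thesis by (simp add: distinct_indices)
qed

lemma skew_adjoint: "skew x \<bullet> y = - (x \<bullet> skew y)"
proof -
  have "skew x \<bullet> y = (\<Sum>i\<in>UNIV. skew x $ i * y $ i)" by (simp add: inner_vec_def)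
  also have "\<dots> = skew x $ i0 * y $ i0 + skew x $ i1 * y $ i1 + skew x $ i2 * y $ i2 + skew x $ i3 * y $ i3"
    by (rule sum_block) (simp add: skew_component)
  also have "\<dots> = - (x $ i0 * skew y $ i0 + x $ i1 * skew y $ i1 + x $ i2 * skew y $ i2 + x $ i3 * skew y $ i3)"
    by (simp add: skew_component algebra_simps)
  also have "x $ i0 * skew y $ i0 + x $ i1 * skew y $ i1 + x $ i2 * skew y $ i2 + x $ i3 * skew y $ i3
      = (\<Sum>i\<in>UNIV. x $ i * skew y $ i)"
    by (rule sum_block[symmetric]) (simp add: skew_component)
  finally show ?thesis by (simp add: inner_vec_def)
qed

lemma twist_adjoint: "twist s x \<bullet> y = x \<bullet> twist (- s) y"
proof -
  have "twist s x \<bullet> y = (\<Sum>i\<in>UNIV. (if i \<in> block then 3 else 1) * x $ i * y $ i) + of_int s * (skew x \<bullet> y)"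
    by (simp add: twist_def inner_vec_def sum.distrib sum_distrib_left algebra_simps)
  moreover have "x \<bullet> twist (- s) y = (\<Sum>i\<in>UNIV. (if i \<in> block then 3 else 1) * x $ i * y $ i) - of_int s * (x \<bullet> skew y)"
    by (simp add: twist_def inner_vec_def sum.distrib sum_subtractf sum_distrib_left algebra_simps flip: sum_negf)
  ultimately show ?thesis by (simp add: skew_adjoint)
qed

definition scale :: "real^'n \<Rightarrow> real^'n" where "scale v = (\<chi> i. sqrt (wt i) * v $ i)"

text \<open>The inverse transpose of the map \<open>scale \<circ> twist s\<close> that generates the dual lattice.\<close>

definition basis_map :: "int \<Rightarrow> real^'n \<Rightarrow> real^'n"
  where "basis_map s z = (\<chi> i. twist s z $ i / (\<nu> i * sqrt (wt i)))"

definition coord_map :: "int \<Rightarrow> real^'n \<Rightarrow> real^'n"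
  where "coord_map s x = twist (- s) (scale x)"

definition \<Gamma> :: "int \<Rightarrow> (real^'n) set"
  where "\<Gamma> s = lattice_generated_by (matrix (basis_map s))"

lemma linear_weight_scaling: "linear scale"
  by (rule linearI) (simp_all add: scale_def vec_eq_iff algebra_simps)

lemma inj_scale: "inj scale"
  by (rule injI) (simp add: scale_def vec_eq_iff wt_pos less_imp_neq[symmetric])

lemma linear_basis_map: "linear (basis_map s)"
  by (rule linearI)
     (simp_all add: basis_map_def vec_eq_iff add_divide_distrib linear_add[OF linear_twist] linear_scale[OF linear_twist])

lemma linear_coord_map: "linear (coord_map s)"
  unfolding coord_map_def using linear_compose[OF linear_weight_scaling linear_twist] by (simp add: o_def)

lemma twist_weighted: "twist s (\<chi> i. x $ i / \<nu> i) = (\<chi> i. twist s x $ i / \<nu> i)"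
proof -
  have "twist s (\<chi> i. x $ i / \<nu> i) $ i = twist s x $ i / \<nu> i" for i
    by (cases "i \<in> block") (auto simp: twist_component \<nu>_def add_divide_distrib diff_divide_distrib)
  then show ?thesis by (simp add: vec_eq_iff)
qed

lemma scale_basis_map: "scale (basis_map s z) = (\<chi> i. twist s z $ i / \<nu> i)"
  using wt_pos by (simp add: scale_def basis_map_def vec_eq_iff less_imp_neq[symmetric])

lemma coord_basis_map: assumes "s = 1 \<or> s = -1" shows "coord_map s (basis_map s z) = z"
  unfolding coord_map_def scale_basis_map twist_weighted
  using \<nu>_pos by (simp add: vec_eq_iff twist_opposite[OF assms] less_imp_neq[symmetric])

lemma basis_coord_map: assumes "s = 1 \<or> s = -1" shows "basis_map s (coord_map s x) = x"
proof -
  have "- s = 1 \<or> - s = -1" using assms by auto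
  from twist_opposite[OF this] have "twist s (twist (- s) (scale x)) $ i = \<nu> i * scale x $ i" for i by simp
  then show ?thesis
    using \<nu>_pos wt_pos by (simp add: basis_map_def coord_map_def vec_eq_iff scale_def less_imp_neq[symmetric])
qed

lemma matrix_mult_basis_map: "matrix (basis_map s) *v x = basis_map s x"
  and matrix_mult_coord_map: "matrix (coord_map s) *v x = coord_map s x"
  by (rule matrix_works, simp add: linear_matrix_vector_mul_eq linear_basis_map linear_coord_map)+

lemma mem_\<Gamma>_iff: "x \<in> \<Gamma> s \<longleftrightarrow> (\<exists>z. (\<forall>i. z $ i \<in> \<int>) \<and> x = basis_map s z)"
  unfolding \<Gamma>_def lattice_generated_by_def
  by (auto simp: matrix_mult_basis_map)

lemma full_rank_\<Gamma>: assumes "s = 1 \<or> s = -1" shows "full_rank_lattice (\<Gamma> s)"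
proof -
  have "matrix (coord_map s) ** matrix (basis_map s) = mat 1"
    "matrix (basis_map s) ** matrix (coord_map s) = mat 1"
    unfolding matrix_eq
    by (simp_all add: matrix_vector_mul_assoc[symmetric] matrix_mult_basis_map
        matrix_mult_coord_map coord_basis_map[OF assms] basis_coord_map[OF assms])
  then have "invertible (matrix (basis_map s))" unfolding invertible_def by blast
  then show ?thesis unfolding full_rank_lattice_def \<Gamma>_def by blast
qed

definition \<Lambda> :: "int \<Rightarrow> (real^'n) set"
  where "\<Lambda> s = {v. (\<forall>i. v $ i \<in> \<int>) \<and> glue s \<lfloor>v $ i0\<rfloor> \<lfloor>v $ i1\<rfloor> \<lfloor>v $ i2\<rfloor> \<lfloor>v $ i3\<rfloor>}"

lemma twist_integral: assumes "\<And>i. v $ i \<in> \<int>" shows "twist s v $ i \<in> \<int>"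
  using assms by (cases "i \<in> block") (auto simp: twist_component intro!: Ints_add Ints_mult Ints_diff Ints_minus)

text \<open>Both sides say that \<open>v\<close> is the image of an integral vector under \<open>twist s\<close>, the inverse of which is
  \<open>twist (- s)\<close> divided by \<open>\<nu>\<close>.\<close>

lemma mem_\<Lambda>_iff:
  assumes s: "s = 1 \<or> s = -1"
  shows "v \<in> \<Lambda> s \<longleftrightarrow> (\<forall>i. twist (- s) v $ i / \<nu> i \<in> \<int>)"
proof -
  have comp: "(\<forall>i. twist (- s) v $ i / \<nu> i \<in> \<int>) \<longleftrightarrow>
      glue s \<lfloor>v $ i0\<rfloor> \<lfloor>v $ i1\<rfloor> \<lfloor>v $ i2\<rfloor> \<lfloor>v $ i3\<rfloor>" if int: "\<And>i. v $ i \<in> \<int>"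
  proof -
    have fl: "v $ i = of_int \<lfloor>v $ i\<rfloor>" for i using int[of i] by (simp add: of_int_floor)
    define w x y z where "w = \<lfloor>v $ i0\<rfloor>" and "x = \<lfloor>v $ i1\<rfloor>" and "y = \<lfloor>v $ i2\<rfloor>" and "z = \<lfloor>v $ i3\<rfloor>"
    have c: "v $ i0 = of_int w" "v $ i1 = of_int x" "v $ i2 = of_int y" "v $ i3 = of_int z"
      using fl by (simp_all add: w_def x_def y_def z_def)
    have "twist (- s) v $ i0 / \<nu> i0 = of_int (3 * w - s * (x + y + z)) / 12"
      "twist (- s) v $ i1 / \<nu> i1 = of_int (3 * x - s * (- w - y + z)) / 12"
      "twist (- s) v $ i2 / \<nu> i2 = of_int (3 * y - s * (- w + x - z)) / 12"
      "twist (- s) v $ i3 / \<nu> i3 = of_int (3 * z - s * (- w - x + y)) / 12"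
      by (simp_all add: twist_component \<nu>_def c)
    then have blk: "(\<forall>i\<in>block. twist (- s) v $ i / \<nu> i \<in> \<int>) \<longleftrightarrow> glue s w x y z"
      by (simp only: ball_simps int_div_12 glue_def) simp
    have "\<forall>i. i \<notin> block \<longrightarrow> twist (- s) v $ i / \<nu> i \<in> \<int>"
      using int by (simp add: twist_component \<nu>_def)
    then show ?thesis using blk unfolding w_def x_def y_def z_def by blast
  qed
  have "v $ i \<in> \<int>" if "\<And>i. twist (- s) v $ i / \<nu> i \<in> \<int>" for i
  proof -
    have "- s = 1 \<or> - s = -1" using s by auto
    from twist_opposite[OF this, of v] have eq: "twist s (twist (- s) v) $ i = \<nu> i * v $ i" by simp
    have "twist s (\<chi> i. twist (- s) v $ i / \<nu> i) $ i = v $ i"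
      using \<nu>_pos[of i] by (simp add: twist_weighted eq)
    moreover have "twist s (\<chi> i. twist (- s) v $ i / \<nu> i) $ i \<in> \<int>"
      using that by (intro twist_integral) simp
    ultimately show ?thesis by simp
  qed
  then show ?thesis using comp unfolding \<Lambda>_def by blast
qed

lemma dual_\<Gamma>:
  assumes s: "s = 1 \<or> s = -1"
  shows "dual_lattice (\<Gamma> s) = scale ` \<Lambda> s"
proof -
  have ip: "scale v \<bullet> basis_map s z = (\<chi> i. twist (- s) v $ i / \<nu> i) \<bullet> z" for v z
  proof -
    have "scale v \<bullet> basis_map s z = (\<Sum>i\<in>UNIV. v $ i / \<nu> i * twist s z $ i)"
      unfolding inner_vec_def
    proof (rule sum.cong)
      fix i
      have "sqrt (wt i) \<noteq> 0" using wt_pos[of i] by simp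
      then show "scale v $ i \<bullet> basis_map s z $ i = v $ i / \<nu> i * twist s z $ i"
        by (simp add: scale_def basis_map_def)
    qed simp
    also have "\<dots> = (\<chi> i. v $ i / \<nu> i) \<bullet> twist s z" by (simp add: inner_vec_def)
    also have "\<dots> = twist (- s) (\<chi> i. v $ i / \<nu> i) \<bullet> z"
      by (simp add: twist_adjoint)
    finally show ?thesis by (simp add: twist_weighted)
  qed
  have mem: "scale v \<in> dual_lattice (\<Gamma> s) \<longleftrightarrow> v \<in> \<Lambda> s" for v
  proof
    assume d: "scale v \<in> dual_lattice (\<Gamma> s)"
    have "twist (- s) v $ i / \<nu> i \<in> \<int>" for i
    proof -
      have "basis_map s (axis i 1) \<in> \<Gamma> s"
        unfolding mem_\<Gamma>_iff by (intro exI[of _ "axis i 1"]) (simp add: axis_def)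
      then have "scale v \<bullet> basis_map s (axis i 1) \<in> \<int>" using d by (simp add: dual_lattice_def)
      then show ?thesis by (simp add: ip inner_axis)
    qed
    then show "v \<in> \<Lambda> s" by (simp add: mem_\<Lambda>_iff[OF s])
  next
    assume "v \<in> \<Lambda> s"
    then have "\<And>i. twist (- s) v $ i / \<nu> i \<in> \<int>" by (simp add: mem_\<Lambda>_iff[OF s])
    then have "(\<Sum>i\<in>UNIV. (twist (- s) v $ i / \<nu> i) * z $ i) \<in> \<int>" if "\<forall>i. z $ i \<in> \<int>" for z
      using that by (intro Ints_sum Ints_mult) auto
    then have "(\<chi> i. twist (- s) v $ i / \<nu> i) \<bullet> z \<in> \<int>" if "\<forall>i. z $ i \<in> \<int>" for z
      using that by (simp add: inner_vec_def)
    then show "scale v \<in> dual_lattice (\<Gamma> s)"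
      unfolding dual_lattice_def by (auto simp: mem_\<Gamma>_iff ip)
  qed
  have "surj scale"
  proof (rule surjI)
    fix x show "scale (\<chi> i. x $ i / sqrt (wt i)) = x"
      using wt_pos by (simp add: scale_def vec_eq_iff less_imp_neq[symmetric])
  qed
  show ?thesis
  proof (intro set_eqI iffI)
    fix \<xi> assume \<xi>: "\<xi> \<in> dual_lattice (\<Gamma> s)"
    obtain v where "\<xi> = scale v" using surjD[OF \<open>surj scale\<close>, of \<xi>] by blast
    then show "\<xi> \<in> scale ` \<Lambda> s" using \<xi> mem by blast
  next
    fix \<xi> assume "\<xi> \<in> scale ` \<Lambda> s"
    then show "\<xi> \<in> dual_lattice (\<Gamma> s)" using mem by blast
  qed
qed

definition flip_index :: "real^'n \<Rightarrow> 'n" where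
  "flip_index v = (if 3 dvd \<lfloor>v $ i0\<rfloor> then i0 else if 3 dvd \<lfloor>v $ i1\<rfloor> then i1
    else if 3 dvd \<lfloor>v $ i2\<rfloor> then i2 else i3)"

text \<open>The length-preserving bijection between the two dual lattices, which is its own inverse: negation keeps
  parity and divisibility by \<open>3\<close>, so the same coordinate is selected again.\<close>

definition flip :: "real^'n \<Rightarrow> real^'n" where
  "flip v = (if odd \<lfloor>v $ i0\<rfloor> then (\<chi> i. if i = flip_index v then - v $ i else v $ i) else v)"

lemma abs_flip: "\<bar>flip v $ i\<bar> = \<bar>v $ i\<bar>"
  by (simp add: flip_def)

lemma norm_scale_flip: "norm (scale (flip v)) = norm (scale v)"
proof -
  have "(flip v $ i)\<^sup>2 = (v $ i)\<^sup>2" for i using abs_flip[of v i] by (metis power2_abs)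
  then have "scale (flip v) \<bullet> scale (flip v) = scale v \<bullet> scale v"
    unfolding inner_vec_def scale_def by (simp add: power2_eq_square mult_ac)
  then show ?thesis by (simp add: norm_eq_sqrt_inner)
qed

lemma flip_mem:
  assumes v: "v \<in> \<Lambda> s" and s: "s = 1 \<or> s = -1"
  shows "flip v \<in> \<Lambda> (- s)" "flip (flip v) = v"
proof -
  have int: "v $ i \<in> \<int>" for i using v by (simp add: \<Lambda>_def)
  have g: "glue s \<lfloor>v $ i0\<rfloor> \<lfloor>v $ i1\<rfloor> \<lfloor>v $ i2\<rfloor> \<lfloor>v $ i3\<rfloor>" using v by (simp add: \<Lambda>_def)
  have int': "flip v $ i \<in> \<int>" for i using int by (simp add: flip_def)
  have dv: "even \<lfloor>flip v $ i\<rfloor> \<longleftrightarrow> even \<lfloor>v $ i\<rfloor>" "3 dvd \<lfloor>flip v $ i\<rfloor> \<longleftrightarrow> 3 dvd \<lfloor>v $ i\<rfloor>" for i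
    using int by (auto simp: flip_def floor_minus_Ints)
  have "flip_index (flip v) = flip_index v" unfolding flip_index_def dv ..
  then show "flip (flip v) = v"
    using dv(1)[of i0] by (auto simp: flip_def vec_eq_iff)
  have "glue (- s) \<lfloor>flip v $ i0\<rfloor> \<lfloor>flip v $ i1\<rfloor> \<lfloor>flip v $ i2\<rfloor> \<lfloor>flip v $ i3\<rfloor>"
  proof (cases "even \<lfloor>v $ i0\<rfloor>")
    case True
    then show ?thesis using glue_even[OF g s] by (simp add: flip_def)
  next
    case False
    have "3 dvd \<lfloor>v $ i0\<rfloor> \<or> 3 dvd \<lfloor>v $ i1\<rfloor> \<or> 3 dvd \<lfloor>v $ i2\<rfloor> \<or> 3 dvd \<lfloor>v $ i3\<rfloor>"
      by (rule glue_multiple_of_3[OF g s])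
    then show ?thesis
      using glue_flip[OF g s False] False int
      by (auto simp: flip_def flip_index_def floor_minus_Ints distinct_indices)
  qed
  then show "flip v \<in> \<Lambda> (- s)" using int' by (simp add: \<Lambda>_def)
qed

lemma card_dual_eq:
  "card {\<xi> \<in> dual_lattice (\<Gamma> 1). 2 * pi * norm \<xi> \<le> r} =
    card {\<xi> \<in> dual_lattice (\<Gamma> (-1)). 2 * pi * norm \<xi> \<le> r}"
proof -
  let ?L = "\<lambda>s. {v \<in> \<Lambda> s. 2 * pi * norm (scale v) \<le> r}"
  have "{\<xi> \<in> dual_lattice (\<Gamma> s). 2 * pi * norm \<xi> \<le> r} = scale ` ?L s" if "s = 1 \<or> s = -1" for s
    unfolding dual_\<Gamma>[OF that] by auto
  moreover have "card (scale ` ?L s) = card (?L s)" for s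
    using inj_scale by (intro card_image) (auto intro: inj_on_subset)
  moreover have "bij_betw flip (?L 1) (?L (-1))"
    by (rule bij_betwI[where g = flip]) (use flip_mem[of _ 1] flip_mem[of _ "-1"] in \<open>auto simp: norm_scale_flip\<close>)
  ultimately show ?thesis by (simp add: bij_betw_same_card)
qed

text \<open>As \<open>twist (- s)\<close> is both the transpose of \<open>twist s\<close> and, up to \<open>\<nu>\<close>, its inverse, the
  two basis maps take the unit ball to the same ellipsoid \<open>\<Sum>i. wt i * \<nu> i * (x $ i)\<^sup>2 < 1\<close>.\<close>

lemma vol_\<Gamma>_eq: "flat_torus.vol (\<Gamma> (-1)) = flat_torus.vol (\<Gamma> 1)"
proof (rule vol_linear_image)
  let ?L = "basis_map (-1) \<circ> coord_map 1" and ?L' = "basis_map 1 \<circ> coord_map (-1)"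
  let ?Q = "basis_map 1 ` ball 0 1"
  show "full_rank_lattice (\<Gamma> 1)" "full_rank_lattice (\<Gamma> (-1))" by (simp_all add: full_rank_\<Gamma>)
  show "linear ?L" "linear ?L'"
    by (intro linear_compose linear_basis_map linear_coord_map)+
  show "?L (?L' x) = x" "?L' (?L x) = x" for x
    by (simp_all add: coord_basis_map basis_coord_map)
  have quad: "(\<Sum>i\<in>UNIV. wt i * \<nu> i * (basis_map s z $ i)\<^sup>2) = z \<bullet> z" if s: "s = 1 \<or> s = -1" for s z
  proof -
    have "wt i * \<nu> i * (basis_map s z $ i)\<^sup>2 = twist s z $ i * (twist s z $ i / \<nu> i)" for i
    proof -
      have "(sqrt (wt i))\<^sup>2 = wt i" using wt_pos[of i] by simp
      then show ?thesis using wt_pos[of i] \<nu>_pos[of i]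
        by (simp add: basis_map_def power_divide power_mult_distrib field_simps power2_eq_square)
    qed
    then have "(\<Sum>i\<in>UNIV. wt i * \<nu> i * (basis_map s z $ i)\<^sup>2) = twist s z \<bullet> (\<chi> i. twist s z $ i / \<nu> i)"
      by (simp add: inner_vec_def)
    also have "\<dots> = z \<bullet> coord_map s (basis_map s z)"
      by (simp add: twist_adjoint coord_map_def scale_basis_map)
    finally show ?thesis by (simp add: coord_basis_map[OF s])
  qed
  have ell: "basis_map s ` ball 0 1 = {x. (\<Sum>i\<in>UNIV. wt i * \<nu> i * (x $ i)\<^sup>2) < 1}" if s: "s = 1 \<or> s = -1" for s
  proof -
    have ball: "z \<in> ball 0 1 \<longleftrightarrow> z \<bullet> z < 1" for z :: "real^'n"
      by (simp add: norm_eq_sqrt_inner real_sqrt_lt_1_iff)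
    show ?thesis
    proof (intro set_eqI iffI)
      fix x assume "x \<in> {x. (\<Sum>i\<in>UNIV. wt i * \<nu> i * (x $ i)\<^sup>2) < 1}"
      then have "coord_map s x \<in> ball 0 1"
        unfolding ball using quad[OF s, of "coord_map s x"] by (simp add: basis_coord_map[OF s])
      then have "basis_map s (coord_map s x) \<in> basis_map s ` ball 0 1" by (rule imageI)
      then show "x \<in> basis_map s ` ball 0 1" by (simp add: basis_coord_map[OF s])
    next
      fix x assume "x \<in> basis_map s ` ball 0 1"
      then show "x \<in> {x. (\<Sum>i\<in>UNIV. wt i * \<nu> i * (x $ i)\<^sup>2) < 1}"
        using quad[OF s] ball by auto
    qed
  qed
  show "open ?Q" unfolding ell[of 1, simplified] by (intro open_Collect_less continuous_intros)
  show "bounded ?Q"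
    by (intro bounded_linear_image bounded_ball linear_basis_map[unfolded linear_conv_bounded_linear])
  show "?Q \<noteq> {}" by simp
  have "?L ` ?Q = basis_map (-1) ` ball 0 1"
    by (simp add: image_image coord_basis_map)
  then show "?L ` ?Q = ?Q" using ell[of 1] ell[of "-1"] by simp
  show "\<Gamma> (-1) = ?L ` \<Gamma> 1"
  proof (intro set_eqI iffI)
    fix x assume "x \<in> \<Gamma> (-1)"
    then obtain z where z: "\<forall>i. z $ i \<in> \<int>" "x = basis_map (-1) z" by (auto simp: mem_\<Gamma>_iff)
    then have "basis_map 1 z \<in> \<Gamma> 1" by (auto simp: mem_\<Gamma>_iff)
    moreover have "x = ?L (basis_map 1 z)" using z(2) by (simp add: coord_basis_map)
    ultimately show "x \<in> ?L ` \<Gamma> 1" by (rule rev_image_eqI)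
  next
    fix x assume "x \<in> ?L ` \<Gamma> 1"
    then obtain z where z: "\<forall>i. z $ i \<in> \<int>" "x = ?L (basis_map 1 z)" by (auto simp: mem_\<Gamma>_iff)
    then have "x = basis_map (-1) z" by (simp add: coord_basis_map)
    then show "x \<in> \<Gamma> (-1)" using z(1) unfolding mem_\<Gamma>_iff by blast
  qed
qed

lemma local_weyl_counts_agree:
  assumes "x \<in> torus (\<Gamma> 1)" "y \<in> torus (\<Gamma> (-1))"
  shows "local_weyl_count (\<Gamma> 1) x r = local_weyl_count (\<Gamma> (-1)) y r"
proof -
  interpret G: flat_torus "\<Gamma> 1" by unfold_locales (simp add: full_rank_\<Gamma>)
  interpret G': flat_torus "\<Gamma> (-1)" by unfold_locales (simp add: full_rank_\<Gamma>)
  show ?thesis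
    using G.local_weyl_count_eq[OF assms(1)] G'.local_weyl_count_eq[OF assms(2)] card_dual_eq vol_\<Gamma>_eq by simp
qed

text \<open>\<open>T\<close> is the congruence in unscaled coordinates of the dual lattices. It preserves the quadratic form with
  coefficients \<open>wt i\<close>, and the squared coordinates are integers, so by independence each of them is preserved
  separately.\<close>

lemma congruence_preserves_coordinates:
  assumes A: "orthogonal_transformation A" "A ` \<Gamma> 1 = \<Gamma> (-1)"
  obtains T where "linear T" "\<And>v. v \<in> \<Lambda> 1 \<Longrightarrow> T v \<in> \<Lambda> (-1)"
    "\<And>v i. v \<in> \<Lambda> 1 \<Longrightarrow> (T v $ i)\<^sup>2 = (v $ i)\<^sup>2"
proof -
  define unscale where "unscale = (\<lambda>x :: real^'n. \<chi> i. x $ i / sqrt (wt i))"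
  have us: "unscale (scale v) = v" for v
    using wt_pos by (simp add: unscale_def scale_def vec_eq_iff less_imp_neq[symmetric])
  have lin_us: "linear unscale"
    by (rule linearI) (simp_all add: unscale_def vec_eq_iff add_divide_distrib)
  have linA: "linear A" using A(1) by (simp add: orthogonal_transformation_def)
  have inner: "A x \<bullet> A y = x \<bullet> y" for x y using A(1) by (simp add: orthogonal_transformation_def)
  define T where "T = (\<lambda>v. unscale (A (scale v)))"
  have linT: "linear T"
    unfolding T_def using linear_compose[OF linear_compose[OF linear_weight_scaling linA] lin_us] by (simp add: o_def)
  have AT: "scale (T v) = A (scale v) \<and> T v \<in> \<Lambda> (-1)" if v: "v \<in> \<Lambda> 1" for v
  proof -
    have d: "scale v \<in> dual_lattice (\<Gamma> 1)" using v dual_\<Gamma>[of 1] by simp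
    have "A (scale v) \<in> dual_lattice (\<Gamma> (-1))"
      unfolding dual_lattice_def A(2)[symmetric] using d by (simp add: inner dual_lattice_def)
    then obtain u where "u \<in> \<Lambda> (-1)" "A (scale v) = scale u" using dual_\<Gamma>[of "-1"] by auto
    then show ?thesis by (simp add: T_def us)
  qed
  have sq: "(T v $ i)\<^sup>2 = (v $ i)\<^sup>2" if v: "v \<in> \<Lambda> 1" for v i
  proof -
    have int: "v $ i \<in> \<int>" "T v $ i \<in> \<int>" for i using v AT[OF v] by (auto simp: \<Lambda>_def)
    define a where "a = (\<lambda>i. \<lfloor>(T v $ i)\<rfloor>\<^sup>2 - \<lfloor>v $ i\<rfloor>\<^sup>2)"
    have a: "of_int (a i) = (T v $ i)\<^sup>2 - (v $ i)\<^sup>2" for i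
      using int by (simp add: a_def of_int_floor)
    have q: "scale u \<bullet> scale u = (\<Sum>i\<in>UNIV. wt i * (u $ i)\<^sup>2)" for u
    proof -
      have "scale u $ i * scale u $ i = wt i * (u $ i)\<^sup>2" for i
      proof -
        have "sqrt (wt i) * sqrt (wt i) = wt i" using wt_pos[of i] by simp
        then show ?thesis by (simp add: scale_def power2_eq_square mult_ac)
      qed
      then show ?thesis by (simp add: inner_vec_def)
    qed
    have "scale (T v) \<bullet> scale (T v) = scale v \<bullet> scale v" using AT[OF v] by (simp add: inner)
    then have "(\<Sum>i\<in>UNIV. wt i * of_int (a i)) = 0"
      by (simp add: q a right_diff_distrib sum_subtractf)
    then have "a i = 0" by (rule independent)
    then show ?thesis using a[of i] by simp
  qed
  show thesis using that[OF linT] AT sq by blast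
qed

text \<open>Two lattice vectors suffice. Polarization, using \<open>p + q\<close>, shows that \<open>T\<close> changes the coordinates of \<open>p\<close> and \<open>q\<close> by
  the same signs, since no coordinate of \<open>p\<close> in the four places vanishes. None of the \<open>16\<close> choices of signs is compatible with
  the conditions for the other lattice.\<close>

lemma not_congruent:
  assumes "orthogonal_transformation A" "A ` \<Gamma> 1 = \<Gamma> (-1)" shows False
proof -
  obtain T where T: "linear T" "\<And>v. v \<in> \<Lambda> 1 \<Longrightarrow> T v \<in> \<Lambda> (-1)"
    "\<And>v i. v \<in> \<Lambda> 1 \<Longrightarrow> (T v $ i)\<^sup>2 = (v $ i)\<^sup>2"
    using congruence_preserves_coordinates[OF assms] by blast
  define p where "p = twist 1 (axis i0 1)"
  define q where "q = twist 1 (axis i1 1)"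
  have pv: "p $ i0 = 3" "p $ i1 = -1" "p $ i2 = -1" "p $ i3 = -1" "i \<notin> block \<Longrightarrow> p $ i = 0" for i
    by (auto simp: p_def twist_component axis_def distinct_indices)
  have qv: "q $ i0 = 1" "q $ i1 = 3" "q $ i2 = 1" "q $ i3 = -1" "i \<notin> block \<Longrightarrow> q $ i = 0" for i
    by (auto simp: q_def twist_component axis_def distinct_indices)
  have mem: "twist 1 z \<in> \<Lambda> 1" if "\<And>i. z $ i \<in> \<int>" for z
    unfolding mem_\<Lambda>_iff[of 1, simplified] using that \<nu>_pos twist_opposite[of 1 z] by (simp add: less_imp_neq[symmetric])
  have "p \<in> \<Lambda> 1" "q \<in> \<Lambda> 1" unfolding p_def q_def by (auto intro!: mem simp: axis_def)
  have "p + q = twist 1 (axis i0 1 + axis i1 1)" by (simp add: p_def q_def linear_add[OF linear_twist])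
  then have "p + q \<in> \<Lambda> 1" by (auto intro!: mem simp: axis_def)
  have prod: "T p $ i * T q $ i = p $ i * q $ i" for i
    using T(3)[OF \<open>p + q \<in> \<Lambda> 1\<close>, of i] T(3)[OF \<open>p \<in> \<Lambda> 1\<close>, of i] T(3)[OF \<open>q \<in> \<Lambda> 1\<close>, of i]
    by (simp add: linear_add[OF T(1)] power2_sum)
  define e where "e = (\<lambda>i. if T p $ i = p $ i then 1 else -1 :: int)"
  have ep: "T p $ i = of_int (e i) * p $ i" for i
  proof (cases "T p $ i = p $ i")
    case True
    then show ?thesis by (simp add: e_def)
  next
    case False
    then have "T p $ i = - p $ i"
      using T(3)[OF \<open>p \<in> \<Lambda> 1\<close>, of i] unfolding power2_eq_iff by blast
    then show ?thesis using False by (simp add: e_def)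
  qed
  have eq: "T q $ i = of_int (e i) * q $ i" if "i \<in> block" for i
  proof -
    have pi: "p $ i \<noteq> 0" using that pv(1-4) by auto
    have "of_int (e i) * (of_int (e i) * (p $ i * T q $ i)) = of_int (e i) * (p $ i * q $ i)"
      using prod[of i] unfolding ep by (simp add: mult.assoc)
    moreover have "of_int (e i) * (of_int (e i) * r) = r" for r :: real by (simp add: e_def)
    ultimately have "p $ i * T q $ i = p $ i * (of_int (e i) * q $ i)" by (simp add: mult.left_commute)
    then show ?thesis using pi by simp
  qed
  have Tp: "T p $ i0 = of_int (3 * e i0)" "T p $ i1 = of_int (- e i1)" "T p $ i2 = of_int (- e i2)"
    "T p $ i3 = of_int (- e i3)"
    by (simp_all add: ep pv)
  have Tq: "T q $ i0 = of_int (e i0)" "T q $ i1 = of_int (3 * e i1)" "T q $ i2 = of_int (e i2)"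
    "T q $ i3 = of_int (- e i3)"
    by (simp_all add: eq qv)
  have g1: "glue (-1) (3 * e i0) (- e i1) (- e i2) (- e i3)"
    using T(2)[OF \<open>p \<in> \<Lambda> 1\<close>] by (simp only: \<Lambda>_def Tp floor_of_int mem_Collect_eq)
  have g2: "glue (-1) (e i0) (3 * e i1) (e i2) (- e i3)"
    using T(2)[OF \<open>q \<in> \<Lambda> 1\<close>] by (simp only: \<Lambda>_def Tq floor_of_int mem_Collect_eq)
  have "e i = 1 \<or> e i = -1" for i by (simp add: e_def)
  then show False using glue_sign_contradiction[OF g1 g2] by blast
qed

lemma not_isometric: "\<not> isometric_tori (\<Gamma> 1) (\<Gamma> (-1))"
  using isometric_tori_imp_congruent[OF full_rank_\<Gamma> full_rank_\<Gamma>, of 1 "-1"] not_congruent by auto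

end

theorem proposition1:
  assumes "CARD('n::finite) \<ge> 4"
  shows "\<exists>\<Gamma> \<Gamma>' :: (real^'n) set.
    full_rank_lattice \<Gamma> \<and> full_rank_lattice \<Gamma>' \<and>
    \<not> isometric_tori \<Gamma> \<Gamma>' \<and>
    (\<forall>x\<in>torus \<Gamma>. \<forall>y\<in>torus \<Gamma>'. \<forall>r.
      local_weyl_count \<Gamma> x r = local_weyl_count \<Gamma>' y r)"
proof -
  obtain xs :: "'n list" where xs: "set xs = UNIV" "distinct xs"
    using finite_distinct_list[of "UNIV :: 'n set"] by auto
  have "length xs \<ge> 4" using assms distinct_card[OF xs(2)] xs(1) by simp
  then obtain i0 i1 i2 i3 ys where "xs = i0 # i1 # i2 # i3 # ys"
    by (auto simp: numeral_eq_Suc Suc_le_length_iff)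
  with xs(2) have distinct: "distinct [i0, i1, i2, i3]" by simp
  obtain wt :: "'n \<Rightarrow> real" where wt: "\<And>i. 0 < wt i"
    "\<And>a :: 'n \<Rightarrow> int. (\<Sum>i\<in>UNIV. wt i * of_int (a i)) = 0 \<Longrightarrow> \<forall>i. a i = 0"
    using exists_independent_weights by blast
  interpret conway_sloane i0 i1 i2 i3 wt
    by unfold_locales (use distinct wt in auto)
  show ?thesis
    using full_rank_\<Gamma>[of 1] full_rank_\<Gamma>[of "-1"] not_isometric local_weyl_counts_agree
    by (intro exI[of _ "\<Gamma> 1"] exI[of _ "\<Gamma> (-1)"]) simp
qed

end
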